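(* Let $\mathbb{T}=\mathbb{R}/2\pi\mathbb{Z}$ and identify $\mathbb{S}^3\simeq\mathrm{SU}(2)$. Let $p_0,\lambda,\delta\in\mathbb{R}$, $\alpha\in\mathbb{C}\setminus\{0\}$, and $q,s\in C^\infty(\mathbb{T};\mathbb{R})$ with $q\ge 0$ and $q\not\equiv 0$. Let $P:C^\infty(\mathbb{T}\times\mathbb{S}^3)\to C^\infty(\mathbb{T}\times\mathbb{S}^3)$ be the operator $$Pu=\partial_t u+i(p_0+i\lambda q(t))\partial_0u-(s(t)+i\delta q(t))u-\alpha q(t)\overline{u}.$$ Put $$s_0=\int_0^{2\pi}s(\tau)\,d\tau,\quad q_0=\int_0^{2\pi}q(\tau)\,d\tau,\quad A_0=s_0+i\delta q_0,\quad B_0=\alpha q_0,\quad C_0=2\pi p_0+i\lambda q_0,$$ and, for $\ell\in\frac12\mathbb{N}_0$ and $m\in\{-\ell,-\ell+1,\dots,\ell\}$, $$\rho_m(\ell)=\sqrt{(\lambda m-i\delta)^2+|\alpha|^2},\qquad\operatorname{Re}\rho_m(\ell)\ge 0.$$ Suppose that: (I) $|\alpha|\neq|\delta|$; (II) there is no $(m,k)\in\frac12\mathbb{Z}\times\mathbb{Z}$ such that both $$\operatorname{Re}\bigl(A_0(2\pi k+m\overline{C_0})\bigr)=0\quad\text{and}\quad|2\pi k+mC_0|^2=|A_0|^2-|B_0|^2;$$ (III) there exists $M>0$ such that, for all $\ell\in\frac12\mathbb{N}_0$ with $\langle\ell\rangle\ge M$ and every $m\in\{-\ell,-\ell+1,\dots,\ell\}$,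 $$\min\Bigl\{\bigl|e^{-\rho_m(\ell)q_0}-e^{2\pi imp_0+s_0}\bigr|,\ \bigl|1-e^{-\rho_m(\ell)q_0+2\pi imp_0+s_0}\bigr|\Bigr\}\ge\langle\ell\rangle^{-M}.$$ Then, for every $f\in C^\infty(\mathbb{T}\times\mathbb{S}^3)$, there exists $u\in C^\infty(\mathbb{T}\times\mathbb{S}^3)$ such that $Pu=f$.
   Context: The irreducible unitary representations of $\mathrm{SU}(2)$ are indexed, up to equivalence, by $\ell\in\frac12\mathbb{N}_0$; the representation $\mathsf{t}^\ell$ has dimension $2\ell+1$, with matrix entries $\mathsf{t}^\ell_{mn}$, $m,n\in\{-\ell,-\ell+1,\dots,\ell\}$. The operator $\partial_0$ is the standard left-invariant (complexified) vector field of Fourier analysis on $\mathbb{S}^3$: $\partial_0=iX$, where $X$ is a real left-invariant vector field on $\mathrm{SU}(2)$, with symbol $\sigma_{\partial_0}(\ell)=\mathsf{t}^\ell(x)^*(\partial_0\mathsf{t}^\ell)(x)$ (the operator being applied entrywise) equal to the diagonal matrix $(m\,\delta_{mn})_{m,n}$; in particular its eigenvalues on $\mathsf{t}^\ell$ are exactly $m\in\{-\ell,\dots,\ell\}$. On $\mathbb{T}\times\mathbb{S}^3$ it acts in the $\mathbb{S}^3$-variable. The weight is $\langle\ell\rangle=(1+\nu_\ell)^{1/2}$, where $\nu_\ell=\ell(\ell+1)$ is the eigenvalue of minus the Laplace–Beltrami operator on the matrix entries of $\mathsf{t}^\ell$. *)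

theory Defs
  imports "HOL-Analysis.Analysis" "HOL-Computational_Algebra.Polynomial"
begin

section \<open>Smooth functions\<close>

text \<open>Meant for open \<^term>\<open>U\<close>, where it is the usual \<open>C\<^sup>k\<close>; directional derivatives
  determine continuity of the Frechet derivative because the domain is finite-dimensional.\<close>

primrec Ck_on :: "nat \<Rightarrow> 'a::euclidean_space set \<Rightarrow> ('a \<Rightarrow> 'b::real_normed_vector) \<Rightarrow> bool" where
  "Ck_on 0 U f \<longleftrightarrow> continuous_on U f"
| "Ck_on (Suc k) U f \<longleftrightarrow>
     (\<forall>x\<in>U. f differentiable (at x)) \<and> (\<forall>v. Ck_on k U (\<lambda>x. frechet_derivative f (at x) v))"

definition smooth_on :: "'a::euclidean_space set \<Rightarrow> ('a \<Rightarrow> 'b::real_normed_vector) \<Rightarrow> bool" where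
  "smooth_on U f \<longleftrightarrow> (\<forall>k. Ck_on k U f)"

text \<open>Functions on \<open>\<real>/2\<pi>\<int>\<close> are \<open>2\<pi>\<close>-periodic functions on \<open>\<real>\<close>.\<close>

definition smooth_circle :: "(real \<Rightarrow> 'b::real_normed_vector) \<Rightarrow> bool" where
  "smooth_circle q \<longleftrightarrow> (\<forall>t. q (t + 2 * pi) = q t) \<and> smooth_on UNIV q"


section \<open>The group SU(2)\<close>

definition SU2 :: "(complex ^ 2 ^ 2) set" where
  "SU2 = {x. x ** map_matrix cnj (transpose x) = mat 1 \<and> det x = 1}"

text \<open>Smoothness on the product of the circle with SU(2), an embedded submanifold of the space
  of complex matrices: locally the restriction of a smooth function on an open subset of the
  ambient real vector space. The values of \<^term>\<open>u t x\<close> for \<^term>\<open>x \<notin> SU2\<close> are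
  irrelevant.\<close>

definition smooth_circle_SU2 :: "(real \<Rightarrow> complex ^ 2 ^ 2 \<Rightarrow> complex) \<Rightarrow> bool" where
  "smooth_circle_SU2 u \<longleftrightarrow>
     (\<forall>t. \<forall>x\<in>SU2. u (t + 2 * pi) x = u t x) \<and>
     (\<forall>t. \<forall>x\<in>SU2. \<exists>U (g :: real \<times> (complex ^ 2 ^ 2) \<Rightarrow> complex).
        open U \<and> (t, x) \<in> U \<and> smooth_on U g \<and>
        (\<forall>\<tau>. \<forall>y\<in>SU2. (\<tau>, y) \<in> U \<longrightarrow> g (\<tau>, y) = u \<tau> y))"

definition omega :: "real \<Rightarrow> complex ^ 2 ^ 2" where
  "omega \<theta> = vector [vector [cis (\<theta> / 2), 0], vector [0, cis (- (\<theta> / 2))]]"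

text \<open>The operator \<open>\<partial>\<^sub>0 = iX\<close>, where \<open>X\<close> is the left-invariant vector field generated by the
  one-parameter subgroup \<^term>\<open>omega\<close>. Its symbol is computed in \<open>d0_rep\<close> below.\<close>

definition d0 :: "(complex ^ 2 ^ 2 \<Rightarrow> complex) \<Rightarrow> complex ^ 2 ^ 2 \<Rightarrow> complex" where
  "d0 v x = \<i> * vector_derivative (\<lambda>\<theta>. v (x ** omega \<theta>)) (at 0)"

definition half_nats :: "real set" where
  "half_nats = {real k / 2 | k :: nat. True}"

definition half_ints :: "real set" where
  "half_ints = {of_int j / 2 | j :: int. True}"

definition weights :: "real \<Rightarrow> real set" where
  "weights l = {- l + real j | j :: nat. real j \<le> 2 * l}"

definition bracket :: "real \<Rightarrow> real" where
  "bracket l = sqrt (1 + l * (l + 1))"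


subsection \<open>Normalisation of the vector field\<close>

text \<open>The irreducible representation of spin \<open>\<ell> = L/2\<close> acts on homogeneous polynomials of degree
  \<open>L\<close> in \<open>(z\<^sub>1, z\<^sub>2)\<close> by \<open>(x f)(z) = f (z x)\<close>, with \<open>z\<close> a row vector. In the orthonormal basis
  \<open>z\<^sub>1^(L - k) z\<^sub>2^k / sqrt ((L - k)! k!)\<close>, whose members have weight \<open>k - \<ell>\<close>, its matrix entries
  are the following (polynomials are dehomogenised by \<open>z\<^sub>1 = 1\<close>).\<close>

definition rep :: "nat \<Rightarrow> nat \<Rightarrow> nat \<Rightarrow> complex ^ 2 ^ 2 \<Rightarrow> complex" where
  "rep L j k x =
     of_real (sqrt (fact (L - j) * fact j / (fact (L - k) * fact k))) *
     coeff ([:x $ 1 $ 1, x $ 2 $ 1:] ^ (L - k) * [:x $ 1 $ 2, x $ 2 $ 2:] ^ k) j"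

lemma rep_mult_omega:
  assumes "k \<le> L"
  shows "rep L j k (x ** omega \<theta>) = cis ((real L / 2 - real k) * \<theta>) * rep L j k x"
proof -
  have 1: "[:(x ** omega \<theta>) $ 1 $ 1, (x ** omega \<theta>) $ 2 $ 1:]
      = smult (cis (\<theta> / 2)) [:x $ 1 $ 1, x $ 2 $ 1:]"
    by (simp add: omega_def matrix_matrix_mult_def sum_2 vector_2)
  have 2: "[:(x ** omega \<theta>) $ 1 $ 2, (x ** omega \<theta>) $ 2 $ 2:]
      = smult (cis (- (\<theta> / 2))) [:x $ 1 $ 2, x $ 2 $ 2:]"
    by (simp add: omega_def matrix_matrix_mult_def sum_2 vector_2)
  have 3: "cis (\<theta> / 2) ^ (L - k) * cis (- (\<theta> / 2)) ^ k = cis ((real L / 2 - real k) * \<theta>)"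
    unfolding Complex.DeMoivre cis_mult
    using assms by (intro arg_cong[where f = cis]) (simp add: of_nat_diff field_simps)
  show ?thesis
    unfolding rep_def 1 2 smult_power mult_smult_left mult_smult_right smult_smult
      coeff_smult 3[symmetric]
    by (simp only: mult_ac)
qed

lemma d0_rep:
  assumes "k \<le> L"
  shows "d0 (rep L j k) x = of_real (real k - real L / 2) * rep L j k x"
proof -
  let ?a = "real L / 2 - real k"
  have "((\<lambda>\<theta>. cis (?a * \<theta>) * rep L j k x) has_vector_derivative
      (\<i> * of_real ?a * cis (?a * 0)) * rep L j k x) (at 0)"
    by (intro has_vector_derivative_mult_left)
      (auto intro!: derivative_eq_intros
        simp: has_vector_derivative_def scaleR_conv_of_real mult_ac)
  hence "vector_derivative (\<lambda>\<theta>. rep L j k (x ** omega \<theta>)) (at 0)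
      = \<i> * of_real ?a * rep L j k x"
    using assms by (simp add: rep_mult_omega vector_derivative_at)
  thus ?thesis
    unfolding d0_def by (simp only:) (simp add: algebra_simps)
qed


section \<open>The operator and the associated exponents\<close>

definition P_op ::
  "real \<Rightarrow> real \<Rightarrow> real \<Rightarrow> complex \<Rightarrow> (real \<Rightarrow> real) \<Rightarrow> (real \<Rightarrow> real) \<Rightarrow>
   (real \<Rightarrow> complex ^ 2 ^ 2 \<Rightarrow> complex) \<Rightarrow> real \<Rightarrow> complex ^ 2 ^ 2 \<Rightarrow> complex" where
  "P_op p0 lam \<delta> \<alpha> q s u t x =
     vector_derivative (\<lambda>\<tau>. u \<tau> x) (at t)
     + \<i> * (of_real p0 + \<i> * of_real lam * of_real (q t)) * d0 (u t) x
     - (of_real (s t) + \<i> * of_real \<delta> * of_real (q t)) * u t x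
     - \<alpha> * of_real (q t) * cnj (u t x)"

text \<open>\<^const>\<open>csqrt\<close> has nonnegative real part. When both roots are purely imaginary this does not
  determine the root, but then the minimum in the Diophantine condition is the same for both.\<close>

definition rho :: "real \<Rightarrow> real \<Rightarrow> complex \<Rightarrow> real \<Rightarrow> complex" where
  "rho lam \<delta> \<alpha> m = csqrt ((of_real (lam * m) - \<i> * of_real \<delta>)\<^sup>2 + of_real ((cmod \<alpha>)\<^sup>2))"

end

theory Submission
  imports Defs
begin

text \<open>Right translation by the one-parameter group of the vector field splits a smooth function on the
  circle times SU(2) into Fourier modes indexed by half-integers \<open>m\<close>, rapidly decreasing with all
  derivatives; these are the weights, so no decomposition into irreducible representations is needed.
  The conjugation couples the mode \<open>m\<close> of \<open>u\<close> only with the mode \<open>m\<close> of \<open>cnj u\<close>. Treating \<open>cnj u\<close> as an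
  independent unknown \<open>v\<close> (and returning to \<open>(u + cnj v) / 2\<close> at the end) gives for each \<open>m\<close> a complex linear
  \<open>2 \<times> 2\<close> system in \<open>t\<close>, whose matrix is a scalar plus \<open>q(t) N\<close> with \<open>N\<^sup>2 = \<rho>\<^sup>2\<close>. By (I),
  \<open>|\<rho>|\<close> is bounded below, so the spectral projections \<open>(1 \<plusminus> N / \<rho>) / 2\<close> are bounded polynomially in \<open>m\<close>;
  on each eigenspace the equation is scalar, and as \<open>q\<close> is nonnegative its periodic solution is an integral with a
  bounded kernel once one integrates backward or forward in time according to the sign of the eigenvalue. The
  remaining factors are the divisors in (III), so the modes of the solution still decrease rapidly.\<close>

section \<open>Calculus of \<open>C\<^sup>k\<close> functions\<close>

text \<open>Two facts make the modes \<open>j\<close> = 2m sufficient. Condition (III) speaks of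
  pairs (l, m) with l large, but each half-integer m is a weight of arbitrarily large l; taking l =
  |m| + const bounds every divisor from below by a negative power of 1 + |m|, up to a constant, with
  no exceptional modes. Since the modes decrease rapidly in \<open>j\<close> together with all
  derivatives in all directions, a loss polynomial in \<open>j\<close> alone is harmless, and the
  variables transverse to the flow are carried along as parameters. Conjugation reverses the sign of
  \<open>d0\<close>. Hence the equations for u and for the conjugate unknown share the term -i m p0
  on mode m while their lambda-terms are opposite; this makes the matrix next to q trace-free, with
  a scalar as its square. All calculus takes place on the open set \<open>tube\<close>, to which
  functions on the group are pulled back by a retraction, so that Frechet derivatives exist. The
  flow is the restriction of a linear one on the ambient space.\<close>

lemma Ck_on_cong:
  assumes "open U" "\<And>x. x \<in> U \<Longrightarrow> f x = g x" "Ck_on k U f"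
  shows "Ck_on k U g"
  using assms(2,3)
proof (induction k arbitrary: f g)
  case 0
  then show ?case by (metis Ck_on.simps(1) continuous_on_cong)
next
  case (Suc k)
  have d: "(f has_derivative frechet_derivative f (at x)) (at x)" if "x \<in> U" for x
    using Suc.prems(2) that by (simp add: frechet_derivative_works)
  have d': "(g has_derivative frechet_derivative f (at x)) (at x)" if "x \<in> U" for x
    using has_derivative_transform_within_open[OF d[OF that] \<open>open U\<close> that] Suc.prems(1) by auto
  have e: "frechet_derivative f (at x) = frechet_derivative g (at x)" if "x \<in> U" for x
    using d'[OF that] by (rule frechet_derivative_at)
  show ?case
    unfolding Ck_on.simps
  proof (intro conjI ballI allI)
    show "g differentiable (at x)" if "x \<in> U" for x
      using d'[OF that] by (auto simp: differentiable_def)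
    show "Ck_on k U (\<lambda>x. frechet_derivative g (at x) v)" for v
      by (rule Suc.IH[of "\<lambda>x. frechet_derivative f (at x) v"]) (use e Suc.prems(2) in simp_all)
  qed
qed

text \<open>Lets later inductions name the derivative by a formula;
  \<open>frechet_derivative\<close> is identified with it by uniqueness.\<close>

lemma Ck_on_SucI:
  assumes "open U" "\<And>x. x \<in> U \<Longrightarrow> (f has_derivative f' x) (at x)" "\<And>v. Ck_on k U (\<lambda>x. f' x v)"
  shows "Ck_on (Suc k) U f"
proof -
  have "frechet_derivative f (at x) = f' x" if "x \<in> U" for x
    using assms(2)[OF that] by (metis frechet_derivative_at)
  moreover from this have "Ck_on k U (\<lambda>x. frechet_derivative f (at x) v)" for v
    by (intro Ck_on_cong[OF assms(1) _ assms(3)[of v]]) simp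
  ultimately show ?thesis
    using assms(2) unfolding Ck_on.simps differentiable_def by blast
qed

lemma Ck_on_SucD:
  assumes "Ck_on (Suc k) U f" "x \<in> U"
  shows "(f has_derivative frechet_derivative f (at x)) (at x)"
  using assms by (simp add: frechet_derivative_works)

lemma Ck_on_SucD':
  assumes "Ck_on (Suc k) U f"
  shows "Ck_on k U (\<lambda>x. frechet_derivative f (at x) v)"
  using assms by simp

lemma Ck_on_imp_continuous_on: "Ck_on k U f \<Longrightarrow> continuous_on U f"
  by (cases k) (simp_all add: differentiable_imp_continuous_on differentiable_on_def
      differentiable_at_withinI)

lemma Ck_on_Suc_imp: "Ck_on (Suc k) U f \<Longrightarrow> Ck_on k U f"
proof (induction k arbitrary: f)
  case 0
  then show ?case using Ck_on_imp_continuous_on by (metis Ck_on.simps(1))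
next
  case (Suc k)
  then show ?case unfolding Ck_on.simps(2)[of "Suc k"] Ck_on.simps(2)[of k U f] by blast
qed

text \<open>Needed because smoothness on the group is given only through local extensions.\<close>

lemma Ck_on_local:
  assumes "open U" "\<And>x. x \<in> U \<Longrightarrow> \<exists>V. open V \<and> x \<in> V \<and> Ck_on k V f"
  shows "Ck_on k U f"
  using assms(2)
proof (induction k arbitrary: f)
  case 0
  then show ?case
    using \<open>open U\<close> unfolding Ck_on.simps by (metis continuous_on_eq_continuous_at)
next
  case (Suc k)
  have "f differentiable (at x)" if "x \<in> U" for x
    using Suc.prems[OF that] unfolding Ck_on.simps by blast
  moreover have "Ck_on k U (\<lambda>x. frechet_derivative f (at x) v)" for v
  proof (rule Suc.IH)
    fix x assume "x \<in> U"
    then show "\<exists>V. open V \<and> x \<in> V \<and> Ck_on k V (\<lambda>x. frechet_derivative f (at x) v)"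
      using Suc.prems[of x] unfolding Ck_on.simps by blast
  qed
  ultimately show ?case unfolding Ck_on.simps by blast
qed

lemma Ck_on_const: "open U \<Longrightarrow> Ck_on k U (\<lambda>x. c)"
proof (induction k arbitrary: c)
  case (Suc k)
  show ?case
    by (rule Ck_on_SucI[OF \<open>open U\<close>, where f' = "\<lambda>_ _. 0"]) (use Suc in auto)
qed auto

lemma Ck_on_bounded_linear:
  assumes "open U" "bounded_linear L" "Ck_on k U f"
  shows "Ck_on k U (\<lambda>x. L (f x))"
  using assms(3)
proof (induction k arbitrary: f)
  case 0
  then show ?case using bounded_linear.continuous_on[OF assms(2)] by auto
next
  case (Suc k)
  show ?case
  proof (rule Ck_on_SucI[OF \<open>open U\<close>])
    show "((\<lambda>x. L (f x)) has_derivative (\<lambda>v. L (frechet_derivative f (at x) v))) (at x)"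
      if "x \<in> U" for x
      by (intro bounded_linear.has_derivative[OF assms(2)] Ck_on_SucD[OF Suc.prems] that)
    show "Ck_on k U (\<lambda>x. L (frechet_derivative f (at x) v))" for v
      by (intro Suc.IH Ck_on_SucD' Suc.prems)
  qed
qed

lemma Ck_on_linear:
  assumes "open U" "bounded_linear L"
  shows "Ck_on k U L"
proof (cases k)
  case 0
  then show ?thesis using assms linear_continuous_on by auto
next
  case (Suc n)
  show ?thesis unfolding Suc
    by (rule Ck_on_SucI[OF \<open>open U\<close>, where f' = "\<lambda>x v. L v"])
      (intro bounded_linear_imp_has_derivative Ck_on_const assms)+
qed

lemma Ck_on_add:
  assumes "open U" "Ck_on k U f" "Ck_on k U g"
  shows "Ck_on k U (\<lambda>x. f x + g x)"
  using assms(2,3)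
proof (induction k arbitrary: f g)
  case 0
  then show ?case by (auto intro: continuous_intros)
next
  case (Suc k)
  show ?case
    by (rule Ck_on_SucI[OF \<open>open U\<close>,
          where f' = "\<lambda>x v. frechet_derivative f (at x) v + frechet_derivative g (at x) v"])
      (intro has_derivative_add Ck_on_SucD[OF Suc.prems(1)] Ck_on_SucD[OF Suc.prems(2)]
        Suc.IH Ck_on_SucD' Suc.prems; assumption)+
qed

lemma Ck_on_sum:
  assumes "open U" "\<And>i. i \<in> I \<Longrightarrow> Ck_on k U (f i)"
  shows "Ck_on k U (\<lambda>x. \<Sum>i\<in>I. f i x)"
  using assms(2)
  by (induction I rule: infinite_finite_induct) (auto intro: Ck_on_const Ck_on_add assms(1))

lemma (in bounded_bilinear) Ck_on:
  assumes "open U" "Ck_on k U f" "Ck_on k U g"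
  shows "Ck_on k U (\<lambda>x. prod (f x) (g x))"
  using assms(2,3)
proof (induction k arbitrary: f g)
  case 0
  then show ?case by (auto intro: continuous_on)
next
  case (Suc k)
  show ?case
  proof (rule Ck_on_SucI[OF \<open>open U\<close>])
    fix x assume "x \<in> U"
    then show "((\<lambda>x. prod (f x) (g x)) has_derivative
      (\<lambda>h. prod (f x) (frechet_derivative g (at x) h) + prod (frechet_derivative f (at x) h) (g x))) (at x)"
      by (intro FDERIV Ck_on_SucD[OF Suc.prems(1)] Ck_on_SucD[OF Suc.prems(2)])
  next
    fix v
    show "Ck_on k U (\<lambda>x. prod (f x) (frechet_derivative g (at x) v) + prod (frechet_derivative f (at x) v) (g x))"
      by (intro Ck_on_add \<open>open U\<close> Suc.IH Ck_on_SucD' Ck_on_Suc_imp[OF Suc.prems(1)]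
          Ck_on_Suc_imp[OF Suc.prems(2)] Suc.prems)
  qed
qed

lemmas Ck_on_mult = bounded_bilinear.Ck_on[OF bounded_bilinear_mult]
lemmas Ck_on_scaleR = bounded_bilinear.Ck_on[OF bounded_bilinear_scaleR]
lemmas Ck_on_inner = bounded_bilinear.Ck_on[OF bounded_bilinear_inner]

text \<open>In the chain rule the outer derivative is applied to a direction that varies with the
  point, whereas \<open>Ck_on\<close> controls constant directions only. Expanding that direction in
  the basis turns the derivative into a finite sum of products to which the induction hypothesis
  applies.\<close>

lemma Ck_on_compose:
  fixes f :: "'a::euclidean_space \<Rightarrow> 'b::euclidean_space" and g :: "'b \<Rightarrow> 'c::real_normed_vector"
  assumes "open U" "open V" "f ` U \<subseteq> V" "Ck_on k U f" "Ck_on k V g"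
  shows "Ck_on k U (\<lambda>x. g (f x))"
  using assms(4,5)
proof (induction k arbitrary: g)
  case 0
  then show ?case using continuous_on_compose2[of V g U f] assms(3) by simp
next
  case (Suc k)
  let ?f' = "\<lambda>x. frechet_derivative f (at x)" and ?g' = "\<lambda>x. frechet_derivative g (at x)"
  have g: "(g has_derivative ?g' (f x)) (at (f x))" if "x \<in> U" for x
    using Ck_on_SucD[OF Suc.prems(2), of "f x"] that assms(3) by auto
  have lin: "?g' (f x) v = (\<Sum>b\<in>Basis. (v \<bullet> b) *\<^sub>R ?g' (f x) b)" if "x \<in> U" for x v
  proof -
    interpret bounded_linear "?g' (f x)" using g[OF that] by (rule has_derivative_bounded_linear)
    have "?g' (f x) v = ?g' (f x) (\<Sum>b\<in>Basis. (v \<bullet> b) *\<^sub>R b)" by (simp add: euclidean_representation)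
    also have "\<dots> = (\<Sum>b\<in>Basis. (v \<bullet> b) *\<^sub>R ?g' (f x) b)" by (simp only: sum scaleR)
    finally show ?thesis .
  qed
  show ?case
  proof (rule Ck_on_SucI[OF \<open>open U\<close>])
    fix x assume x: "x \<in> U"
    have "((g \<circ> f) has_derivative (?g' (f x) \<circ> ?f' x)) (at x)"
      by (intro diff_chain_at Ck_on_SucD[OF Suc.prems(1)] g x)
    moreover have "?g' (f x) \<circ> ?f' x = (\<lambda>v. \<Sum>b\<in>Basis. (?f' x v \<bullet> b) *\<^sub>R ?g' (f x) b)"
      unfolding o_def by (intro ext lin x)
    ultimately show "((\<lambda>x. g (f x)) has_derivative (\<lambda>v. \<Sum>b\<in>Basis. (?f' x v \<bullet> b) *\<^sub>R ?g' (f x) b)) (at x)"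
      by (simp only: o_def)
  next
    fix v
    have "Ck_on k U (\<lambda>x. ?g' (f x) b)" for b
      by (rule Suc.IH[OF Ck_on_Suc_imp[OF Suc.prems(1)] Ck_on_SucD'[OF Suc.prems(2)]])
    moreover have "Ck_on k U (\<lambda>x. ?f' x v \<bullet> b)" for b
      by (rule Ck_on_bounded_linear[OF \<open>open U\<close> bounded_linear_inner_left Ck_on_SucD'[OF Suc.prems(1)]])
    ultimately show "Ck_on k U (\<lambda>x. \<Sum>b\<in>Basis. (?f' x v \<bullet> b) *\<^sub>R ?g' (f x) b)"
      by (intro Ck_on_sum Ck_on_scaleR \<open>open U\<close>)
  qed
qed

text \<open>The exponent is generalised in the induction because differentiation lowers it by
  one.\<close>

lemma Ck_on_powr:
  fixes f :: "'a::euclidean_space \<Rightarrow> real"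
  assumes "open U" "Ck_on k U f" "\<And>x. x \<in> U \<Longrightarrow> f x > 0"
  shows "Ck_on k U (\<lambda>x. f x powr p)"
  using assms(2)
proof (induction k arbitrary: p)
  case 0
  then show ?case using assms(3) by (auto simp: less_imp_neq[symmetric] intro!: continuous_on_powr continuous_on_const)
next
  case (Suc k)
  show ?case
  proof (rule Ck_on_SucI[OF \<open>open U\<close>])
    fix x assume x: "x \<in> U"
    note d = Ck_on_SucD[OF Suc.prems x]
    have "((\<lambda>y. y powr p) has_derivative (\<lambda>h. h * (p * f x powr (p - 1)))) (at (f x))"
      by (rule has_derivative_eq_rhs[OF has_real_derivative_powr[of "f x" p, unfolded has_field_derivative_def]])
        (use assms(3)[OF x] in \<open>simp_all add: fun_eq_iff\<close>)
    from diff_chain_at[OF d this]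
    show "((\<lambda>x. f x powr p) has_derivative (\<lambda>v. frechet_derivative f (at x) v * (p * f x powr (p - 1)))) (at x)"
      by (simp add: o_def)
  next
    fix v
    show "Ck_on k U (\<lambda>x. frechet_derivative f (at x) v * (p * f x powr (p - 1)))"
      by (intro Ck_on_mult Ck_on_const \<open>open U\<close> Suc Ck_on_SucD' Ck_on_Suc_imp[OF Suc.prems])
  qed
qed

lemma frechet_derivative_lincomb:
  fixes f g :: "'a::euclidean_space \<Rightarrow> complex"
  assumes "f differentiable (at z)" "g differentiable (at z)"
  shows "frechet_derivative (\<lambda>z. c * f z + d * g z) (at z) v
    = c * frechet_derivative f (at z) v + d * frechet_derivative g (at z) v"
proof -
  have "((\<lambda>z. c * f z + d * g z) has_derivative
      (\<lambda>v. c * frechet_derivative f (at z) v + d * frechet_derivative g (at z) v)) (at z)"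
    by (intro has_derivative_add has_derivative_mult_right frechet_derivative_works[THEN iffD1] assms)
  from frechet_derivative_at[OF this, symmetric] show ?thesis by simp
qed

lemma smooth_on_frechet:
  "smooth_on U f \<Longrightarrow> smooth_on U (\<lambda>x. frechet_derivative f (at x) v)"
  unfolding smooth_on_def by (intro allI Ck_on_SucD') blast

lemma smooth_on_has_derivative:
  "smooth_on U f \<Longrightarrow> x \<in> U \<Longrightarrow> (f has_derivative frechet_derivative f (at x)) (at x)"
  unfolding smooth_on_def by (intro Ck_on_SucD) blast+

lemma smooth_on_continuous_on: "smooth_on U f \<Longrightarrow> continuous_on U f"
  unfolding smooth_on_def by (intro Ck_on_imp_continuous_on) blast

section \<open>Rapidly decreasing families\<close>

text \<open>The seminorms of rapid decrease in \<open>j\<close>, locally uniform in the point: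
  nothing is claimed near the boundary of \<open>U\<close>.\<close>

definition rapid0 :: "'a::euclidean_space set \<Rightarrow> (int \<Rightarrow> 'a \<Rightarrow> complex) \<Rightarrow> bool" where
  "rapid0 U a \<longleftrightarrow> (\<forall>j. continuous_on U (a j)) \<and>
     (\<forall>N K. compact K \<longrightarrow> K \<subseteq> U \<longrightarrow>
        (\<exists>C. \<forall>j. \<forall>z\<in>K. cmod (a j z) * (1 + \<bar>real_of_int j\<bar>) ^ N \<le> C))"

text \<open>The recursion runs parallel to that of \<open>Ck_on\<close>, so that a sum over
  \<open>j\<close> can be differentiated level by level in \<open>zsum_Ck_on\<close>.\<close>

primrec rapid :: "nat \<Rightarrow> 'a::euclidean_space set \<Rightarrow> (int \<Rightarrow> 'a \<Rightarrow> complex) \<Rightarrow> bool" where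
  "rapid 0 U a \<longleftrightarrow> rapid0 U a"
| "rapid (Suc k) U a \<longleftrightarrow> rapid0 U a \<and> (\<forall>j. \<forall>x\<in>U. a j differentiable (at x)) \<and>
     (\<forall>v. rapid k U (\<lambda>j x. frechet_derivative (a j) (at x) v))"

text \<open>The multipliers that preserve rapid decrease. Inverse divisors, eigenvalues and the
  entries of the spectral projections are of this kind.\<close>

definition poly_bdd :: "(int \<Rightarrow> complex) \<Rightarrow> bool" where
  "poly_bdd \<kappa> \<longleftrightarrow> (\<exists>C N. \<forall>j. cmod (\<kappa> j) \<le> C * (1 + \<bar>real_of_int j\<bar>) ^ N)"

lemma rapid0D:
  assumes "rapid0 U a" "compact K" "K \<subseteq> U"
  obtains C where "C \<ge> 0" "\<And>j z. z \<in> K \<Longrightarrow> cmod (a j z) * (1 + \<bar>real_of_int j\<bar>) ^ N \<le> C"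
proof -
  obtain C where C: "\<forall>j. \<forall>z\<in>K. cmod (a j z) * (1 + \<bar>real_of_int j\<bar>) ^ N \<le> C"
    using assms unfolding rapid0_def by blast
  show ?thesis by (rule that[of "max 0 C"]) (use C in \<open>auto simp: le_max_iff_disj\<close>)
qed

lemma rapid_imp_rapid0: "rapid k U a \<Longrightarrow> rapid0 U a"
  by (cases k) simp_all

lemma rapid0_cong:
  assumes "\<And>j x. x \<in> U \<Longrightarrow> a j x = b j x" "rapid0 U a"
  shows "rapid0 U b"
  unfolding rapid0_def
proof (intro conjI allI impI)
  show "continuous_on U (b j)" for j
    using assms(2) continuous_on_cong[OF refl assms(1), of U] unfolding rapid0_def by simp
  fix N K assume K: "compact K" "K \<subseteq> U"
  obtain C where C: "\<And>j z. z \<in> K \<Longrightarrow> cmod (a j z) * (1 + \<bar>real_of_int j\<bar>) ^ N \<le> C"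
    by (rule rapid0D[OF assms(2) K, where N = "N"]) blast
  show "\<exists>C. \<forall>j. \<forall>z\<in>K. cmod (b j z) * (1 + \<bar>real_of_int j\<bar>) ^ N \<le> C"
  proof (intro exI allI ballI)
    fix j z assume "z \<in> K"
    then show "cmod (b j z) * (1 + \<bar>real_of_int j\<bar>) ^ N \<le> C"
      using C[of z j] assms(1)[of z j] K(2) by auto
  qed
qed

lemma rapid_cong:
  assumes "open U" "\<And>j x. x \<in> U \<Longrightarrow> a j x = b j x" "rapid k U a"
  shows "rapid k U b"
  using assms(2,3)
proof (induction k arbitrary: a b)
  case 0
  then show ?case using rapid0_cong[of U a b] by simp
next
  case (Suc k)
  have d: "(b j has_derivative frechet_derivative (a j) (at x)) (at x)" if "x \<in> U" for x j
  proof -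
    have "(a j has_derivative frechet_derivative (a j) (at x)) (at x)"
      using Suc.prems(2) that by (simp add: frechet_derivative_works)
    then show ?thesis
      by (rule has_derivative_transform_within_open[OF _ \<open>open U\<close> that]) (use Suc.prems(1) in auto)
  qed
  have e: "frechet_derivative (a j) (at x) = frechet_derivative (b j) (at x)" if "x \<in> U" for x j
    using d[OF that] by (rule frechet_derivative_at)
  show ?case
    unfolding rapid.simps
  proof (intro conjI ballI allI)
    show "rapid0 U b"
      using rapid0_cong[of U a b] Suc.prems by simp
    show "b j differentiable (at x)" if "x \<in> U" for x j
      using d[OF that] by (auto simp: differentiable_def)
    show "rapid k U (\<lambda>j x. frechet_derivative (b j) (at x) v)" for v
      by (rule Suc.IH[of "\<lambda>j x. frechet_derivative (a j) (at x) v"]) (use e Suc.prems(2) in simp_all)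
  qed
qed

lemma rapid_SucI:
  assumes "open U" "rapid0 U a" "\<And>j x. x \<in> U \<Longrightarrow> (a j has_derivative a' j x) (at x)"
    "\<And>v. rapid k U (\<lambda>j x. a' j x v)"
  shows "rapid (Suc k) U a"
proof -
  have e: "a' j x = frechet_derivative (a j) (at x)" if "x \<in> U" for j x
    using assms(3)[OF that] by (metis frechet_derivative_at)
  have "rapid k U (\<lambda>j x. frechet_derivative (a j) (at x) v)" for v
    by (rule rapid_cong[OF assms(1) _ assms(4)[of v]]) (simp add: e)
  then show ?thesis
    using assms(2,3) unfolding rapid.simps differentiable_def by blast
qed

lemma rapid_SucD:
  assumes "rapid (Suc k) U a" "x \<in> U"
  shows "(a j has_derivative frechet_derivative (a j) (at x)) (at x)"
  using assms by (simp add: frechet_derivative_works)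

lemma rapid_SucD':
  assumes "rapid (Suc k) U a"
  shows "rapid k U (\<lambda>j x. frechet_derivative (a j) (at x) v)"
  using assms by simp

lemma rapid_Suc_imp: "rapid (Suc k) U a \<Longrightarrow> rapid k U a"
proof (induction k arbitrary: a)
  case 0
  then show ?case by simp
next
  case (Suc k)
  then show ?case unfolding rapid.simps(2)[of "Suc k"] rapid.simps(2)[of k U a] by blast
qed

lemma rapid0_add:
  assumes "rapid0 U a" "rapid0 U b"
  shows "rapid0 U (\<lambda>j x. a j x + b j x)"
  unfolding rapid0_def
proof (intro conjI allI impI)
  show "continuous_on U (\<lambda>x. a j x + b j x)" for j
    using assms unfolding rapid0_def by (intro continuous_on_add) auto
  fix N K assume K: "compact K" "K \<subseteq> U"
  obtain C where C: "\<And>j z. z \<in> K \<Longrightarrow> cmod (a j z) * (1 + \<bar>real_of_int j\<bar>) ^ N \<le> C"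
    by (rule rapid0D[OF assms(1) K, where N = "N"]) blast
  obtain D where D: "\<And>j z. z \<in> K \<Longrightarrow> cmod (b j z) * (1 + \<bar>real_of_int j\<bar>) ^ N \<le> D"
    by (rule rapid0D[OF assms(2) K, where N = "N"]) blast
  show "\<exists>C. \<forall>j. \<forall>z\<in>K. cmod (a j z + b j z) * (1 + \<bar>real_of_int j\<bar>) ^ N \<le> C"
  proof (intro exI allI ballI)
    fix j z assume z: "z \<in> K"
    have "cmod (a j z + b j z) * (1 + \<bar>real_of_int j\<bar>) ^ N
        \<le> (cmod (a j z) + cmod (b j z)) * (1 + \<bar>real_of_int j\<bar>) ^ N"
      by (intro mult_right_mono norm_triangle_ineq) auto
    also have "\<dots> \<le> C + D"
      using C[OF z, of j] D[OF z, of j] by (simp add: distrib_right)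
    finally show "cmod (a j z + b j z) * (1 + \<bar>real_of_int j\<bar>) ^ N \<le> C + D" .
  qed
qed

lemma rapid_add:
  assumes "open U" "rapid k U a" "rapid k U b"
  shows "rapid k U (\<lambda>j x. a j x + b j x)"
  using assms(2,3)
proof (induction k arbitrary: a b)
  case 0
  then show ?case using rapid0_add by auto
next
  case (Suc k)
  show ?case
  proof (rule rapid_SucI[OF \<open>open U\<close>])
    show "rapid0 U (\<lambda>j x. a j x + b j x)"
      by (intro rapid0_add rapid_imp_rapid0[OF Suc.prems(1)] rapid_imp_rapid0[OF Suc.prems(2)])
    show "((\<lambda>x. a j x + b j x) has_derivative
      (\<lambda>v. frechet_derivative (a j) (at x) v + frechet_derivative (b j) (at x) v)) (at x)"
      if "x \<in> U" for j x
      by (intro has_derivative_add rapid_SucD[OF Suc.prems(1)] rapid_SucD[OF Suc.prems(2)] that)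
    show "rapid k U (\<lambda>j x. frechet_derivative (a j) (at x) v + frechet_derivative (b j) (at x) v)" for v
      by (rule Suc.IH[OF rapid_SucD'[OF Suc.prems(1)] rapid_SucD'[OF Suc.prems(2)]])
  qed
qed

lemma rapid0_mult:
  assumes "rapid0 U a" "poly_bdd \<kappa>" "continuous_on U \<phi>"
  shows "rapid0 U (\<lambda>j x. \<kappa> j * \<phi> x * a j x)"
  unfolding rapid0_def
proof (intro conjI allI impI)
  show "continuous_on U (\<lambda>x. \<kappa> j * \<phi> x * a j x)" for j
    using assms unfolding rapid0_def by (intro continuous_intros) auto
  fix N K assume K: "compact K" "K \<subseteq> U"
  obtain C1 N1 where \<kappa>: "\<And>j. cmod (\<kappa> j) \<le> C1 * (1 + \<bar>real_of_int j\<bar>) ^ N1"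
    using assms(2) unfolding poly_bdd_def by blast
  \<comment> \<open>\<open>N1\<close> further powers of the weight pay for the growth of
    \<open>\<kappa>\<close>.\<close>
  obtain C where C: "C \<ge> 0" "\<And>j z. z \<in> K \<Longrightarrow> cmod (a j z) * (1 + \<bar>real_of_int j\<bar>) ^ (N + N1) \<le> C"
    by (rule rapid0D[OF assms(1) K, where N = "(N + N1)"]) blast
  have "compact (\<phi> ` K)"
    by (intro compact_continuous_image continuous_on_subset[OF assms(3)] K)
  then obtain D where D: "\<And>z. z \<in> K \<Longrightarrow> cmod (\<phi> z) \<le> D"
    by (meson bounded_iff compact_imp_bounded imageI)
  have "cmod (\<kappa> 0) \<le> C1" using \<kappa>[of 0] by simp
  then have C1: "C1 \<ge> 0" using norm_ge_zero order_trans by blast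
  show "\<exists>C. \<forall>j. \<forall>z\<in>K. cmod (\<kappa> j * \<phi> z * a j z) * (1 + \<bar>real_of_int j\<bar>) ^ N \<le> C"
  proof (intro exI allI ballI)
    fix j z assume z: "z \<in> K"
    have D0: "0 \<le> D" using D[OF z] norm_ge_zero order_trans by blast
    have "cmod (\<kappa> j * \<phi> z * a j z) * (1 + \<bar>real_of_int j\<bar>) ^ N
        = cmod (\<kappa> j) * (cmod (\<phi> z) * (cmod (a j z) * (1 + \<bar>real_of_int j\<bar>) ^ N))"
      by (simp add: norm_mult)
    also have "\<dots> \<le> (C1 * (1 + \<bar>real_of_int j\<bar>) ^ N1) * (D * (cmod (a j z) * (1 + \<bar>real_of_int j\<bar>) ^ N))"
      by (intro mult_mono \<kappa> D z) (auto simp: C1 D0)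
    also have "\<dots> = C1 * D * (cmod (a j z) * (1 + \<bar>real_of_int j\<bar>) ^ (N + N1))"
      by (simp add: power_add algebra_simps)
    also have "\<dots> \<le> C1 * D * C"
      by (intro mult_left_mono C z) (auto simp: C1 D0)
    finally show "cmod (\<kappa> j * \<phi> z * a j z) * (1 + \<bar>real_of_int j\<bar>) ^ N \<le> C1 * D * C" .
  qed
qed

lemma rapid_mult:
  assumes "open U" "poly_bdd \<kappa>" "rapid k U a" "Ck_on k U \<phi>"
  shows "rapid k U (\<lambda>j x. \<kappa> j * \<phi> x * a j x)"
  using assms(3,4)
proof (induction k arbitrary: a \<phi>)
  case 0
  then show ?case using rapid0_mult assms(2) by auto
next
  case (Suc k)
  let ?a' = "\<lambda>j x. frechet_derivative (a j) (at x)" and ?\<phi>' = "\<lambda>x. frechet_derivative \<phi> (at x)"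
  show ?case
  proof (rule rapid_SucI[OF \<open>open U\<close>])
    show "rapid0 U (\<lambda>j x. \<kappa> j * \<phi> x * a j x)"
      by (intro rapid0_mult rapid_imp_rapid0[OF Suc.prems(1)] assms(2) Ck_on_imp_continuous_on[OF Suc.prems(2)])
    show "((\<lambda>x. \<kappa> j * \<phi> x * a j x) has_derivative
      (\<lambda>v. \<kappa> j * \<phi> x * ?a' j x v + \<kappa> j * ?\<phi>' x v * a j x)) (at x)"
      if "x \<in> U" for j x
      by (intro has_derivative_mult has_derivative_mult_right
          rapid_SucD[OF Suc.prems(1)] Ck_on_SucD[OF Suc.prems(2)] that)
    show "rapid k U (\<lambda>j x. \<kappa> j * \<phi> x * ?a' j x v + \<kappa> j * ?\<phi>' x v * a j x)" for v
      by (rule rapid_add[OF \<open>open U\<close> Suc.IH[OF rapid_SucD'[OF Suc.prems(1)] Ck_on_Suc_imp[OF Suc.prems(2)]]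
          Suc.IH[OF rapid_Suc_imp[OF Suc.prems(1)] Ck_on_SucD'[OF Suc.prems(2)]]])
  qed
qed

lemma rapid_cmult:
  assumes "open U" "poly_bdd \<kappa>" "rapid k U a"
  shows "rapid k U (\<lambda>j x. \<kappa> j * a j x)"
  using rapid_mult[OF assms Ck_on_const[OF assms(1), of k 1]] by simp

lemma rapid_lincomb:
  assumes "open U" "poly_bdd c" "poly_bdd d" "rapid k U f" "rapid k U g"
  shows "rapid k U (\<lambda>j z. c j * f j z + d j * g j z)"
  using assms by (intro rapid_add rapid_cmult)

text \<open>The weight is moderate: 1 + |j| is at most (1 + |d|)(1 + |j + d|). Shifts by 1 and -1
  occur when modes are differentiated, see \<open>fcoef_derivative_formula\<close>.\<close>

lemma rapid0_shift:
  assumes "rapid0 U a"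
  shows "rapid0 U (\<lambda>j. a (j + d))"
  unfolding rapid0_def
proof (intro conjI allI impI)
  show "continuous_on U (a (j + d))" for j
    using assms unfolding rapid0_def by blast
  fix N K assume K: "compact K" "K \<subseteq> U"
  obtain C where C: "\<And>j z. z \<in> K \<Longrightarrow> cmod (a j z) * (1 + \<bar>real_of_int j\<bar>) ^ N \<le> C"
    by (rule rapid0D[OF assms K, where N = "N"]) blast
  show "\<exists>C. \<forall>j. \<forall>z\<in>K. cmod (a (j + d) z) * (1 + \<bar>real_of_int j\<bar>) ^ N \<le> C"
  proof (intro exI allI ballI)
    fix j z assume z: "z \<in> K"
    let ?m = "1 + \<bar>real_of_int (j + d)\<bar>" and ?e = "1 + \<bar>real_of_int d\<bar>"
    have "1 + \<bar>real_of_int j\<bar> \<le> 1 + (\<bar>real_of_int (j + d)\<bar> + \<bar>real_of_int d\<bar>)"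
      by auto
    also have "\<dots> \<le> ?e * ?m"
      by (simp add: algebra_simps)
    finally have "(1 + \<bar>real_of_int j\<bar>) ^ N \<le> (?e * ?m) ^ N"
      by (rule power_mono) simp
    then have "cmod (a (j + d) z) * (1 + \<bar>real_of_int j\<bar>) ^ N \<le> cmod (a (j + d) z) * (?e * ?m) ^ N"
      by (rule mult_left_mono) simp
    also have "\<dots> = ?e ^ N * (cmod (a (j + d) z) * ?m ^ N)"
      by (simp only: power_mult_distrib mult_ac)
    also have "\<dots> \<le> ?e ^ N * C"
      by (intro mult_left_mono C z) simp
    finally show "cmod (a (j + d) z) * (1 + \<bar>real_of_int j\<bar>) ^ N \<le> ?e ^ N * C" .
  qed
qed

lemma rapid_shift:
  "rapid k U a \<Longrightarrow> rapid k U (\<lambda>j. a (j + d))"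
proof (induction k arbitrary: a)
  case 0
  then show ?case using rapid0_shift by auto
next
  case (Suc k)
  then show ?case using rapid0_shift Suc.IH[OF rapid_SucD'[OF Suc.prems]] by auto
qed

subsection \<open>Summation over the integers\<close>

text \<open>Pairing n with -n - 1 visits each integer once, and the n-th partial sum runs over -n,
  ..., n - 1; over such a range the sums in \<open>fourier_inversion\<close> telescope.\<close>

definition zterm :: "(int \<Rightarrow> 'b::ab_group_add) \<Rightarrow> nat \<Rightarrow> 'b" where
  "zterm c n = c (int n) + c (- int n - 1)"

definition zsum :: "(int \<Rightarrow> complex) \<Rightarrow> complex" where
  "zsum c = (\<Sum>n. zterm c n)"

text \<open>Both indices in the n-th pair satisfy 1 + |j| >= n + 1, so the weight of order 2 already
  gives a summable majorant, uniform on \<open>K\<close>.\<close>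

lemma rapid0_zterm_bound:
  assumes "rapid0 U a" "compact K" "K \<subseteq> U"
  obtains C where "C \<ge> 0" "\<And>n z. z \<in> K \<Longrightarrow> cmod (zterm (\<lambda>j. a j z) n) \<le> C * (1 / real (Suc n) ^ 2)"
proof -
  obtain C where C: "C \<ge> 0" "\<And>j z. z \<in> K \<Longrightarrow> cmod (a j z) * (1 + \<bar>real_of_int j\<bar>) ^ 2 \<le> C"
    by (rule rapid0D[OF assms, where N = "2"]) blast
  show ?thesis
  proof (rule that[of "2 * C"])
    fix n z assume z: "z \<in> K"
    have *: "cmod (a j z) \<le> C * (1 / real (Suc n) ^ 2)" if "real (Suc n) \<le> 1 + \<bar>real_of_int j\<bar>" for j
    proof -
      have "cmod (a j z) * real (Suc n) ^ 2 \<le> cmod (a j z) * (1 + \<bar>real_of_int j\<bar>) ^ 2"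
        by (intro mult_left_mono power_mono that) auto
      also have "\<dots> \<le> C" by (rule C(2)[OF z])
      finally show ?thesis by (simp add: field_simps)
    qed
    have "cmod (zterm (\<lambda>j. a j z) n) \<le> cmod (a (int n) z) + cmod (a (- int n - 1) z)"
      unfolding zterm_def by (rule norm_triangle_ineq)
    also have "\<dots> \<le> 2 * C * (1 / real (Suc n) ^ 2)"
      using *[of "int n"] *[of "- int n - 1"] by simp
    finally show "cmod (zterm (\<lambda>j. a j z) n) \<le> 2 * C * (1 / real (Suc n) ^ 2)" .
  qed (use C in simp)
qed

lemma summable_inverse_Suc_squares: "summable (\<lambda>n. C * (1 / real (Suc n) ^ 2))"
  using sums_summable[OF inverse_squares_sums] by (intro summable_mult) (simp add: add.commute)

lemma rapid0_summable:
  assumes "rapid0 U a" "z \<in> U"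
  shows "summable (zterm (\<lambda>j. a j z))"
proof -
  have "compact {z}" "{z} \<subseteq> U" using assms(2) by simp_all
  then obtain C where "\<And>n y. y \<in> {z} \<Longrightarrow> cmod (zterm (\<lambda>j. a j y) n) \<le> C * (1 / real (Suc n) ^ 2)"
    by (rule rapid0_zterm_bound[OF assms(1)]) blast
  then have "\<exists>N. \<forall>n\<ge>N. cmod (zterm (\<lambda>j. a j z) n) \<le> C * (1 / real (Suc n) ^ 2)"
    by blast
  then show ?thesis
    by (rule summable_comparison_test[OF _ summable_inverse_Suc_squares[of C]])
qed

lemma zsum_sums:
  assumes "rapid0 U a" "z \<in> U"
  shows "zterm (\<lambda>j. a j z) sums zsum (\<lambda>j. a j z)"
  unfolding zsum_def by (rule summable_sums[OF rapid0_summable[OF assms]])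

lemma rapid0_uniform_limit:
  assumes "rapid0 U a" "compact K" "K \<subseteq> U"
  shows "uniform_limit K (\<lambda>n z. \<Sum>i<n. zterm (\<lambda>j. a j z) i) (\<lambda>z. zsum (\<lambda>j. a j z)) sequentially"
proof -
  obtain C where "\<And>n z. z \<in> K \<Longrightarrow> cmod (zterm (\<lambda>j. a j z) n) \<le> C * (1 / real (Suc n) ^ 2)"
    by (rule rapid0_zterm_bound[OF assms]) blast
  then show ?thesis
    unfolding zsum_def
    by (intro Weierstrass_m_test[OF _ summable_inverse_Suc_squares[of C]]) blast
qed

lemma zsum_continuous_on:
  assumes "open U" "rapid0 U a"
  shows "continuous_on U (\<lambda>z. zsum (\<lambda>j. a j z))"
proof -
  have "isCont (\<lambda>z. zsum (\<lambda>j. a j z)) z" if z: "z \<in> U" for z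
  proof -
    obtain e where e: "e > 0" "cball z e \<subseteq> U"
      using \<open>open U\<close> z open_contains_cball by blast
    have "continuous_on (cball z e) (\<lambda>z. zsum (\<lambda>j. a j z))"
    proof (rule uniform_limit_theorem[OF _ rapid0_uniform_limit[OF assms(2) compact_cball e(2)]])
      have "continuous_on (cball z e) (a j)" for j
        by (rule continuous_on_subset[OF _ e(2)]) (use assms(2) in \<open>simp add: rapid0_def\<close>)
      then show "\<forall>\<^sub>F n in sequentially. continuous_on (cball z e) (\<lambda>z. \<Sum>i<n. zterm (\<lambda>j. a j z) i)"
        unfolding zterm_def
        by (intro always_eventually allI continuous_on_sum continuous_on_add) simp_all
    qed simp
    then show ?thesis
      by (rule continuous_on_interior) (use e(1) in simp)
  qed
  then show ?thesis by (simp add: continuous_at_imp_continuous_on)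
qed

text \<open>Reduces a bound uniform in the direction, as \<open>has_derivative_series\<close>
  requires, to finitely many basis directions.\<close>

lemma linear_cmod_le_Basis:
  fixes L :: "'a::euclidean_space \<Rightarrow> complex"
  assumes "linear L" "\<And>b. b \<in> Basis \<Longrightarrow> cmod (L b) \<le> e"
  shows "cmod (L h) \<le> real (DIM('a)) * e * norm h"
proof -
  have "L h = L (\<Sum>b\<in>Basis. (h \<bullet> b) *\<^sub>R b)"
    by (simp add: euclidean_representation)
  also have "\<dots> = (\<Sum>b\<in>Basis. (h \<bullet> b) *\<^sub>R L b)"
    by (simp only: linear_sum[OF assms(1)] linear_scale[OF assms(1)])
  also have "cmod \<dots> \<le> (\<Sum>b\<in>(Basis::'a set). e * norm h)"
  proof (rule sum_norm_le)
    fix b :: 'a assume b: "b \<in> Basis"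
    have "e \<ge> 0" using order_trans[OF norm_ge_zero assms(2)[OF b]] .
    from mult_mono[OF assms(2)[OF b] Basis_le_norm[OF b, of h] this abs_ge_zero]
    show "cmod ((h \<bullet> b) *\<^sub>R L b) \<le> e * norm h"
      by (simp add: mult.commute)
  qed
  finally show ?thesis by simp
qed

text \<open>Rapid decrease makes the differentiated series converge uniformly for each fixed
  direction. The finitely many basis directions upgrade this to convergence in operator norm on a
  closed ball, where the series may be differentiated termwise.\<close>

lemma zsum_has_derivative:
  fixes a :: "int \<Rightarrow> 'a::euclidean_space \<Rightarrow> complex"
  assumes "open U" "rapid (Suc k) U a" "z \<in> U"
  shows "((\<lambda>z. zsum (\<lambda>j. a j z)) has_derivative
           (\<lambda>v. zsum (\<lambda>j. frechet_derivative (a j) (at z) v))) (at z)"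
proof -
  define a' where "a' = (\<lambda>j z. frechet_derivative (a j) (at z))"
  have d: "(a j has_derivative a' j z) (at z)" if "z \<in> U" for j z
    unfolding a'_def by (rule rapid_SucD[OF assms(2) that])
  have r: "rapid0 U (\<lambda>j z. a' j z v)" for v
    unfolding a'_def by (rule rapid_imp_rapid0[OF rapid_SucD'[OF assms(2)]])
  obtain e where e: "e > 0" "cball z e \<subseteq> U"
    using \<open>open U\<close> assms(3) open_contains_cball by blast
  let ?S = "cball z e" and ?g = "\<lambda>z v. zsum (\<lambda>j. a' j z v)"
  have lin_a': "linear (a' j z)" if "z \<in> U" for j z
    by (rule has_derivative_linear[OF d[OF that]])
  have sums': "zterm (\<lambda>j. a' j z v) sums ?g z v" if "z \<in> U" for z v
    by (rule zsum_sums[OF r that])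
  have lin_g: "linear (?g z)" if z: "z \<in> U" for z
  proof (rule linearI)
    fix v w
    have "zterm (\<lambda>j. a' j z (v + w)) = (\<lambda>n. zterm (\<lambda>j. a' j z v) n + zterm (\<lambda>j. a' j z w) n)"
      unfolding zterm_def by (auto simp: linear_add[OF lin_a'[OF z]])
    then show "?g z (v + w) = ?g z v + ?g z w"
      using sums_add[OF sums'[OF z, of v] sums'[OF z, of w]]
      by (intro sums_unique2[OF sums'[OF z, of "v + w"]]) (simp only:)
  next
    fix c v
    have "zterm (\<lambda>j. a' j z (c *\<^sub>R v)) = (\<lambda>n. c *\<^sub>R zterm (\<lambda>j. a' j z v) n)"
      unfolding zterm_def by (auto simp: linear_scale[OF lin_a'[OF z]] scaleR_add_right)
    then show "?g z (c *\<^sub>R v) = c *\<^sub>R ?g z v"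
      using sums_scaleR_right[OF sums'[OF z, of v], of c]
      by (intro sums_unique2[OF sums'[OF z, of "c *\<^sub>R v"]]) (simp only:)
  qed
  have "\<exists>g. \<forall>x\<in>?S. (\<lambda>n. zterm (\<lambda>j. a j x) n) sums g x \<and> (g has_derivative ?g x) (at x within ?S)"
  proof (rule has_derivative_series[where x = z and l = "zsum (\<lambda>j. a j z)"])
    show "((\<lambda>x. zterm (\<lambda>j. a j x) n) has_derivative (\<lambda>v. zterm (\<lambda>j. a' j x v) n)) (at x within ?S)"
      if "x \<in> ?S" for n x
      unfolding zterm_def
      using that e by (intro has_derivative_add has_derivative_at_withinI[OF d]) auto
    fix \<epsilon> :: real assume \<epsilon>: "\<epsilon> > 0"
    \<comment> \<open>The dimension factor lost in \<open>linear_cmod_le_Basis\<close> is paid in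
      advance.\<close>
    let ?\<epsilon> = "\<epsilon> / real DIM('a)"
    have "?\<epsilon> > 0" using \<epsilon> by simp
    then have "\<forall>\<^sub>F n in sequentially. \<forall>x\<in>?S. dist (\<Sum>i<n. zterm (\<lambda>j. a' j x b) i) (?g x b) < ?\<epsilon>" for b
      using rapid0_uniform_limit[OF r compact_cball e(2)] unfolding uniform_limit_iff by blast
    then have "\<forall>\<^sub>F n in sequentially. \<forall>b\<in>(Basis::'a set). \<forall>x\<in>?S.
        dist (\<Sum>i<n. zterm (\<lambda>j. a' j x b) i) (?g x b) < ?\<epsilon>"
      by (intro eventually_ball_finite[OF finite_Basis] ballI)
    then show "\<forall>\<^sub>F n in sequentially. \<forall>x\<in>?S. \<forall>h.
        cmod ((\<Sum>i<n. zterm (\<lambda>j. a' j x h) i) - ?g x h) \<le> \<epsilon> * norm h"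
    proof eventually_elim
      case (elim n)
      show ?case
      proof (intro ballI allI)
        fix x h assume x: "x \<in> ?S"
        then have xU: "x \<in> U" using e by auto
        have "linear (\<lambda>h. (\<Sum>i<n. zterm (\<lambda>j. a' j x h) i) - ?g x h)"
          unfolding zterm_def
          using lin_g[OF xU] lin_a'[OF xU]
          by (intro linear_compose_sub linear_compose_sum linear_compose_add ballI)
        from linear_cmod_le_Basis[OF this, of ?\<epsilon> h]
        show "cmod ((\<Sum>i<n. zterm (\<lambda>j. a' j x h) i) - ?g x h) \<le> \<epsilon> * norm h"
          using elim x by (simp add: dist_norm less_imp_le)
      qed
    qed
  next
    show "z \<in> ?S" using e by simp
    show "zterm (\<lambda>j. a j z) sums zsum (\<lambda>j. a j z)"
      by (rule zsum_sums[OF rapid_imp_rapid0[OF assms(2)] assms(3)])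
  qed simp
  \<comment> \<open>The limit \<open>g\<close> is anonymous; uniqueness of sums identifies it with
    \<open>zsum\<close> near \<open>z\<close> below.\<close>
  then obtain g where "\<forall>x\<in>?S. zterm (\<lambda>j. a j x) sums g x \<and> (g has_derivative ?g x) (at x within ?S)"
    by (rule exE)
  then have g: "zterm (\<lambda>j. a j x) sums g x" "(g has_derivative ?g x) (at x within ?S)" if "x \<in> ?S" for x
    using that by blast+
  have "at z within ?S = at z"
    by (rule at_within_interior) (use e in simp)
  then have gz: "(g has_derivative ?g z) (at z)"
    using g(2)[of z] e(1) by (simp only: centre_in_cball less_imp_le)
  have "((\<lambda>z. zsum (\<lambda>j. a j z)) has_derivative ?g z) (at z)"
  proof (rule has_derivative_transform_within_open[OF gz open_ball[of z e]])
    show "g x = zsum (\<lambda>j. a j x)" if "x \<in> ball z e" for x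
      unfolding zsum_def by (rule sums_unique[OF g(1)]) (use that in simp)
  qed (use e in simp)
  then show ?thesis unfolding a'_def .
qed

lemma zsum_frechet:
  assumes "open U" "rapid (Suc k) U u" "z \<in> U"
  shows "zterm (\<lambda>j. frechet_derivative (u j) (at z) v) sums frechet_derivative (\<lambda>z. zsum (\<lambda>j. u j z)) (at z) v"
proof -
  have "frechet_derivative (\<lambda>z. zsum (\<lambda>j. u j z)) (at z) v = zsum (\<lambda>j. frechet_derivative (u j) (at z) v)"
    unfolding frechet_derivative_at[OF zsum_has_derivative[OF assms], symmetric] ..
  then show ?thesis
    using zsum_sums[OF rapid_imp_rapid0[OF rapid_SucD'[OF assms(2)]] assms(3)] by simp
qed

text \<open>Has the shape of the right-hand sides of \<open>pair_system\<close>: \<open>x1\<close>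
  is the unknown itself, \<open>x2\<close> its derivative along the flow, \<open>x3\<close> the
  other unknown and \<open>x4\<close> the inhomogeneity.\<close>

lemma zterm_lincomb:
  fixes a b c d :: complex
  assumes "zterm x1 sums y1" "zterm x2 sums y2" "zterm x3 sums y3" "zterm x4 sums y4"
  shows "zterm (\<lambda>j. a * x1 j + b * x2 j + c * (d * x1 j + e * x3 j) + x4 j) sums (a * y1 + b * y2 + c * (d * y1 + e * y3) + y4)"
proof -
  have "zterm (\<lambda>j. a * x1 j + b * x2 j + c * (d * x1 j + e * x3 j) + x4 j)
     = (\<lambda>n. a * zterm x1 n + b * zterm x2 n + c * (d * zterm x1 n + e * zterm x3 n) + zterm x4 n)"
    unfolding zterm_def by (rule ext) (simp add: algebra_simps)
  then show ?thesis
    using assms by (simp only:) (intro sums_add sums_mult)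
qed

lemma zsum_Ck_on:
  assumes "open U" "rapid k U a"
  shows "Ck_on k U (\<lambda>z. zsum (\<lambda>j. a j z))"
  using assms(2)
proof (induction k arbitrary: a)
  case 0
  then show ?case using zsum_continuous_on[OF assms(1)] by simp
next
  case (Suc k)
  show ?case
    by (rule Ck_on_SucI[OF assms(1) zsum_has_derivative[OF assms(1) Suc.prems]
          Suc.IH[OF rapid_SucD'[OF Suc.prems]]])
qed

section \<open>Parameter integrals\<close>

text \<open>\<open>leibniz_rule\<close> asks for a continuous family of bounded linear maps. In
  finite dimension this follows from continuity in each fixed direction, the form in which
  derivatives are available here.\<close>

lemma integral_has_derivative:
  fixes h :: "'a::euclidean_space \<Rightarrow> real \<Rightarrow> complex"
  assumes "open U" "z \<in> U"
    and der: "\<And>r z. r \<in> {a..b} \<Longrightarrow> z \<in> U \<Longrightarrow> ((\<lambda>z. h z r) has_derivative h' z r) (at z)"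
    and cont: "\<And>z. z \<in> U \<Longrightarrow> continuous_on {a..b} (h z)"
    and cont': "\<And>v. continuous_on (U \<times> {a..b}) (\<lambda>p. h' (fst p) (snd p) v)"
  shows "((\<lambda>z. integral {a..b} (h z)) has_derivative (\<lambda>v. integral {a..b} (\<lambda>r. h' z r v))) (at z)"
proof -
  obtain e where e: "e > 0" "ball z e \<subseteq> U"
    using assms(1,2) open_contains_ball by blast
  \<comment> \<open>\<open>Blinfun\<close> returns the intended map only where \<open>h' z r\<close>
    is bounded linear, so every use of \<open>fx\<close> is confined to \<open>U\<close> and
    \<open>{a..b}\<close>.\<close>
  define fx where "fx = (\<lambda>z r. Blinfun (h' z r))"
  have fx: "blinfun_apply (fx z r) = h' z r" if "z \<in> U" "r \<in> {a..b}" for z r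
    unfolding fx_def
    by (rule bounded_linear_Blinfun_apply[OF has_derivative_bounded_linear[OF der[OF that(2,1)]]])
  have cfx: "continuous_on (U \<times> {a..b}) (\<lambda>p. fx (fst p) (snd p))"
  proof (rule continuous_on_blinfun_componentwise)
    fix v :: 'a
    show "continuous_on (U \<times> {a..b}) (\<lambda>p. blinfun_apply (fx (fst p) (snd p)) v)"
      by (rule continuous_on_eq[OF cont'[of v]]) (auto simp: fx)
  qed
  have "((\<lambda>x. integral (cbox a b) (h x)) has_derivative integral (cbox a b) (fx z)) (at z within ball z e)"
  proof (rule leibniz_rule)
    fix x t assume xt: "x \<in> ball z e" "t \<in> cbox a b"
    then have "x \<in> U" "t \<in> {a..b}" using e by auto
    then show "((\<lambda>x. h x t) has_derivative blinfun_apply (fx x t)) (at x within ball z e)"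
      using has_derivative_at_withinI[OF der[of t x]] by (simp only: fx)
  next
    fix x assume "x \<in> ball z e"
    then have "x \<in> U" using e by auto
    from cont[OF this] show "h x integrable_on cbox a b"
      unfolding cbox_interval by (rule integrable_continuous_real)
  next
    show "continuous_on (ball z e \<times> cbox a b) (\<lambda>(x, t). fx x t)"
      unfolding split_beta cbox_interval by (rule continuous_on_subset[OF cfx]) (use e in auto)
  qed (use e in auto)
  moreover have "at z within ball z e = at z"
    by (rule at_within_open[OF _ open_ball]) (use e in simp)
  moreover have "blinfun_apply (integral (cbox a b) (fx z)) = (\<lambda>v. integral {a..b} (\<lambda>r. h' z r v))"
  proof
    fix v
    have "continuous_on {a..b} (\<lambda>r. fx (fst (z, r)) (snd (z, r)))"
      by (rule continuous_on_compose2[OF cfx]) (use assms(2) in \<open>auto intro!: continuous_intros\<close>)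
    then have "fx z integrable_on {a..b}"
      by (intro integrable_continuous_real) simp
    then have "blinfun_apply (integral {a..b} (fx z)) v = integral {a..b} (\<lambda>r. blinfun_apply (fx z r) v)"
      by (rule blinfun_apply_integral)
    also have "\<dots> = integral {a..b} (\<lambda>r. h' z r v)"
      by (rule integral_cong) (simp add: fx[OF assms(2)])
    finally show "blinfun_apply (integral (cbox a b) (fx z)) v = integral {a..b} (\<lambda>r. h' z r v)"
      by (simp only: cbox_interval)
  qed
  ultimately show ?thesis by (simp only: cbox_interval)
qed

lemma integral_cmod_bound:
  fixes f :: "real \<Rightarrow> complex"
  assumes "continuous_on {0..2 * pi} f" "\<And>t. t \<in> {0..2 * pi} \<Longrightarrow> cmod (f t) \<le> B"
  shows "cmod (integral {0..2 * pi} f) \<le> 2 * pi * B"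
  using integral_bound[of 0 "2 * pi" f B] assms by (simp add: mult.commute)

section \<open>Fourier inversion\<close>

lemma integral_periodic_shift:
  fixes g :: "real \<Rightarrow> complex"
  assumes g: "continuous_on UNIV g" and per: "\<And>x. g (x + 2 * pi) = g x" and s: "0 \<le> s" "s \<le> 2 * pi"
  shows "integral {0..2 * pi} (\<lambda>x. g (x + s)) = integral {0..2 * pi} g"
proof -
  have int: "g integrable_on {a..b}" for a b
    by (intro integrable_continuous_real continuous_on_subset[OF g]) simp
  have "integral {0..2 * pi} (\<lambda>x. g (x + s)) = integral {0 + s..2 * pi + s} g"
    using integral_shift_Icc_real[of 0 "2 * pi" g s] by (simp add: o_def add.commute)
  also have "\<dots> = integral {s..2 * pi} g + integral {0 + 2 * pi..s + 2 * pi} g"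
    using Henstock_Kurzweil_Integration.integral_combine[where a = s and c = "2 * pi" and b = "2 * pi + s" and f = g] s int by (simp add: add.commute)
  also have "integral {0 + 2 * pi..s + 2 * pi} g = integral {0..s} g"
    using integral_shift_Icc_real[of 0 s g "2 * pi"] per by (simp add: o_def add.commute)
  also have "integral {s..2 * pi} g + integral {0..s} g = integral {0..2 * pi} g"
    using Henstock_Kurzweil_Integration.integral_combine[where a = 0 and c = s and b = "2 * pi" and f = g] s int by (simp add: add.commute)
  finally show ?thesis .
qed

text \<open>The exponent carries a plus sign, so that along the flow the j-th coefficient is
  multiplied by \<open>cis (- j * \<phi>)\<close> and becomes an eigenfunction of \<open>d0\<close>
  for the eigenvalue +j/2. Inversion is needed only at 0, where the characters equal 1.\<close>

definition fourier :: "(real \<Rightarrow> complex) \<Rightarrow> int \<Rightarrow> complex" where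
  "fourier h j = integral {0..2 * pi} (\<lambda>x. cis (of_int j * x) * h x) / (2 * pi)"

lemma cis_int_periodic: "cis (of_int j * (x + 2 * pi)) = cis (of_int j * x)"
proof -
  have "cis (of_int j * (x + 2 * pi)) = cis (of_int j * x) * cis (2 * pi * of_int j)"
    by (simp add: cis_mult algebra_simps)
  then show ?thesis by (simp add: cis_multiple_2pi)
qed

text \<open>Translation by pi/|j| reverses the sign of the character. Hence twice the integral is
  the integral of \<open>k x - k (x + s)\<close> against a character, which uniform continuity makes
  small.\<close>

lemma riemann_lebesgue:
  fixes k :: "real \<Rightarrow> complex" and \<epsilon> :: real
  assumes k: "continuous_on UNIV k" and per: "\<And>x. k (x + 2 * pi) = k x" and "\<epsilon> > 0"
  shows "\<exists>N. \<forall>j. \<bar>j\<bar> \<ge> N \<longrightarrow> cmod (fourier k j) \<le> \<epsilon>"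
proof -
  \<comment> \<open>Both x in one period and x + s with s <= pi stay in this interval.\<close>
  have "uniformly_continuous_on {0..3 * pi} k"
    by (intro compact_uniformly_continuous continuous_on_subset[OF k]) auto
  then obtain d where d: "d > 0"
    "\<And>x y. x \<in> {0..3 * pi} \<Longrightarrow> y \<in> {0..3 * pi} \<Longrightarrow> dist y x < d \<Longrightarrow> dist (k y) (k x) < \<epsilon>"
    using \<open>\<epsilon> > 0\<close> unfolding uniformly_continuous_on_def by meson
  obtain n :: nat where n: "pi / d < real n" using reals_Archimedean2 by blast
  have "pi / d > 0" using d(1) by simp
  then have n0: "n > 0" using n by linarith
  show ?thesis
  proof (intro exI[of _ "int n"] allI impI)
    fix j :: int assume j: "\<bar>j\<bar> \<ge> int n"
    define s where "s = pi / \<bar>real_of_int j\<bar>"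
    have j1: "\<bar>real_of_int j\<bar> \<ge> real n" using j by linarith
    have j0: "\<bar>real_of_int j\<bar> \<ge> 1" using j n0 by linarith
    have s0: "0 \<le> s" "s \<le> pi"
      using j0 pi_gt_zero unfolding s_def by (auto simp: field_simps)
    have "s \<le> pi / real n"
      unfolding s_def using j1 n0 pi_gt_zero by (intro divide_left_mono) auto
    also have "\<dots> < d"
      using n n0 d(1) by (simp add: field_simps)
    finally have sd: "s < d" .
    let ?g = "\<lambda>x. cis (of_int j * x) * k x"
    have cont: "continuous_on UNIV ?g"
      using k by (intro continuous_intros) auto
    have "cis (of_int j * s) = -1"
    proof (cases "j > 0")
      case True
      then show ?thesis unfolding s_def by simp
    next
      case False
      with j0 have "of_int j * s = - pi" unfolding s_def by simp
      then show ?thesis by (simp add: complex_eq_iff)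
    qed
    then have *: "?g (x + s) = - (cis (of_int j * x) * k (x + s))" for x
      by (simp add: distrib_left flip: cis_mult)
    have "integral {0..2 * pi} ?g = integral {0..2 * pi} (\<lambda>x. - (cis (of_int j * x) * k (x + s)))"
      using integral_periodic_shift[OF cont _ s0(1)] s0(2) pi_gt_zero
      by (simp add: per cis_int_periodic *)
    then have "2 * integral {0..2 * pi} ?g
        = integral {0..2 * pi} ?g + integral {0..2 * pi} (\<lambda>x. - (cis (of_int j * x) * k (x + s)))"
      by simp
    also have "\<dots> = integral {0..2 * pi} (\<lambda>x. ?g x + - (cis (of_int j * x) * k (x + s)))"
      by (intro integral_add[symmetric] integrable_continuous_real continuous_intros
          continuous_on_subset[OF k] continuous_on_compose2[OF k]) auto
    finally have "cmod (2 * integral {0..2 * pi} ?g) = cmod (integral {0..2 * pi} (\<lambda>x. ?g x + - (cis (of_int j * x) * k (x + s))))"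
      by simp
    also have "\<dots> \<le> 2 * pi * \<epsilon>"
    proof (rule integral_cmod_bound)
      show "continuous_on {0..2 * pi} (\<lambda>x. ?g x + - (cis (of_int j * x) * k (x + s)))"
        by (intro continuous_intros continuous_on_subset[OF k] continuous_on_compose2[OF k]) auto
      fix x :: real assume x: "x \<in> {0..2 * pi}"
      have "?g x + - (cis (of_int j * x) * k (x + s)) = cis (of_int j * x) * (k x - k (x + s))"
        by (simp add: algebra_simps)
      then have "cmod (?g x + - (cis (of_int j * x) * k (x + s))) = dist (k x) (k (x + s))"
        by (simp add: norm_mult dist_norm)
      also have "\<dots> < \<epsilon>"
        using x s0 sd by (intro d(2)) (auto simp: dist_real_def)
      finally show "cmod (?g x + - (cis (of_int j * x) * k (x + s))) \<le> \<epsilon>" by simp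
    qed
    finally have "2 * cmod (integral {0..2 * pi} ?g) \<le> 2 * pi * \<epsilon>"
      by (simp add: norm_mult)
    then have "cmod (integral {0..2 * pi} ?g) / (2 * pi) \<le> \<epsilon> / 2"
      using pi_gt_zero by (simp add: field_simps)
    then show "cmod (fourier k j) \<le> \<epsilon>"
      using \<open>\<epsilon> > 0\<close> unfolding fourier_def by (simp add: norm_divide norm_mult)
  qed
qed

lemma fourier_const: "fourier (\<lambda>x. c) j = (if j = 0 then c else 0)"
proof (cases "j = 0")
  case True
  then show ?thesis by (simp add: fourier_def scaleR_conv_of_real)
next
  case False
  have "((\<lambda>x. cis (of_int j * x)) has_integral
      (cis (of_int j * (2 * pi)) / (\<i> * of_int j) - cis (of_int j * 0) / (\<i> * of_int j))) {0..2 * pi}"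
  proof (rule fundamental_theorem_of_calculus)
    fix x
    show "((\<lambda>x. cis (of_int j * x) / (\<i> * of_int j)) has_vector_derivative cis (of_int j * x))
        (at x within {0..2 * pi})"
      using False by (auto intro!: derivative_eq_intros
          simp: has_vector_derivative_def scaleR_conv_of_real mult_ac divide_simps)
  qed simp
  moreover have "cis (of_int j * (2 * pi)) = 1"
    using cis_int_periodic[of j 0] by simp
  ultimately have "((\<lambda>x. cis (of_int j * x)) has_integral 0) {0..2 * pi}"
    by simp
  from integral_unique[OF has_integral_mult_left[OF this, of c]]
  have "integral {0..2 * pi} (\<lambda>x. cis (of_int j * x) * c) = 0"
    by simp
  then show ?thesis using False by (simp add: fourier_def)
qed

lemma periodic_int:
  fixes g :: "real \<Rightarrow> 'a"
  assumes "\<And>x. g (x + 2 * pi) = g x"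
  shows "g (x + 2 * pi * of_int n) = g x"
proof (induction n rule: int_induct[where k = 0])
  case base
  then show ?case by simp
next
  case (step1 i)
  have "g (x + 2 * pi * of_int (i + 1)) = g (x + 2 * pi * of_int i + 2 * pi)"
    by (simp add: algebra_simps)
  then show ?case using step1 assms by simp
next
  case (step2 i)
  have "g (x + 2 * pi * of_int i) = g (x + 2 * pi * of_int (i - 1) + 2 * pi)"
    by (simp add: algebra_simps)
  then show ?case using step2 assms by simp
qed

lemma has_vector_derivative_tendsto_quotient:
  fixes f :: "real \<Rightarrow> complex"
  assumes "(f has_vector_derivative D) (at 0)"
  shows "((\<lambda>x. (f x - f 0) / of_real x) \<longlongrightarrow> D) (at 0)"
proof -
  have "((\<lambda>y. cmod ((f y - f 0) - (y - 0) *\<^sub>R D) / norm (y - 0)) \<longlongrightarrow> 0) (at 0)"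
    using assms unfolding has_vector_derivative_def has_derivative_iff_norm by simp
  moreover have "\<forall>\<^sub>F y in at (0::real).
      cmod ((f y - f 0) - (y - 0) *\<^sub>R D) / norm (y - 0) = cmod ((f y - f 0) / of_real y - D)"
  proof (rule eventually_at_topological[THEN iffD2], intro exI[of _ UNIV] conjI ballI impI)
    fix y :: real assume y: "y \<noteq> 0"
    have "(f y - f 0) / of_real y - D = ((f y - f 0) - (y - 0) *\<^sub>R D) / of_real y"
      using y by (simp add: scaleR_conv_of_real diff_divide_distrib)
    then show "cmod ((f y - f 0) - (y - 0) *\<^sub>R D) / norm (y - 0) = cmod ((f y - f 0) / of_real y - D)"
      by (simp add: norm_divide)
  qed auto
  ultimately have "((\<lambda>y. cmod ((f y - f 0) / of_real y - D)) \<longlongrightarrow> 0) (at 0)"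
    by (rule Lim_transform_eventually)
  then show ?thesis
    by (simp only: tendsto_norm_zero_iff Lim_null[of _ D])
qed

text \<open>Chernoff's argument: after division of \<open>h - h 0\<close> by \<open>cis - 1\<close> the partial sums telescope.\<close>

lemma fourier_inversion:
  fixes h :: "real \<Rightarrow> complex"
  assumes h: "continuous_on UNIV h" and per: "\<And>x. h (x + 2 * pi) = h x"
    and h': "(h has_vector_derivative D) (at 0)"
  shows "zterm (fourier h) sums h 0"
proof -
  \<comment> \<open>The value at the multiples of 2 pi is the limit of the quotient there, since
    \<open>cis\<close> has derivative i at 0; this makes \<open>k\<close> continuous.\<close>
  define k where "k = (\<lambda>x. if cis x = 1 then D / \<i> else (h x - h 0) / (cis x - 1))"
  have kper: "k (x + 2 * pi) = k x" for x
    using per cis_int_periodic[of 1 x] by (simp add: k_def)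
  have c': "(cis has_vector_derivative \<i>) (at 0)"
    by (auto intro!: derivative_eq_intros simp: has_vector_derivative_def scaleR_conv_of_real)
  have k0: "isCont k 0"
  proof -
    have "((\<lambda>x. ((h x - h 0) / of_real x) / ((cis x - cis 0) / of_real x)) \<longlongrightarrow> D / \<i>) (at 0)"
      by (intro tendsto_divide has_vector_derivative_tendsto_quotient h' c') simp
    moreover have "\<forall>\<^sub>F x in at 0. ((h x - h 0) / of_real x) / ((cis x - cis 0) / of_real x) = k x"
    proof (rule eventually_at_topological[THEN iffD2], intro exI[of _ "ball 0 1"] conjI ballI impI)
      fix x :: real assume x: "x \<noteq> 0" "x \<in> ball 0 1"
      have "cis x \<noteq> 1"
      proof
        assume "cis x = 1"
        then have "sin x = 0" by (simp add: complex_eq_iff)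
        moreover have "sin \<bar>x\<bar> > 0"
          using x pi_gt3 by (intro sin_gt_zero) auto
        ultimately show False by (simp add: abs_if split: if_splits)
      qed
      then show "((h x - h 0) / of_real x) / ((cis x - cis 0) / of_real x) = k x"
        using x by (simp add: k_def)
    qed auto
    ultimately have "(k \<longlongrightarrow> D / \<i>) (at 0)"
      by (rule Lim_transform_eventually)
    then show ?thesis by (simp add: isCont_def k_def)
  qed
  have "isCont k x" for x
  proof (cases "cis x = 1")
    case True
    then have "cos x = 1" by (simp add: complex_eq_iff)
    then obtain n :: int where n: "x = of_int n * 2 * pi" using cos_one_2pi_int by blast
    have "isCont (\<lambda>y. k (y - x)) x"
      by (rule isCont_o2[of _ "\<lambda>y. y - x"]) (use k0 in simp_all)
    moreover have "k (y - x) = k y" for y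
      using periodic_int[of k "y - x" n, OF kper] n by (simp add: mult_ac)
    ultimately show ?thesis by simp
  next
    case False
    have o: "open {y. cis y \<noteq> 1}"
      by (intro open_Collect_neq continuous_intros)
    have "continuous_on {y. cis y \<noteq> 1} (\<lambda>y. (h y - h 0) / (cis y - 1))"
      by (intro continuous_intros continuous_on_subset[OF h]) auto
    then have "continuous_on {y. cis y \<noteq> 1} k"
      by (rule continuous_on_eq) (simp add: k_def)
    then show ?thesis
      using o False continuous_on_eq_continuous_at[OF o, of k] by blast
  qed
  then have k: "continuous_on UNIV k" by (simp add: continuous_at_imp_continuous_on)
  have kh: "(cis x - 1) * k x = h x - h 0" for x
  proof (cases "cis x = 1")
    case True
    then have "cos x = 1" by (simp add: complex_eq_iff)
    then obtain n :: int where "x = of_int n * 2 * pi" using cos_one_2pi_int by blast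
    then have "h x = h 0" using periodic_int[of h 0 n, OF per] by (simp add: mult_ac)
    then show ?thesis using True by simp
  next
    case False
    then show ?thesis by (simp add: k_def)
  qed
  \<comment> \<open>Multiplying the integrand by \<open>cis x\<close> raises the index by one, so
    \<open>(cis x - 1) * k x\<close> contributes a difference of neighbouring coefficients; the
    constant \<open>h 0\<close> contributes for \<open>j = 0\<close> only.\<close>
  have tele: "fourier h j = (if j = 0 then h 0 else 0) + (fourier k (j + 1) - fourier k j)" for j
  proof -
    have "integral {0..2 * pi} (\<lambda>x. cis (of_int j * x) * h x)
        = integral {0..2 * pi} (\<lambda>x. cis (of_int j * x) * h 0 +
            (cis (of_int (j + 1) * x) * k x - cis (of_int j * x) * k x))"
    proof (rule integral_cong)
      fix x
      have "cis (of_int (j + 1) * x) * k x - cis (of_int j * x) * k x = cis (of_int j * x) * ((cis x - 1) * k x)"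
        by (simp add: distrib_right algebra_simps flip: cis_mult)
      then show "cis (of_int j * x) * h x = cis (of_int j * x) * h 0 +
            (cis (of_int (j + 1) * x) * k x - cis (of_int j * x) * k x)"
        unfolding kh by (simp add: algebra_simps)
    qed
    also have "\<dots> = integral {0..2 * pi} (\<lambda>x. cis (of_int j * x) * h 0) +
        (integral {0..2 * pi} (\<lambda>x. cis (of_int (j + 1) * x) * k x) - integral {0..2 * pi} (\<lambda>x. cis (of_int j * x) * k x))"
      by (subst integral_add; (subst integral_diff)?)
        (auto intro!: integrable_continuous_real continuous_intros continuous_on_subset[OF k])
    finally have "fourier h j = fourier (\<lambda>x. h 0) j + (fourier k (j + 1) - fourier k j)"
      unfolding fourier_def by (simp only: add_divide_distrib diff_divide_distrib)
    then show ?thesis by (simp only: fourier_const)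
  qed
  \<comment> \<open>The indices -n - 1 to n telescope; the coefficients left at the two ends tend to
    0 by \<open>riemann_lebesgue\<close>.\<close>
  have part: "(\<Sum>i<Suc n. zterm (fourier h) i) = h 0 + fourier k (int (Suc n)) - fourier k (- int (Suc n))" for n
  proof (induction n)
    case 0
    show ?case by (simp add: zterm_def tele[of 0] tele[of "-1"])
  next
    case (Suc n)
    have "zterm (fourier h) (Suc n) = (fourier k (int (Suc (Suc n))) - fourier k (int (Suc n))) +
        (fourier k (- int (Suc n)) - fourier k (- int (Suc (Suc n))))"
      unfolding zterm_def tele[of "int (Suc n)"] tele[of "- int (Suc n) - 1"] by (simp add: algebra_simps)
    then show ?case
      unfolding sum.lessThan_Suc[of _ "Suc n"] Suc.IH by simp
  qed
  have lim: "(\<lambda>n. fourier k (\<sigma> * int (Suc n))) \<longlonglongrightarrow> 0" if "\<bar>\<sigma>\<bar> = 1" for \<sigma> :: int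
  proof (rule LIMSEQ_I)
    fix e :: real assume "e > 0"
    then obtain N where N: "\<And>j. \<bar>j\<bar> \<ge> N \<Longrightarrow> cmod (fourier k j) \<le> e / 2"
      using riemann_lebesgue[OF k kper, of "e / 2"] by auto
    show "\<exists>no. \<forall>n\<ge>no. cmod (fourier k (\<sigma> * int (Suc n)) - 0) < e"
    proof (intro exI[of _ "nat N"] allI impI)
      fix n assume "n \<ge> nat N"
      then have "cmod (fourier k (\<sigma> * int (Suc n))) \<le> e / 2"
        using that by (intro N) (simp add: abs_mult)
      then show "cmod (fourier k (\<sigma> * int (Suc n)) - 0) < e"
        using \<open>e > 0\<close> by simp
    qed
  qed
  have "(\<lambda>n. h 0 + fourier k (1 * int (Suc n)) - fourier k ((-1) * int (Suc n))) \<longlonglongrightarrow> h 0 + 0 - 0"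
    by (intro tendsto_diff tendsto_add tendsto_const lim) simp_all
  then have "(\<lambda>n. \<Sum>i<Suc n. zterm (fourier h) i) \<longlonglongrightarrow> h 0"
    by (simp only: part mult_1 mult_minus1 add_0_right diff_zero)
  then show ?thesis
    unfolding sums_def by (rule LIMSEQ_imp_Suc)
qed

section \<open>Multipliers of polynomial growth\<close>

lemma poly_bdd_const: "poly_bdd (\<lambda>j. c)"
  unfolding poly_bdd_def by (intro exI[of _ "cmod c"] exI[of _ 0]) simp

lemma poly_bdd_of_int: "poly_bdd of_int"
  unfolding poly_bdd_def by (intro exI[of _ 1]) simp

lemma poly_bddE:
  assumes "poly_bdd \<kappa>"
  obtains C N where "C \<ge> 0" "\<And>j. cmod (\<kappa> j) \<le> C * (1 + \<bar>real_of_int j\<bar>) ^ N"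
proof -
  obtain C N where C: "\<And>j. cmod (\<kappa> j) \<le> C * (1 + \<bar>real_of_int j\<bar>) ^ N"
    using assms unfolding poly_bdd_def by blast
  have "C \<ge> 0" using order_trans[OF norm_ge_zero C[of 0]] by simp
  then show ?thesis using that C by blast
qed

lemma poly_bdd_mult:
  assumes "poly_bdd \<kappa>" "poly_bdd \<kappa>'"
  shows "poly_bdd (\<lambda>j. \<kappa> j * \<kappa>' j)"
proof -
  obtain C N where C: "C \<ge> 0" "\<And>j. cmod (\<kappa> j) \<le> C * (1 + \<bar>real_of_int j\<bar>) ^ N"
    by (rule poly_bddE[OF assms(1)]) blast
  obtain C' N' where C': "C' \<ge> 0" "\<And>j. cmod (\<kappa>' j) \<le> C' * (1 + \<bar>real_of_int j\<bar>) ^ N'"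
    by (rule poly_bddE[OF assms(2)]) blast
  show ?thesis
    unfolding poly_bdd_def
  proof (intro exI allI)
    fix j
    have "cmod (\<kappa> j * \<kappa>' j) \<le> (C * (1 + \<bar>real_of_int j\<bar>) ^ N) * (C' * (1 + \<bar>real_of_int j\<bar>) ^ N')"
      unfolding norm_mult by (intro mult_mono C(2) C'(2)) (simp_all add: C(1))
    then show "cmod (\<kappa> j * \<kappa>' j) \<le> (C * C') * (1 + \<bar>real_of_int j\<bar>) ^ (N + N')"
      by (simp add: power_add mult_ac)
  qed
qed

lemma poly_bdd_add:
  assumes "poly_bdd \<kappa>" "poly_bdd \<kappa>'"
  shows "poly_bdd (\<lambda>j. \<kappa> j + \<kappa>' j)"
proof -
  obtain C N where C: "C \<ge> 0" "\<And>j. cmod (\<kappa> j) \<le> C * (1 + \<bar>real_of_int j\<bar>) ^ N"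
    by (rule poly_bddE[OF assms(1)]) blast
  obtain C' N' where C': "C' \<ge> 0" "\<And>j. cmod (\<kappa>' j) \<le> C' * (1 + \<bar>real_of_int j\<bar>) ^ N'"
    by (rule poly_bddE[OF assms(2)]) blast
  show ?thesis
    unfolding poly_bdd_def
  proof (intro exI allI)
    fix j
    let ?m = "1 + \<bar>real_of_int j\<bar>"
    have "cmod (\<kappa> j + \<kappa>' j) \<le> C * ?m ^ N + C' * ?m ^ N'"
      by (rule norm_triangle_mono[OF C(2) C'(2)])
    also have "\<dots> \<le> C * ?m ^ (N + N') + C' * ?m ^ (N + N')"
      by (intro add_mono mult_left_mono power_increasing C(1) C'(1)) simp_all
    finally show "cmod (\<kappa> j + \<kappa>' j) \<le> (C + C') * ?m ^ (N + N')"
      by (simp add: distrib_right)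
  qed
qed

section \<open>Periodic solutions of scalar transport equations\<close>

text \<open>The sign \<open>\<sigma>\<close> selects the direction of integration in time in which the propagator of
  \<open>\<partial>\<^sub>t - A\<close> stays bounded uniformly in the index.\<close>

locale transport =
  fixes V :: "'x::euclidean_space set" and \<sigma> :: real and E :: "int \<Rightarrow> real \<Rightarrow> complex"
    and s q :: "real \<Rightarrow> real" and \<mu> \<nu> :: "int \<Rightarrow> complex" and B :: real
  assumes V: "open V" and \<sigma>: "\<sigma> = 1 \<or> \<sigma> = -1"
    and smooth: "smooth_on UNIV s" "smooth_on UNIV q"
    and poly: "poly_bdd \<mu>" "poly_bdd \<nu>"
    and E: "(E j has_vector_derivative (of_real (s t) + \<mu> j + \<nu> j * of_real (q t))) (at t)"
    and E_period: "E j (t + 2 * pi) = E j t + E j (2 * pi)"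
    and E_bound: "0 \<le> r \<Longrightarrow> r \<le> 2 * pi \<Longrightarrow> Re (E j t - E j (t + \<sigma> * r)) \<le> B"
    and nonres: "exp (- of_real \<sigma> * E j (2 * pi)) \<noteq> 1"
    and nonres_poly: "poly_bdd (\<lambda>j. 1 / (exp (- of_real \<sigma> * E j (2 * pi)) - 1))"
begin

definition A :: "int \<Rightarrow> real \<Rightarrow> complex" where
  "A j t = of_real (s t) + \<mu> j + \<nu> j * of_real (q t)"

definition D :: "(real \<times> 'x) set" where "D = UNIV \<times> V"

text \<open>Variation of constants over one period. If u is periodic and solves
  \<open>u' = A u + a\<close>, then the r-derivative of
  \<open>exp (E t - E (t + \<sigma> r)) u (t + \<sigma> r)\<close> is
  \<open>\<sigma> exp (E t - E (t + \<sigma> r)) a (t + \<sigma> r)\<close>; integrating over 0 <= r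
  <= 2 pi and using periodicity determines u as this quotient.\<close>

definition solve :: "(int \<Rightarrow> real \<times> 'x \<Rightarrow> complex) \<Rightarrow> int \<Rightarrow> real \<times> 'x \<Rightarrow> complex" where
  "solve a j z = of_real \<sigma> / (exp (- of_real \<sigma> * E j (2 * pi)) - 1) *
     integral {0..2 * pi} (\<lambda>r. exp (E j (fst z) - E j (fst z + \<sigma> * r)) * a j (z + (\<sigma> * r, 0)))"

lemma open_D: "open D"
  unfolding D_def by (intro open_Times open_UNIV V)

lemma D_shift: "z + (r, 0) \<in> D \<longleftrightarrow> z \<in> D"
  unfolding D_def by (simp add: mem_Times_iff)

lemma E': "(E j has_vector_derivative A j t) (at t)"
  using E unfolding A_def .

lemma E_continuous: "continuous_on S (E j)"
  by (intro continuous_at_imp_continuous_on ballI has_vector_derivative_continuous[OF E'])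

lemma A_continuous: "continuous_on S (A j)"
proof -
  have "continuous_on UNIV s" "continuous_on UNIV q"
    using smooth by (simp_all add: smooth_on_continuous_on)
  then show ?thesis
    unfolding A_def by (intro continuous_intros) (auto intro: continuous_on_subset)
qed

lemma E_shift_period: "E j (t + \<sigma> * (2 * pi)) = E j t + of_real \<sigma> * E j (2 * pi)"
  using \<sigma> E_period[of j t] E_period[of j "t - 2 * pi"] by auto

text \<open>The t-derivative of the integrand equals \<open>A\<close> times the integrand plus
  \<open>\<sigma>\<close> times its r-derivative. The latter integrates to boundary values, which
  the normalisation turns into \<open>a j z\<close>. So the time direction needs no derivative of
  \<open>a\<close>, and a derivative of a solution is again built from solutions;
  \<open>solve_rapid\<close> rests on this.\<close>

lemma solve_has_derivative:
  assumes a: "\<And>z. z \<in> D \<Longrightarrow> (a j has_derivative a' j z) (at z)"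
    and a': "\<And>v. continuous_on D (\<lambda>z. a' j z v)"
    and per: "\<And>z. z \<in> D \<Longrightarrow> a j (z + (2 * pi, 0)) = a j z"
    and z: "z \<in> D"
  shows "(solve a j has_derivative (\<lambda>v. of_real (fst v) * (A j (fst z) * solve a j z + a j z)
      + solve (\<lambda>j z. a' j z (0, snd v)) j z)) (at z)"
proof -
  define e where "e = (\<lambda>(z :: real \<times> 'x) r. exp (E j (fst z) - E j (fst z + \<sigma> * r)))"
  define h where "h = (\<lambda>z r. e z r * a j (z + (\<sigma> * r, 0)))"
  define h' where "h' = (\<lambda>z r v. e z r * a' j (z + (\<sigma> * r, 0)) v +
    e z r * (fst v *\<^sub>R (A j (fst z) - A j (fst z + \<sigma> * r))) * a j (z + (\<sigma> * r, 0)))"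
  define c where "c = of_real \<sigma> / (exp (- of_real \<sigma> * E j (2 * pi)) - 1)"
  have ac: "continuous_on D (a j)"
    by (intro continuous_at_imp_continuous_on ballI has_derivative_continuous[OF a])
  have e_cont: "continuous_on S (\<lambda>p. e (fst p) (snd p))" for S
    unfolding e_def by (intro continuous_intros continuous_on_compose2[OF E_continuous]) auto
  have Dsh: "z + (\<sigma> * r, 0) \<in> D" if "z \<in> D" for z :: "real \<times> 'x" and r
    using that by (simp add: D_shift)
  have a_cont: "continuous_on (D \<times> {0..2 * pi}) (\<lambda>p. a j (fst p + (\<sigma> * snd p, 0)))"
    by (rule continuous_on_compose2[OF ac]) (auto intro!: continuous_intros simp: D_def)
  have a'_cont: "continuous_on (D \<times> {0..2 * pi}) (\<lambda>p. a' j (fst p + (\<sigma> * snd p, 0)) v)" for v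
    by (rule continuous_on_compose2[OF a'[of v]]) (auto intro!: continuous_intros simp: D_def)
  have A_cont: "continuous_on S (\<lambda>p. A j (f p))" if "continuous_on S f" for f :: "(real \<times> 'x) \<times> real \<Rightarrow> real" and S
    by (rule continuous_on_compose2[OF A_continuous that]) auto
  have h_cont: "continuous_on {0..2 * pi} (h z)" if "z \<in> D" for z
  proof -
    have "continuous_on (D \<times> {0..2 * pi}) (\<lambda>p. h (fst p) (snd p))"
      unfolding h_def by (intro continuous_on_mult e_cont a_cont)
    then have "continuous_on {0..2 * pi} (\<lambda>r. h (fst (z, r)) (snd (z, r)))"
      by (rule continuous_on_compose2) (use that in \<open>auto intro!: continuous_intros\<close>)
    then show ?thesis by simp
  qed
  have h'_cont: "continuous_on (D \<times> {0..2 * pi}) (\<lambda>p. h' (fst p) (snd p) v)" for v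
    unfolding h'_def
    by (intro continuous_on_mult continuous_on_add continuous_on_diff continuous_on_scaleR
        continuous_on_const e_cont a_cont a'_cont A_cont continuous_on_fst continuous_on_snd continuous_on_id)
  have e_der: "((\<lambda>z. e z r) has_derivative
      (\<lambda>v. e z r * (fst v *\<^sub>R (A j (fst z) - A j (fst z + \<sigma> * r))))) (at z)" for z r
  proof -
    have 1: "((\<lambda>z. E j (fst z)) has_derivative (\<lambda>v. fst v *\<^sub>R A j (fst z))) (at z)"
      by (rule has_derivative_compose[OF has_derivative_fst[OF has_derivative_ident]
            E'[unfolded has_vector_derivative_def]])
    have 2: "((\<lambda>z::real \<times> 'x. fst z + \<sigma> * r) has_derivative (\<lambda>v. fst v + 0)) (at z)"
      by (intro has_derivative_add has_derivative_fst[OF has_derivative_ident] has_derivative_const)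
    have 3: "((\<lambda>z. E j (fst z + \<sigma> * r)) has_derivative (\<lambda>v. (fst v + 0) *\<^sub>R A j (fst z + \<sigma> * r))) (at z)"
      by (rule has_derivative_compose[OF 2 E'[unfolded has_vector_derivative_def]])
    have 4: "((\<lambda>z. E j (fst z) - E j (fst z + \<sigma> * r)) has_derivative
        (\<lambda>v. fst v *\<^sub>R A j (fst z) - (fst v + 0) *\<^sub>R A j (fst z + \<sigma> * r))) (at z)"
      by (rule has_derivative_diff[OF 1 3])
    show ?thesis
      using has_derivative_compose[OF 4 DERIV_exp[unfolded has_field_derivative_def]]
      unfolding e_def by (simp only: add_0_right scaleR_diff_right)
  qed
  have a_sh: "((\<lambda>z. a j (z + (\<sigma> * r, 0))) has_derivative a' j (z + (\<sigma> * r, 0))) (at z)" if "z \<in> D" for z r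
  proof -
    have "((\<lambda>z. z + (\<sigma> * r, 0)) has_derivative (\<lambda>v. v + 0)) (at z)"
      by (intro has_derivative_add has_derivative_ident has_derivative_const)
    from has_derivative_compose[OF this a[OF Dsh[OF that]]] show ?thesis
      by (simp only: add_0_right)
  qed
  have h_der: "((\<lambda>z. h z r) has_derivative h' z r) (at z)" if "z \<in> D" for z r
    unfolding h_def h'_def by (rule has_derivative_mult[OF e_der a_sh[OF that]])
  have int_der: "((\<lambda>z. integral {0..2 * pi} (h z)) has_derivative (\<lambda>v. integral {0..2 * pi} (\<lambda>r. h' z r v))) (at z)"
    by (rule integral_has_derivative[OF open_D z h_der h_cont h'_cont])
  have solve_eq: "solve a j = (\<lambda>z. c * integral {0..2 * pi} (h z))"
    unfolding solve_def c_def h_def e_def ..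
  \<comment> \<open>The derivative of the integrand in the integration variable
    \<open>r\<close>.\<close>
  define H' where "H' = (\<lambda>r. e z r * (a' j (z + (\<sigma> * r, 0)) (\<sigma>, 0)) +
     e z r * (- (\<sigma> *\<^sub>R A j (fst z + \<sigma> * r))) * a j (z + (\<sigma> * r, 0)))"
  have H: "(h z has_vector_derivative H' r) (at r)" for r
  proof -
    have 1: "((\<lambda>r. fst z + \<sigma> * r) has_vector_derivative \<sigma>) (at r)"
      by (auto intro!: derivative_eq_intros simp: has_vector_derivative_def)
    have "((\<lambda>r. E j (fst z + \<sigma> * r)) has_vector_derivative \<sigma> *\<^sub>R A j (fst z + \<sigma> * r)) (at r)"
      using vector_diff_chain_at[OF 1 E'[of j "fst z + \<sigma> * r"]] by (simp only: o_def)
    then have "((\<lambda>r. E j (fst z) - E j (fst z + \<sigma> * r)) has_vector_derivative 0 - \<sigma> *\<^sub>R A j (fst z + \<sigma> * r)) (at r)"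
      by (intro has_vector_derivative_diff has_vector_derivative_const)
    from field_vector_diff_chain_at[OF this DERIV_exp]
    have 2: "((\<lambda>r. e z r) has_vector_derivative (0 - \<sigma> *\<^sub>R A j (fst z + \<sigma> * r)) * e z r) (at r)"
      unfolding e_def by (simp only: o_def)
    have "((\<lambda>r. z + (\<sigma> * r, 0)) has_derivative (\<lambda>t. 0 + (\<sigma> * t, 0))) (at r)"
      by (intro has_derivative_add has_derivative_const has_derivative_Pair has_derivative_mult_right has_derivative_ident)
    from has_derivative_compose[OF this a[OF Dsh[OF z]]]
    have "((\<lambda>r. a j (z + (\<sigma> * r, 0))) has_derivative (\<lambda>t. a' j (z + (\<sigma> * r, 0)) (0 + (\<sigma> * t, 0)))) (at r)" .
    moreover have "a' j (z + (\<sigma> * r, 0)) (0 + (\<sigma> * t, 0)) = t *\<^sub>R a' j (z + (\<sigma> * r, 0)) (\<sigma>, 0)" for t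
      using linear_scale[OF has_derivative_linear[OF a[OF Dsh[OF z]]], of r t "(\<sigma>, 0)"]
      by (simp add: mult.commute)
    ultimately have 3: "((\<lambda>r. a j (z + (\<sigma> * r, 0))) has_vector_derivative a' j (z + (\<sigma> * r, 0)) (\<sigma>, 0)) (at r)"
      unfolding has_vector_derivative_def by (simp only:)
    show ?thesis
      using has_vector_derivative_mult[OF 2 3] unfolding h_def H'_def
      by (simp only: diff_0 mult_ac)
  qed
  have int_H': "(H' has_integral (h z (2 * pi) - h z 0)) {0..2 * pi}"
    by (rule fundamental_theorem_of_calculus)
      (auto intro: has_vector_derivative_at_within[OF H])
  \<comment> \<open>\<open>a\<close> is periodic and \<open>E\<close> is so up to its increment,
    hence the two ends of the period differ by exactly the divisor in \<open>solve\<close>.\<close>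
  have endpoint: "h z (2 * pi) - h z 0 = (exp (- of_real \<sigma> * E j (2 * pi)) - 1) * a j z"
  proof -
    have "a j (z + (\<sigma> * (2 * pi), 0)) = a j z"
      using \<sigma>
    proof
      assume "\<sigma> = 1"
      then show ?thesis using per[OF z] by simp
    next
      assume "\<sigma> = -1"
      then have "a j (z + (\<sigma> * (2 * pi), 0)) = a j (z + (\<sigma> * (2 * pi), 0) + (2 * pi, 0))"
        using per[OF Dsh[OF z, of "2 * pi"]] by simp
      also have "z + (\<sigma> * (2 * pi), 0) + (2 * pi, 0) = z"
        using \<open>\<sigma> = -1\<close> by (simp add: add.assoc zero_prod_def[symmetric])
      finally show ?thesis .
    qed
    then show ?thesis
      unfolding h_def e_def E_shift_period by (simp add: algebra_simps zero_prod_def[symmetric])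
  qed
  have "c * integral {0..2 * pi} (\<lambda>r. h' z r v) = of_real (fst v) * (A j (fst z) * solve a j z + a j z)
      + solve (\<lambda>j z. a' j z (0, snd v)) j z" for v
  proof -
    \<comment> \<open>\<open>v\<close> is split into its time and space parts. As
      \<open>\<sigma>\<close> has square 1, the time derivative of \<open>a\<close> and the term
      with \<open>A j (fst z + \<sigma> * r)\<close> recombine to \<open>\<sigma>\<close> times
      \<open>H' r\<close>.\<close>
    have "h' z r v = of_real (fst v) * (A j (fst z) * h z r + of_real \<sigma> * H' r)
        + e z r * a' j (z + (\<sigma> * r, 0)) (0, snd v)" for r
    proof -
      interpret L: linear "a' j (z + (\<sigma> * r, 0))"
        by (rule has_derivative_linear[OF a[OF Dsh[OF z]]])
      have 1: "a' j (z + (\<sigma> * r, 0)) (\<sigma>, 0) = \<sigma> *\<^sub>R a' j (z + (\<sigma> * r, 0)) (1, 0)"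
        using L.scale[of \<sigma> "(1, 0)"] by simp
      have 2: "a' j (z + (\<sigma> * r, 0)) v = fst v *\<^sub>R a' j (z + (\<sigma> * r, 0)) (1, 0) + a' j (z + (\<sigma> * r, 0)) (0, snd v)"
        using L.add[of "fst v *\<^sub>R (1, 0)" "(0, snd v)"] L.scale[of "fst v" "(1, 0)"] by simp
      have 3: "of_real \<sigma> * of_real \<sigma> = (1 :: complex)" using \<sigma> by auto
      have 4: "of_real \<sigma> * (of_real \<sigma> * x) = x" for x :: complex
        using 3 by (simp only: mult.assoc[symmetric] mult_1)
      show ?thesis
        unfolding h'_def h_def H'_def 1 2 scaleR_conv_of_real
        by (simp add: algebra_simps 4)
    qed
    moreover have "((\<lambda>r. of_real (fst v) * (A j (fst z) * h z r + of_real \<sigma> * H' r)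
        + e z r * a' j (z + (\<sigma> * r, 0)) (0, snd v)) has_integral
       of_real (fst v) * (A j (fst z) * integral {0..2 * pi} (h z) + of_real \<sigma> * (h z (2 * pi) - h z 0))
        + integral {0..2 * pi} (\<lambda>r. e z r * a' j (z + (\<sigma> * r, 0)) (0, snd v))) {0..2 * pi}"
    proof (intro has_integral_add has_integral_mult_right int_H')
      show "(h z has_integral integral {0..2 * pi} (h z)) {0..2 * pi}"
        by (intro integrable_integral integrable_continuous_real h_cont z)
      have "continuous_on (D \<times> {0..2 * pi}) (\<lambda>p. e (fst p) (snd p) * a' j (fst p + (\<sigma> * snd p, 0)) (0, snd v))"
        by (intro continuous_on_mult e_cont a'_cont)
      then have "continuous_on {0..2 * pi} (\<lambda>r. e (fst (z, r)) (snd (z, r)) * a' j (fst (z, r) + (\<sigma> * snd (z, r), 0)) (0, snd v))"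
        by (rule continuous_on_compose2) (use z in \<open>auto intro!: continuous_intros\<close>)
      then have "continuous_on {0..2 * pi} (\<lambda>r. e z r * a' j (z + (\<sigma> * r, 0)) (0, snd v))"
        by simp
      then show "((\<lambda>r. e z r * a' j (z + (\<sigma> * r, 0)) (0, snd v)) has_integral
          integral {0..2 * pi} (\<lambda>r. e z r * a' j (z + (\<sigma> * r, 0)) (0, snd v))) {0..2 * pi}"
        by (intro integrable_integral integrable_continuous_real)
    qed
    ultimately have I: "integral {0..2 * pi} (\<lambda>r. h' z r v)
      = of_real (fst v) * (A j (fst z) * integral {0..2 * pi} (h z) + of_real \<sigma> * (h z (2 * pi) - h z 0))
        + integral {0..2 * pi} (\<lambda>r. e z r * a' j (z + (\<sigma> * r, 0)) (0, snd v))"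
      by (simp only: integral_unique)
    have "c * (of_real \<sigma> * (h z (2 * pi) - h z 0)) = a j z"
      unfolding endpoint c_def using nonres[of j] \<sigma> by (auto simp: field_simps)
    then have "c * (of_real (fst v) * (A j (fst z) * integral {0..2 * pi} (h z) + of_real \<sigma> * (h z (2 * pi) - h z 0)))
        = of_real (fst v) * (A j (fst z) * (c * integral {0..2 * pi} (h z)) + a j z)"
      by (simp only: distrib_left mult.left_commute[of c])
    then show ?thesis
      unfolding I solve_eq by (simp only: distrib_left[of c]) (simp add: solve_def c_def e_def)
  qed
  then show ?thesis
    using has_derivative_mult_right[OF int_der, of c] unfolding solve_eq by (simp only:)
qed

text \<open>By \<open>E_bound\<close> the kernel is at most \<open>exp B\<close> in modulus,
  whatever \<open>j\<close> is, so only the inverse divisor costs powers of the weight. The compact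
  set is enlarged by the time translates over which the integral runs.\<close>

lemma solve_rapid0:
  assumes a: "rapid0 D a" and cont: "\<And>j. continuous_on D (solve a j)"
  shows "rapid0 D (solve a)"
  unfolding rapid0_def
proof (intro conjI allI impI)
  show "continuous_on D (solve a j)" for j by (rule cont)
  fix N K assume K: "compact K" "K \<subseteq> D"
  obtain C1 N1 where C1: "C1 \<ge> 0"
    "\<And>j. cmod (1 / (exp (- of_real \<sigma> * E j (2 * pi)) - 1)) \<le> C1 * (1 + \<bar>real_of_int j\<bar>) ^ N1"
    by (rule poly_bddE[OF nonres_poly]) blast
  let ?K = "(\<lambda>p. fst p + (\<sigma> * snd p, 0)) ` (K \<times> {0..2 * pi})"
  have K': "compact ?K" "?K \<subseteq> D"
    using K(2) by (auto intro!: compact_continuous_image compact_Times K(1) continuous_intros simp: D_def)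
  obtain C where C: "C \<ge> 0" "\<And>j z. z \<in> ?K \<Longrightarrow> cmod (a j z) * (1 + \<bar>real_of_int j\<bar>) ^ (N + N1) \<le> C"
    by (rule rapid0D[OF a K', where N = "N + N1"]) blast
  show "\<exists>C. \<forall>j. \<forall>z\<in>K. cmod (solve a j z) * (1 + \<bar>real_of_int j\<bar>) ^ N \<le> C"
  proof (intro exI allI ballI)
    fix j z assume z: "z \<in> K"
    let ?m = "1 + \<bar>real_of_int j\<bar>"
    have m: "?m > 0" by simp
    let ?f = "\<lambda>r. exp (E j (fst z) - E j (fst z + \<sigma> * r)) * a j (z + (\<sigma> * r, 0))"
    have "cmod (integral {0..2 * pi} ?f) \<le> 2 * pi * (exp B * (C / ?m ^ (N + N1)))"
    proof (rule integral_cmod_bound)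
      have ac: "continuous_on D (a j)" using a unfolding rapid0_def by blast
      have "z \<in> D" using z K(2) by blast
      then have "continuous_on {0..2 * pi} (\<lambda>r. a j (z + (\<sigma> * r, 0)))"
        by (intro continuous_on_compose2[OF ac]) (auto intro!: continuous_intros simp: D_def)
      moreover have "continuous_on {0..2 * pi} (\<lambda>r. E j (fst z + \<sigma> * r))"
        by (rule continuous_on_compose2[OF E_continuous[of UNIV]]) (auto intro!: continuous_intros)
      ultimately show "continuous_on {0..2 * pi} ?f"
        by (intro continuous_on_mult continuous_on_exp continuous_on_diff continuous_on_const)
      fix r :: real assume r: "r \<in> {0..2 * pi}"
      have "z + (\<sigma> * r, 0) \<in> ?K"
        using z r by (intro image_eqI[of _ _ "(z, r)"]) auto
      from C(2)[OF this, of j] have "cmod (a j (z + (\<sigma> * r, 0))) \<le> C / ?m ^ (N + N1)"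
        by (simp only: pos_le_divide_eq[OF zero_less_power[OF m]])
      moreover have "cmod (exp (E j (fst z) - E j (fst z + \<sigma> * r))) \<le> exp B"
        using r E_bound[of r j "fst z"] by simp
      ultimately show "cmod (?f r) \<le> exp B * (C / ?m ^ (N + N1))"
        unfolding norm_mult by (intro mult_mono) simp_all
    qed
    moreover have "cmod (of_real \<sigma> / (exp (- of_real \<sigma> * E j (2 * pi)) - 1)) \<le> C1 * ?m ^ N1"
      using C1(2)[of j] \<sigma> by (auto simp: norm_divide)
    ultimately have "cmod (solve a j z) \<le> (C1 * ?m ^ N1) * (2 * pi * (exp B * (C / ?m ^ (N + N1))))"
      unfolding solve_def norm_mult by (intro mult_mono) (simp_all add: C1(1))
    then have "cmod (solve a j z) * ?m ^ N \<le> (C1 * ?m ^ N1) * (2 * pi * (exp B * (C / ?m ^ (N + N1)))) * ?m ^ N"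
      by (rule mult_right_mono) simp
    also have "\<dots> = C1 * (2 * pi * (exp B * C))"
      using m by (simp add: power_add)
    finally show "cmod (solve a j z) * ?m ^ N \<le> C1 * (2 * pi * (exp B * C))" .
  qed
qed

section \<open>Smoothness, periodicity and derivatives of the scalar solutions\<close>

definition tperiodic :: "(int \<Rightarrow> real \<times> 'x \<Rightarrow> complex) \<Rightarrow> bool" where
  "tperiodic a \<longleftrightarrow> (\<forall>j. \<forall>z\<in>D. a j (z + (2 * pi, 0)) = a j z)"

text \<open>Keeps the derivatives of \<open>a\<close> inside the class on which
  \<open>solve_rapid\<close> inducts.\<close>

lemma tperiodic_frechet:
  assumes "\<And>k. rapid k D a" "tperiodic a"
  shows "tperiodic (\<lambda>j z. frechet_derivative (a j) (at z) v)"
  unfolding tperiodic_def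
proof (intro allI ballI)
  fix j z assume z: "z \<in> D"
  have z': "z + (2 * pi, 0) \<in> D" using z by (simp add: D_shift)
  have "((\<lambda>z. z + (2 * pi, 0)) has_derivative (\<lambda>v. v + 0)) (at z)"
    by (intro has_derivative_add has_derivative_ident has_derivative_const)
  from has_derivative_compose[OF this rapid_SucD[OF assms(1) z']]
  have "((\<lambda>z. a j (z + (2 * pi, 0))) has_derivative frechet_derivative (a j) (at (z + (2 * pi, 0)))) (at z)"
    by (simp only: add_0_right)
  then have "(a j has_derivative frechet_derivative (a j) (at (z + (2 * pi, 0)))) (at z)"
    by (rule has_derivative_transform_within_open[OF _ open_D z]) (use assms(2) in \<open>simp add: tperiodic_def\<close>)
  from frechet_derivative_at[OF this]
  show "frechet_derivative (a j) (at (z + (2 * pi, 0))) v = frechet_derivative (a j) (at z) v"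
    by simp
qed

lemma solve_has_derivative_rapid:
  assumes "\<And>k. rapid k D a" "tperiodic a" "z \<in> D"
  shows "(solve a j has_derivative (\<lambda>v. of_real (fst v) * (A j (fst z) * solve a j z + a j z)
      + solve (\<lambda>j z. frechet_derivative (a j) (at z) (0, snd v)) j z)) (at z)"
proof (rule solve_has_derivative)
  show "continuous_on D (\<lambda>z. frechet_derivative (a j) (at z) v)" for v
    using rapid_imp_rapid0[OF rapid_SucD'[OF assms(1), where v = v]] unfolding rapid0_def by blast
qed (use assms in \<open>auto simp: tperiodic_def intro: rapid_SucD[OF assms(1)]\<close>)

lemma smooth_time:
  assumes "smooth_on UNIV (\<phi> :: real \<Rightarrow> real)"
  shows "Ck_on k D (\<lambda>z. of_real (\<phi> (fst z)))"
proof -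
  have "Ck_on k D (\<lambda>z. \<phi> (fst z))"
    using assms by (intro Ck_on_compose[OF open_D open_UNIV _ Ck_on_linear[OF open_D bounded_linear_fst]])
      (simp_all add: smooth_on_def)
  then show ?thesis
    by (rule Ck_on_bounded_linear[OF open_D bounded_linear_of_real])
qed

text \<open>A derivative of the solution combines the solution, \<open>a\<close>, and the solution
  for a space derivative of \<open>a\<close>. The hypothesis covers all orders of \<open>a\<close>
  because the last term uses one order more at each level.\<close>

lemma solve_rapid:
  assumes "\<And>k. rapid k D a" "tperiodic a"
  shows "rapid k D (solve a)"
  using assms
proof (induction k arbitrary: a)
  case 0
  have "continuous_on D (solve a j)" for j
    by (intro continuous_at_imp_continuous_on ballI
        has_derivative_continuous[OF solve_has_derivative_rapid[OF 0(1,2)]])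
  then show ?case
    using solve_rapid0[OF rapid_imp_rapid0[OF 0(1)]] by simp
next
  case (Suc k)
  show ?case
  proof (rule rapid_SucI[OF open_D rapid_imp_rapid0[OF Suc.IH] solve_has_derivative_rapid])
    fix v :: "real \<times> 'x"
    let ?w = "solve a" and ?w' = "solve (\<lambda>j z. frechet_derivative (a j) (at z) (0, snd v))"
    have w: "rapid k D ?w" by (rule Suc.IH[OF Suc.prems])
    have w': "rapid k D ?w'"
      by (rule Suc.IH[OF rapid_SucD'[OF Suc.prems(1)] tperiodic_frechet[OF Suc.prems]])
    have 1: "rapid k D (\<lambda>j z. 1 * of_real (s (fst z)) * ?w j z)"
      by (rule rapid_mult[OF open_D poly_bdd_const w smooth_time[OF smooth(1)]])
    have 2: "rapid k D (\<lambda>j z. \<mu> j * ?w j z)"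
      by (rule rapid_cmult[OF open_D poly(1) w])
    have 3: "rapid k D (\<lambda>j z. \<nu> j * of_real (q (fst z)) * ?w j z)"
      by (rule rapid_mult[OF open_D poly(2) w smooth_time[OF smooth(2)]])
    have "rapid k D (\<lambda>j z. of_real (fst v) * (1 * of_real (s (fst z)) * ?w j z + \<mu> j * ?w j z
        + \<nu> j * of_real (q (fst z)) * ?w j z + a j z) + ?w' j z)"
      by (intro rapid_add[OF open_D] rapid_cmult[OF open_D] poly_bdd_const 1 2 3 w' Suc.prems(1))
    then show "rapid k D (\<lambda>j z. of_real (fst v) * (A j (fst z) * ?w j z + a j z) + ?w' j z)"
      by (rule rapid_cong[OF open_D, rotated]) (simp add: A_def algebra_simps)
  qed (use Suc.prems in auto)
qed

lemma solve_tperiodic: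
  assumes "tperiodic a"
  shows "tperiodic (solve a)"
  unfolding tperiodic_def
proof (intro allI ballI)
  fix j z assume z: "z \<in> D"
  have "integral {0..2 * pi} (\<lambda>r. exp (E j (fst (z + (2 * pi, 0))) - E j (fst (z + (2 * pi, 0)) + \<sigma> * r))
          * a j (z + (2 * pi, 0) + (\<sigma> * r, 0)))
      = integral {0..2 * pi} (\<lambda>r. exp (E j (fst z) - E j (fst z + \<sigma> * r)) * a j (z + (\<sigma> * r, 0)))"
  proof (rule integral_cong)
    fix r
    have "a j (z + (2 * pi, 0) + (\<sigma> * r, 0)) = a j (z + (\<sigma> * r, 0) + (2 * pi, 0))"
      by (simp add: add_ac)
    also have "\<dots> = a j (z + (\<sigma> * r, 0))"
      using assms z by (simp add: tperiodic_def D_shift)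
    finally have "a j (z + (2 * pi, 0) + (\<sigma> * r, 0)) = a j (z + (\<sigma> * r, 0))" .
    moreover have "E j (fst (z + (2 * pi, 0))) - E j (fst (z + (2 * pi, 0)) + \<sigma> * r)
        = E j (fst z) - E j (fst z + \<sigma> * r)"
      using E_period[of j "fst z"] E_period[of j "fst z + \<sigma> * r"] by (simp add: add_ac)
    ultimately show "exp (E j (fst (z + (2 * pi, 0))) - E j (fst (z + (2 * pi, 0)) + \<sigma> * r))
          * a j (z + (2 * pi, 0) + (\<sigma> * r, 0))
        = exp (E j (fst z) - E j (fst z + \<sigma> * r)) * a j (z + (\<sigma> * r, 0))"
      by simp
  qed
  then show "solve a j (z + (2 * pi, 0)) = solve a j z"
    unfolding solve_def by (simp only:)
qed

text \<open>The hypothesis concerns the time translates of one point only, so \<open>c\<close> may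
  depend on the space variable.\<close>

lemma solve_cmult:
  assumes "\<And>r. b j (z + (\<sigma> * r, 0)) = c * a j (z + (\<sigma> * r, 0))"
  shows "solve b j z = c * solve a j z"
  unfolding solve_def assms mult.left_commute[of _ c] integral_mult_right ..

lemma solve_zero:
  assumes "z \<in> D" "\<And>z. z \<in> D \<Longrightarrow> b j z = 0"
  shows "solve b j z = 0"
proof -
  have "solve b j z = 0 * solve b j z"
    by (rule solve_cmult) (simp add: assms D_shift)
  then show ?thesis by simp
qed

text \<open>The space part of the direction (1, 0) is zero, so the last term of the general
  derivative is the solution for the inhomogeneity 0.\<close>

lemma solve_frechet_time:
  assumes a: "\<And>k. rapid k D a" "tperiodic a" and z: "z \<in> D"
  shows "frechet_derivative (solve a j) (at z) (1, 0) = A j (fst z) * solve a j z + a j z"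
proof -
  have "frechet_derivative (a j) (at z) (0, 0) = 0" if "z \<in> D" for z
    using linear_0[OF has_derivative_linear[OF rapid_SucD[OF a(1) that, of j]]] by (simp add: zero_prod_def)
  then have "solve (\<lambda>j z. frechet_derivative (a j) (at z) (0, snd (1, 0))) j z = 0"
    by (intro solve_zero z) simp
  then show ?thesis
    unfolding frechet_derivative_at[OF solve_has_derivative_rapid[OF assms], symmetric] by simp
qed

text \<open>The direction \<open>w\<close> will be \<open>snd (turn z)\<close>, which varies with
  the space point. As \<open>solve\<close> integrates in time only, the eigenvalue relation is asked
  for just over the space point of \<open>z\<close>.\<close>

lemma solve_frechet_space:
  assumes a: "\<And>k. rapid k D a" "tperiodic a" and z: "z \<in> D"
    and e: "\<And>z'. z' \<in> D \<Longrightarrow> snd z' = snd z \<Longrightarrow> frechet_derivative (a j) (at z') (0, w) = c * a j z'"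
  shows "frechet_derivative (solve a j) (at z) (0, w) = c * solve a j z"
proof -
  have "solve (\<lambda>j z. frechet_derivative (a j) (at z) (0, w)) j z = c * solve a j z"
    by (rule solve_cmult) (use z in \<open>simp add: e D_shift\<close>)
  then show ?thesis
    unfolding frechet_derivative_at[OF solve_has_derivative_rapid[OF a z], symmetric] by simp
qed

end

section \<open>Extension of functions from SU(2)\<close>

text \<open>An open neighbourhood of \<open>SU2\<close> on which the first column can be normalised;
  it is invariant under the flow.\<close>

definition col_ne :: "(complex ^ 2 ^ 2) set" where
  "col_ne = {x. x $ 1 $ 1 \<noteq> 0 \<or> x $ 2 $ 1 \<noteq> 0}"

text \<open>The quaternion matrix with the same first column. The map is real linear, and
  \<open>SU2\<close> consists of its fixed points with first column of length 1.\<close>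

definition quat :: "complex ^ 2 ^ 2 \<Rightarrow> complex ^ 2 ^ 2" where
  "quat x = vector [vector [x $ 1 $ 1, - cnj (x $ 2 $ 1)], vector [x $ 2 $ 1, cnj (x $ 1 $ 1)]]"

lemma quat_nth [simp]:
  "quat x $ 1 $ 1 = x $ 1 $ 1" "quat x $ 1 $ 2 = - cnj (x $ 2 $ 1)"
  "quat x $ 2 $ 1 = x $ 2 $ 1" "quat x $ 2 $ 2 = cnj (x $ 1 $ 1)"
  by (simp_all add: quat_def)

lemma matrix2_eq_iff:
  fixes x y :: "'a ^ 2 ^ 2"
  shows "x = y \<longleftrightarrow> x $ 1 $ 1 = y $ 1 $ 1 \<and> x $ 1 $ 2 = y $ 1 $ 2 \<and> x $ 2 $ 1 = y $ 2 $ 1 \<and> x $ 2 $ 2 = y $ 2 $ 2"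
  by (auto simp: vec_eq_iff forall_2)

lemma bounded_linear_quat: "bounded_linear quat"
  by (intro linear_conv_bounded_linear[THEN iffD1] linearI) (simp_all add: matrix2_eq_iff algebra_simps)

lemma open_col_ne: "open col_ne"
proof -
  have *: "col_ne = {x. x $ 1 $ 1 \<noteq> 0} \<union> {x. x $ 2 $ 1 \<noteq> 0}"
    unfolding col_ne_def by auto
  show ?thesis
    unfolding * by (intro open_Un open_Collect_neq continuous_intros)
qed

lemma SU2_iff:
  "x \<in> SU2 \<longleftrightarrow> quat x = x \<and> (cmod (x $ 1 $ 1))\<^sup>2 + (cmod (x $ 2 $ 1))\<^sup>2 = 1"
proof -
  let ?a = "x $ 1 $ 1" and ?b = "x $ 1 $ 2" and ?c = "x $ 2 $ 1" and ?d = "x $ 2 $ 2"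
  have mem: "x \<in> SU2 \<longleftrightarrow> ?a * cnj ?a + ?b * cnj ?b = 1 \<and> ?a * cnj ?c + ?b * cnj ?d = 0 \<and>
      ?c * cnj ?a + ?d * cnj ?b = 0 \<and> ?c * cnj ?c + ?d * cnj ?d = 1 \<and> ?a * ?d - ?b * ?c = 1"
    unfolding SU2_def
    by (simp add: matrix2_eq_iff matrix_matrix_mult_def sum_2 transpose_def map_matrix_def mat_def det_2)
  have norm: "(cmod ?a)\<^sup>2 + (cmod ?c)\<^sup>2 = 1 \<longleftrightarrow> ?a * cnj ?a + ?c * cnj ?c = 1"
    by (simp only: complex_norm_square[symmetric] of_real_add[symmetric] of_real_eq_1_iff)
  have quat: "quat x = x \<longleftrightarrow> ?b = - cnj ?c \<and> ?d = cnj ?a"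
    by (auto simp: matrix2_eq_iff)
  show ?thesis
  proof
    assume "x \<in> SU2"
    then have h: "?a * cnj ?a + ?b * cnj ?b = 1" "?a * cnj ?c + ?b * cnj ?d = 0"
      "?c * cnj ?a + ?d * cnj ?b = 0" "?c * cnj ?c + ?d * cnj ?d = 1" "?a * ?d - ?b * ?c = 1"
      using mem by auto
    \<comment> \<open>Inserting the determinant 1 and eliminating with the unitarity relations is
      Cramer's rule: the adjugate is the inverse, that is, the conjugate transpose.\<close>
    have "cnj ?a = cnj ?a * (?a * ?d - ?b * ?c)" using h(5) by simp
    also have "\<dots> = (?a * cnj ?a + ?b * cnj ?b) * ?d - ?b * (?c * cnj ?a + ?d * cnj ?b)"
      by (simp add: algebra_simps)
    finally have d: "?d = cnj ?a" using h(1,3) by simp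
    have "cnj ?b = cnj ?b * (?a * ?d - ?b * ?c)" using h(5) by simp
    also have "\<dots> = ?a * (?c * cnj ?a + ?d * cnj ?b) - (?a * cnj ?a + ?b * cnj ?b) * ?c"
      by (simp add: algebra_simps)
    finally have "cnj ?b = - ?c" using h(1,3) by simp
    then have b: "?b = - cnj ?c" by (metis complex_cnj_cnj complex_cnj_minus)
    show "quat x = x \<and> (cmod ?a)\<^sup>2 + (cmod ?c)\<^sup>2 = 1"
      unfolding quat norm using h(5) b d by (simp add: mult.commute)
  next
    assume "quat x = x \<and> (cmod ?a)\<^sup>2 + (cmod ?c)\<^sup>2 = 1"
    then have "?b = - cnj ?c" "?d = cnj ?a" "?a * cnj ?a + ?c * cnj ?c = 1"
      unfolding quat norm by auto
    then show "x \<in> SU2"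
      unfolding mem by (simp add: mult.commute add.commute)
  qed
qed

lemma SU2_subset_col_ne: "SU2 \<subseteq> col_ne"
  by (auto simp: SU2_iff col_ne_def)

lemma omega_nth [simp]:
  "omega \<theta> $ 1 $ 1 = cis (\<theta> / 2)" "omega \<theta> $ 1 $ 2 = 0"
  "omega \<theta> $ 2 $ 1 = 0" "omega \<theta> $ 2 $ 2 = cis (- (\<theta> / 2))"
  by (simp_all add: omega_def)

lemma mult_omega_nth:
  "(x ** omega \<theta>) $ i $ 1 = cis (\<theta> / 2) * x $ i $ 1"
  "(x ** omega \<theta>) $ i $ 2 = cis (- (\<theta> / 2)) * x $ i $ 2"
  by (simp_all add: matrix_matrix_mult_def sum_2)

text \<open>Normalises the first column and completes it to a matrix in \<open>SU2\<close>; a smooth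
  retraction of \<open>col_ne\<close> onto \<open>SU2\<close>.\<close>

definition retr :: "complex ^ 2 ^ 2 \<Rightarrow> complex ^ 2 ^ 2" where
  "retr x = ((cmod (x $ 1 $ 1))\<^sup>2 + (cmod (x $ 2 $ 1))\<^sup>2) powr (- 1 / 2) *\<^sub>R quat x"

lemma retr_SU2: "x \<in> SU2 \<Longrightarrow> retr x = x"
  by (simp add: retr_def SU2_iff)

lemma retr_in_SU2:
  assumes "x \<in> col_ne"
  shows "retr x \<in> SU2"
proof -
  define n where "n = (cmod (x $ 1 $ 1))\<^sup>2 + (cmod (x $ 2 $ 1))\<^sup>2"
  define p where "p = n powr (- 1 / 2)"
  have n: "n > 0"
    using assms by (auto simp: n_def col_ne_def add_pos_nonneg add_nonneg_pos)
  have "p\<^sup>2 = n powr (- 1)"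
    unfolding p_def power2_eq_square powr_add[symmetric] by simp
  then have "p\<^sup>2 * n = 1"
    using n by (simp add: powr_minus)
  then have "p\<^sup>2 * (cmod (x $ 1 $ 1))\<^sup>2 + p\<^sup>2 * (cmod (x $ 2 $ 1))\<^sup>2 = 1"
    by (simp only: n_def distrib_left)
  moreover have "retr x = p *\<^sub>R quat x"
    by (simp only: retr_def p_def n_def)
  ultimately show ?thesis
    unfolding SU2_iff by (simp add: matrix2_eq_iff power_mult_distrib)
qed

definition tube :: "(real \<times> (complex ^ 2 ^ 2)) set" where "tube = UNIV \<times> col_ne"

lemma open_tube: "open tube"
  unfolding tube_def by (intro open_Times open_UNIV open_col_ne)

text \<open>The squared norm, written with inner products, is a polynomial in linear maps and
  positive on \<open>tube\<close>; the pair is split so that only the space part is scaled.\<close>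

lemma smooth_retr: "Ck_on k tube (\<lambda>z. (fst z, retr (snd z)))"
proof -
  let ?n = "\<lambda>z :: real \<times> (complex ^ 2 ^ 2). snd z $ 1 $ 1 \<bullet> snd z $ 1 $ 1 + snd z $ 2 $ 1 \<bullet> snd z $ 2 $ 1"
  have bl: "bounded_linear (\<lambda>z :: real \<times> (complex ^ 2 ^ 2). snd z $ i $ j)" for i j
    by (intro bounded_linear_compose[OF bounded_linear_vec_nth] bounded_linear_snd)
  have n: "Ck_on k tube ?n"
    by (intro Ck_on_add[OF open_tube] Ck_on_inner[OF open_tube] Ck_on_linear[OF open_tube] bl)
  have 1: "Ck_on k tube (\<lambda>z. ?n z powr (- 1 / 2))"
    by (rule Ck_on_powr[OF open_tube n])
      (auto simp: tube_def col_ne_def power2_norm_eq_inner[symmetric] add_pos_nonneg add_nonneg_pos)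
  have 2: "Ck_on k tube (\<lambda>z. (0 :: real, quat (snd z)))"
    by (intro Ck_on_linear[OF open_tube] bounded_linear_Pair bounded_linear_zero
        bounded_linear_compose[OF bounded_linear_quat] bounded_linear_snd)
  have 3: "Ck_on k tube (\<lambda>z. (fst z, 0 :: complex ^ 2 ^ 2))"
    by (intro Ck_on_linear[OF open_tube] bounded_linear_Pair bounded_linear_zero bounded_linear_fst)
  have "Ck_on k tube (\<lambda>z. (fst z, 0 :: complex ^ 2 ^ 2) + ?n z powr (- 1 / 2) *\<^sub>R (0 :: real, quat (snd z)))"
    by (intro Ck_on_add[OF open_tube] Ck_on_scaleR[OF open_tube] 1 2 3)
  then show ?thesis
    by (rule Ck_on_cong[OF open_tube, rotated]) (simp add: retr_def power2_norm_eq_inner)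
qed

text \<open>The local extensions in \<open>smooth_circle_SU2\<close> need not agree off the group.
  Composed with \<open>retr\<close> they do, since only values on \<open>SU2\<close> enter, and so
  they define one smooth function on \<open>tube\<close>.\<close>

lemma smooth_extension:
  assumes f: "smooth_circle_SU2 f"
  shows "smooth_on tube (\<lambda>z. f (fst z) (retr (snd z)))"
  unfolding smooth_on_def
proof
  fix k
  show "Ck_on k tube (\<lambda>z. f (fst z) (retr (snd z)))"
  proof (rule Ck_on_local[OF open_tube])
    fix z assume "z \<in> tube"
    then have z: "retr (snd z) \<in> SU2" by (auto simp: tube_def intro: retr_in_SU2)
    let ?R = "\<lambda>z. (fst z, retr (snd z))"
    obtain U and g :: "real \<times> (complex ^ 2 ^ 2) \<Rightarrow> complex" where g: "open U" "(fst z, retr (snd z)) \<in> U" "smooth_on U g"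
      "\<And>\<tau> y. y \<in> SU2 \<Longrightarrow> (\<tau>, y) \<in> U \<Longrightarrow> g (\<tau>, y) = f \<tau> y"
      using f z unfolding smooth_circle_SU2_def by meson
    define W where "W = ?R -` U \<inter> tube"
    have oW: "open W"
      unfolding W_def using continuous_on_open_vimage[OF open_tube, of ?R]
        Ck_on_imp_continuous_on[OF smooth_retr[of 0]] g(1) by blast
    have RW: "Ck_on k W ?R"
    proof (rule Ck_on_local[OF oW])
      fix x assume "x \<in> W"
      then show "\<exists>V. open V \<and> x \<in> V \<and> Ck_on k V ?R"
        using open_tube smooth_retr[of k] unfolding W_def by blast
    qed
    have "Ck_on k W (\<lambda>x. g (?R x))"
      by (rule Ck_on_compose[OF oW g(1) _ RW]) (use g(3) in \<open>auto simp: W_def smooth_on_def\<close>)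
    then have "Ck_on k W (\<lambda>z. f (fst z) (retr (snd z)))"
      by (rule Ck_on_cong[OF oW, rotated]) (auto simp: W_def tube_def intro!: g(4) retr_in_SU2)
    moreover have "z \<in> W" using \<open>z \<in> tube\<close> g(2) by (simp add: W_def)
    ultimately show "\<exists>V. open V \<and> z \<in> V \<and> Ck_on k V (\<lambda>z. f (fst z) (retr (snd z)))"
      using oW by blast
  qed
qed

lemma smooth_circle_SU2I:
  assumes "smooth_on tube u" "\<And>z. z \<in> tube \<Longrightarrow> u (z + (2 * pi, 0)) = u z"
  shows "smooth_circle_SU2 (\<lambda>t x. u (t, x))"
  unfolding smooth_circle_SU2_def
proof (intro conjI allI ballI)
  fix t x assume "x \<in> SU2"
  then have z: "(t, x) \<in> tube" using SU2_subset_col_ne by (auto simp: tube_def)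
  show "u (t + 2 * pi, x) = u (t, x)"
    using assms(2)[OF z] by simp
  show "\<exists>U g. open U \<and> (t, x) \<in> U \<and> smooth_on U g \<and>
      (\<forall>\<tau>. \<forall>y\<in>SU2. (\<tau>, y) \<in> U \<longrightarrow> g (\<tau>, y) = u (\<tau>, y))"
    using open_tube z assms(1) by blast
qed

section \<open>Fourier coefficients along the flow of the vector field\<close>

definition tpart :: "real \<times> (complex ^ 2 ^ 2) \<Rightarrow> real \<times> (complex ^ 2 ^ 2)" where
  "tpart z = (fst z, 0)"

definition xpart :: "real \<times> (complex ^ 2 ^ 2) \<Rightarrow> real \<times> (complex ^ 2 ^ 2)" where
  "xpart z = (0, snd z)"

text \<open>Generator of \<open>rot\<close>: right multiplication of the space part by diag(i, -i).
  It is twice the real vector field behind \<open>d0\<close>, which therefore is i/2 times the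
  derivative along \<open>turn\<close>.\<close>

definition turn :: "real \<times> (complex ^ 2 ^ 2) \<Rightarrow> real \<times> (complex ^ 2 ^ 2)" where
  "turn z = (0, vector [vector [\<i> * snd z $ 1 $ 1, - \<i> * snd z $ 1 $ 2],
    vector [\<i> * snd z $ 2 $ 1, - \<i> * snd z $ 2 $ 2]])"

text \<open>Right translation by \<open>omega (2 * \<phi>)\<close>, see \<open>rot_Pair\<close>.
  Doubling the angle gives the flow period 2 pi where \<open>omega\<close> has period 4 pi, and
  makes the frequencies integers \<open>j\<close> = 2m. The trigonometric form with fixed linear
  maps exposes the dependence on \<open>\<phi>\<close>.\<close>

definition rot :: "real \<Rightarrow> real \<times> (complex ^ 2 ^ 2) \<Rightarrow> real \<times> (complex ^ 2 ^ 2)" where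
  "rot \<phi> z = tpart z + cos \<phi> *\<^sub>R xpart z + sin \<phi> *\<^sub>R turn z"

lemma bounded_linear_tpart: "bounded_linear tpart"
  unfolding tpart_def by (intro bounded_linear_Pair bounded_linear_zero bounded_linear_fst)

lemma bounded_linear_xpart: "bounded_linear xpart"
  unfolding xpart_def by (intro bounded_linear_Pair bounded_linear_zero bounded_linear_snd)

lemma bounded_linear_turn: "bounded_linear turn"
  by (intro linear_conv_bounded_linear[THEN iffD1] linearI)
    (simp_all add: turn_def prod_eq_iff matrix2_eq_iff algebra_simps)

lemma bounded_linear_rot: "bounded_linear (rot \<phi>)"
  unfolding rot_def
  by (intro bounded_linear_add bounded_linear_scaleR_right[THEN bounded_linear_compose]
      bounded_linear_tpart bounded_linear_xpart bounded_linear_turn)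

lemma fst_rot [simp]: "fst (rot \<phi> z) = fst z"
  by (simp add: rot_def tpart_def xpart_def turn_def)

lemma snd_rot_nth:
  "snd (rot \<phi> z) $ 1 $ 1 = cis \<phi> * snd z $ 1 $ 1" "snd (rot \<phi> z) $ 2 $ 1 = cis \<phi> * snd z $ 2 $ 1"
  "snd (rot \<phi> z) $ 1 $ 2 = cis (- \<phi>) * snd z $ 1 $ 2" "snd (rot \<phi> z) $ 2 $ 2 = cis (- \<phi>) * snd z $ 2 $ 2"
  by (simp_all add: rot_def tpart_def xpart_def turn_def complex_eq_iff algebra_simps)

lemma rot_Pair: "rot \<phi> (t, x) = (t, x ** omega (2 * \<phi>))"
  by (simp add: prod_eq_iff matrix2_eq_iff snd_rot_nth mult_omega_nth)

lemma rot_tube: "z \<in> tube \<Longrightarrow> rot \<phi> z \<in> tube"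
  by (simp add: tube_def col_ne_def mem_Times_iff snd_rot_nth)

lemma rot_0 [simp]: "rot 0 z = z"
  by (simp add: prod_eq_iff matrix2_eq_iff snd_rot_nth)

lemma rot_periodic: "rot (\<phi> + 2 * pi) z = rot \<phi> z"
  unfolding rot_def by simp

lemma rot_turn: "rot \<phi> (turn z) = turn (rot \<phi> z)"
  by (simp add: prod_eq_iff matrix2_eq_iff snd_rot_nth) (simp add: turn_def snd_rot_nth)

lemma rot_has_vector_derivative: "((\<lambda>\<phi>. rot \<phi> z) has_vector_derivative turn (rot \<phi> z)) (at \<phi>)"
proof -
  have "((\<lambda>\<phi>. tpart z + cos \<phi> *\<^sub>R xpart z + sin \<phi> *\<^sub>R turn z) has_vector_derivative
      0 + (cos \<phi> *\<^sub>R 0 + (- sin \<phi>) *\<^sub>R xpart z) + (sin \<phi> *\<^sub>R 0 + cos \<phi> *\<^sub>R turn z)) (at \<phi>)"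
    by (intro has_vector_derivative_add has_vector_derivative_scaleR has_vector_derivative_const DERIV_cos DERIV_sin)
  moreover have "0 + (cos \<phi> *\<^sub>R 0 + (- sin \<phi>) *\<^sub>R xpart z) + (sin \<phi> *\<^sub>R 0 + cos \<phi> *\<^sub>R turn z) = turn (rot \<phi> z)"
    by (simp add: prod_eq_iff matrix2_eq_iff turn_def snd_rot_nth)
      (simp add: xpart_def complex_eq_iff algebra_simps)
  ultimately show ?thesis unfolding rot_def by simp
qed

lemma continuous_on_rot: "continuous_on S (\<lambda>p. rot (snd p) (fst p))"
  unfolding rot_def
  by (intro continuous_intros bounded_linear.continuous_on[OF bounded_linear_tpart]
      bounded_linear.continuous_on[OF bounded_linear_xpart] bounded_linear.continuous_on[OF bounded_linear_turn])

lemma compact_rot_orbit: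
  assumes "compact K" "K \<subseteq> tube"
  shows "compact ((\<lambda>p. rot (snd p) (fst p)) ` (K \<times> {0..2 * pi}))"
    "(\<lambda>p. rot (snd p) (fst p)) ` (K \<times> {0..2 * pi}) \<subseteq> tube"
  using assms(2) by (auto intro!: compact_continuous_image compact_Times assms(1) continuous_on_rot rot_tube)

lemma frechet_derivative_linear:
  assumes "smooth_on U F" "z \<in> U"
  shows "linear (frechet_derivative F (at z))"
  by (rule has_derivative_linear[OF smooth_on_has_derivative[OF assms]])

text \<open>The direction varies linearly with the point; in coordinates the derivative is a finite
  sum of smooth products.\<close>

lemma smooth_on_directional:
  fixes F :: "'a::euclidean_space \<Rightarrow> complex"
  assumes "open U" "smooth_on U F" "bounded_linear L"
  shows "smooth_on U (\<lambda>z. frechet_derivative F (at z) (L z))"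
  unfolding smooth_on_def
proof
  fix k
  have "Ck_on k U (\<lambda>z. L z \<bullet> b)" for b
    by (rule Ck_on_bounded_linear[OF assms(1) bounded_linear_inner_left Ck_on_linear[OF assms(1,3)]])
  moreover have "Ck_on k U (\<lambda>z. frechet_derivative F (at z) b)" for b
    using smooth_on_frechet[OF assms(2)] unfolding smooth_on_def by blast
  ultimately have "Ck_on k U (\<lambda>z. \<Sum>b\<in>Basis. (L z \<bullet> b) *\<^sub>R frechet_derivative F (at z) b)"
    by (intro Ck_on_sum Ck_on_scaleR assms(1))
  then show "Ck_on k U (\<lambda>z. frechet_derivative F (at z) (L z))"
  proof (rule Ck_on_cong[OF assms(1), rotated])
    fix z assume z: "z \<in> U"
    note l = frechet_derivative_linear[OF assms(2) z]
    have "frechet_derivative F (at z) (L z) = frechet_derivative F (at z) (\<Sum>b\<in>Basis. (L z \<bullet> b) *\<^sub>R b)"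
      by (simp only: euclidean_representation)
    also have "\<dots> = (\<Sum>b\<in>Basis. (L z \<bullet> b) *\<^sub>R frechet_derivative F (at z) b)"
      by (simp only: linear_sum[OF l] linear_scale[OF l])
    finally show "(\<Sum>b\<in>Basis. (L z \<bullet> b) *\<^sub>R frechet_derivative F (at z) b) = frechet_derivative F (at z) (L z)"
      by (rule sym)
  qed
qed

text \<open>Cosine and sine are combinations of the characters of index 1 and -1, so they shift
  coefficients. They enter through \<open>rot \<phi> v\<close> in the derivative of a mode.\<close>

lemma fourier_trig:
  assumes a: "continuous_on {0..2 * pi} a" and b: "continuous_on {0..2 * pi} b" and c: "continuous_on {0..2 * pi} c"
  shows "fourier (\<lambda>\<phi>. a \<phi> + cos \<phi> *\<^sub>R b \<phi> + sin \<phi> *\<^sub>R c \<phi>) j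
    = fourier a j + (1 / 2) * (fourier b (j + 1) + fourier b (j - 1))
      + (1 / (2 * \<i>)) * (fourier c (j + 1) - fourier c (j - 1))"
proof -
  have int: "((\<lambda>\<phi>. cis (of_int j * \<phi>) * g \<phi>) has_integral (fourier g j * (2 * pi))) {0..2 * pi}"
    if "continuous_on {0..2 * pi} g" for g j
  proof -
    have "(\<lambda>\<phi>. cis (of_int j * \<phi>) * g \<phi>) integrable_on {0..2 * pi}"
      using that by (intro integrable_continuous_real continuous_intros)
    from integrable_integral[OF this] show ?thesis by (simp add: fourier_def)
  qed
  have e: "cis (of_int j * \<phi>) * (a \<phi> + cos \<phi> *\<^sub>R b \<phi> + sin \<phi> *\<^sub>R c \<phi>) =
     cis (of_int j * \<phi>) * a \<phi>
     + (1 / 2) * (cis (of_int (j + 1) * \<phi>) * b \<phi> + cis (of_int (j - 1) * \<phi>) * b \<phi>)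
     + (1 / (2 * \<i>)) * (cis (of_int (j + 1) * \<phi>) * c \<phi> - cis (of_int (j - 1) * \<phi>) * c \<phi>)" for \<phi>
  proof -
    have p: "cis (of_int (j + 1) * \<phi>) = cis (of_int j * \<phi>) * cis \<phi>"
      by (simp add: cis_mult distrib_right)
    have m: "cis (of_int (j - 1) * \<phi>) = cis (of_int j * \<phi>) * cis (- \<phi>)"
      by (simp add: cis_mult left_diff_distrib)
    have "(1 / 2) * (cis \<phi> + cis (- \<phi>)) = of_real (cos \<phi>)"
      by (simp add: complex_eq_iff)
    moreover have "(1 / (2 * \<i>)) * (cis \<phi> - cis (- \<phi>)) = of_real (sin \<phi>)"
      by (simp add: complex_eq_iff)
    ultimately have "cis (of_int j * \<phi>) * (a \<phi> + cos \<phi> *\<^sub>R b \<phi> + sin \<phi> *\<^sub>R c \<phi>)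
       = cis (of_int j * \<phi>) * (a \<phi> + ((1 / 2) * (cis \<phi> + cis (- \<phi>))) * b \<phi> + ((1 / (2 * \<i>)) * (cis \<phi> - cis (- \<phi>))) * c \<phi>)"
      by (simp only: scaleR_conv_of_real)
    then show ?thesis
      unfolding p m
      by (simp only: distrib_left distrib_right left_diff_distrib right_diff_distrib mult_ac add_ac)
  qed
  have "((\<lambda>\<phi>. cis (of_int j * \<phi>) * (a \<phi> + cos \<phi> *\<^sub>R b \<phi> + sin \<phi> *\<^sub>R c \<phi>)) has_integral
     (fourier a j * (2 * pi)
     + (1 / 2) * (fourier b (j + 1) * (2 * pi) + fourier b (j - 1) * (2 * pi))
     + (1 / (2 * \<i>)) * (fourier c (j + 1) * (2 * pi) - fourier c (j - 1) * (2 * pi)))) {0..2 * pi}"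
    unfolding e
    by (intro has_integral_add has_integral_diff has_integral_mult_right int a b c)
  then have "((\<lambda>\<phi>. cis (of_int j * \<phi>) * (a \<phi> + cos \<phi> *\<^sub>R b \<phi> + sin \<phi> *\<^sub>R c \<phi>)) has_integral
     ((fourier a j + (1 / 2) * (fourier b (j + 1) + fourier b (j - 1))
      + (1 / (2 * \<i>)) * (fourier c (j + 1) - fourier c (j - 1))) * (2 * pi))) {0..2 * pi}"
    by (simp only: distrib_right left_diff_distrib mult.assoc)
  from integral_unique[OF this] show ?thesis
    unfolding fourier_def[of "\<lambda>\<phi>. a \<phi> + cos \<phi> *\<^sub>R b \<phi> + sin \<phi> *\<^sub>R c \<phi>"]
    by simp
qed

text \<open>The component of \<open>F\<close> of weight j/2 under right translation.\<close>

definition fcoef :: "(real \<times> (complex ^ 2 ^ 2) \<Rightarrow> complex) \<Rightarrow> int \<Rightarrow> real \<times> (complex ^ 2 ^ 2) \<Rightarrow> complex" where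
  "fcoef F j z = fourier (\<lambda>\<phi>. F (rot \<phi> z)) j"

lemma rot_flow_continuous:
  assumes "continuous_on tube F" "z \<in> tube"
  shows "continuous_on S (\<lambda>\<phi>. F (rot \<phi> z))"
proof (rule continuous_on_compose2[OF assms(1)])
  have "continuous_on S (\<lambda>\<phi>. rot (snd (z, \<phi>)) (fst (z, \<phi>)))"
    by (rule continuous_on_compose2[OF continuous_on_rot[of UNIV]]) (auto intro!: continuous_intros)
  then show "continuous_on S (\<lambda>\<phi>. rot \<phi> z)" by simp
qed (use rot_tube[OF assms(2)] in blast)

lemma rot_flow_derivative:
  assumes "smooth_on tube F" "z \<in> tube"
  shows "((\<lambda>\<phi>. F (rot \<phi> z)) has_vector_derivative
    frechet_derivative F (at (rot \<phi> z)) (turn (rot \<phi> z))) (at \<phi>)"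
proof -
  have "((\<lambda>\<phi>. F (rot \<phi> z)) has_derivative
      (\<lambda>h. frechet_derivative F (at (rot \<phi> z)) (h *\<^sub>R turn (rot \<phi> z)))) (at \<phi>)"
    by (rule has_derivative_compose[OF rot_has_vector_derivative[unfolded has_vector_derivative_def]
          smooth_on_has_derivative[OF assms(1) rot_tube[OF assms(2)]]])
  then show ?thesis
    unfolding has_vector_derivative_def linear_scale[OF frechet_derivative_linear[OF assms(1) rot_tube[OF assms(2)]]] .
qed

text \<open>Integration by parts along the flow; the boundary terms cancel because the orbit closes
  after 2 pi.\<close>

lemma fcoef_turn:
  assumes "smooth_on tube F" "z \<in> tube"
  shows "fcoef (\<lambda>z. frechet_derivative F (at z) (turn z)) j z = - \<i> * of_int j * fcoef F j z"
proof -
  let ?Y = "\<lambda>z. frechet_derivative F (at z) (turn z)"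
  have Yc: "continuous_on tube ?Y"
    by (intro smooth_on_continuous_on smooth_on_directional open_tube assms(1) bounded_linear_turn)
  let ?c = "\<lambda>\<phi>. cis (of_int j * \<phi>)"
  have "(?c has_vector_derivative (\<i> * of_int j * ?c \<phi>)) (at \<phi>)" for \<phi>
    by (auto intro!: derivative_eq_intros simp: has_vector_derivative_def scaleR_conv_of_real mult_ac)
  from has_vector_derivative_mult[OF this rot_flow_derivative[OF assms]]
  have d: "((\<lambda>\<phi>. ?c \<phi> * F (rot \<phi> z)) has_vector_derivative
      (?c \<phi> * ?Y (rot \<phi> z) + (\<i> * of_int j * ?c \<phi>) * F (rot \<phi> z))) (at \<phi>)" for \<phi> .
  have "((\<lambda>\<phi>. ?c \<phi> * ?Y (rot \<phi> z) + (\<i> * of_int j * ?c \<phi>) * F (rot \<phi> z)) has_integral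
      (?c (2 * pi) * F (rot (2 * pi) z) - ?c 0 * F (rot 0 z))) {0..2 * pi}"
    by (rule fundamental_theorem_of_calculus[OF _ has_vector_derivative_at_within[OF d]]) simp
  moreover have "?c (2 * pi) * F (rot (2 * pi) z) - ?c 0 * F (rot 0 z) = 0"
    using cis_int_periodic[of j 0] rot_periodic[of 0 z] by simp
  ultimately have 1: "((\<lambda>\<phi>. ?c \<phi> * ?Y (rot \<phi> z) + \<i> * of_int j * (?c \<phi> * F (rot \<phi> z))) has_integral 0) {0..2 * pi}"
    by (simp only: mult.assoc)
  have cc: "continuous_on {0..2 * pi} ?c"
    by (intro continuous_intros)
  have "continuous_on {0..2 * pi} (\<lambda>\<phi>. ?c \<phi> * ?Y (rot \<phi> z))"
    by (rule continuous_on_mult[OF cc rot_flow_continuous[OF Yc assms(2)]])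
  note i1 = integrable_integral[OF integrable_continuous_real[OF this]]
  have "continuous_on {0..2 * pi} (\<lambda>\<phi>. ?c \<phi> * F (rot \<phi> z))"
    by (rule continuous_on_mult[OF cc rot_flow_continuous[OF smooth_on_continuous_on[OF assms(1)] assms(2)]])
  note i2 = integrable_integral[OF integrable_continuous_real[OF this]]
  have 2: "((\<lambda>\<phi>. ?c \<phi> * ?Y (rot \<phi> z) + \<i> * of_int j * (?c \<phi> * F (rot \<phi> z))) has_integral
      (integral {0..2 * pi} (\<lambda>\<phi>. ?c \<phi> * ?Y (rot \<phi> z))
        + \<i> * of_int j * integral {0..2 * pi} (\<lambda>\<phi>. ?c \<phi> * F (rot \<phi> z)))) {0..2 * pi}"
    by (rule has_integral_add[OF i1 has_integral_mult_right[OF i2]])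
  have "integral {0..2 * pi} (\<lambda>\<phi>. ?c \<phi> * ?Y (rot \<phi> z))
        + \<i> * of_int j * integral {0..2 * pi} (\<lambda>\<phi>. ?c \<phi> * F (rot \<phi> z)) = 0"
    by (rule has_integral_unique[OF 2 1])
  then have "integral {0..2 * pi} (\<lambda>\<phi>. ?c \<phi> * ?Y (rot \<phi> z))
        = - (\<i> * of_int j * integral {0..2 * pi} (\<lambda>\<phi>. ?c \<phi> * F (rot \<phi> z)))"
    by (simp only: eq_neg_iff_add_eq_0)
  then show ?thesis
    unfolding fcoef_def fourier_def by simp
qed

text \<open>Each use of \<open>fcoef_turn\<close> exchanges one factor |j| for a derivative of
  \<open>F\<close> along the flow, and smooth functions are bounded on the compact union of the
  orbits through \<open>K\<close>.\<close>

lemma fcoef_decay: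
  assumes "compact K" "K \<subseteq> tube" "smooth_on tube F"
  shows "\<exists>C. \<forall>j. \<forall>z\<in>K. cmod (fcoef F j z) * \<bar>real_of_int j\<bar> ^ N \<le> C"
  using assms(3)
proof (induction N arbitrary: F)
  case 0
  let ?K = "(\<lambda>p. rot (snd p) (fst p)) ` (K \<times> {0..2 * pi})"
  note K' = compact_rot_orbit[OF assms(1,2)]
  have "compact (F ` ?K)"
    by (rule compact_continuous_image[OF continuous_on_subset[OF smooth_on_continuous_on[OF 0] K'(2)] K'(1)])
  from compact_imp_bounded[OF this] obtain C where C: "\<And>w. w \<in> F ` ?K \<Longrightarrow> cmod w \<le> C"
    unfolding bounded_iff by blast
  show ?case
  proof (intro exI allI ballI)
    fix j z assume z: "z \<in> K"
    have "cmod (integral {0..2 * pi} (\<lambda>\<phi>. cis (of_int j * \<phi>) * F (rot \<phi> z))) \<le> 2 * pi * C"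
    proof (rule integral_cmod_bound)
      show "continuous_on {0..2 * pi} (\<lambda>\<phi>. cis (of_int j * \<phi>) * F (rot \<phi> z))"
        by (rule continuous_on_mult[OF _ rot_flow_continuous[OF smooth_on_continuous_on[OF 0]]])
          (use z assms(2) in \<open>auto intro!: continuous_intros\<close>)
      fix \<phi> :: real assume "\<phi> \<in> {0..2 * pi}"
      then have "rot \<phi> z \<in> ?K"
        using z by (intro image_eqI[of _ _ "(z, \<phi>)"]) auto
      then have "cmod (F (rot \<phi> z)) \<le> C" by (intro C imageI)
      then show "cmod (cis (of_int j * \<phi>) * F (rot \<phi> z)) \<le> C" by (simp add: norm_mult)
    qed
    then show "cmod (fcoef F j z) * \<bar>real_of_int j\<bar> ^ 0 \<le> C"
      using pi_gt_zero by (simp add: fcoef_def fourier_def norm_divide norm_mult field_simps)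
  qed
next
  case (Suc N)
  obtain C where C: "\<And>j z. z \<in> K \<Longrightarrow>
      cmod (fcoef (\<lambda>z. frechet_derivative F (at z) (turn z)) j z) * \<bar>real_of_int j\<bar> ^ N \<le> C"
    using Suc.IH[OF smooth_on_directional[OF open_tube Suc.prems bounded_linear_turn]] by blast
  show ?case
  proof (intro exI allI ballI)
    fix j z assume z: "z \<in> K"
    then have "z \<in> tube" using assms(2) by blast
    from C[OF z, of j] show "cmod (fcoef F j z) * \<bar>real_of_int j\<bar> ^ Suc N \<le> C"
      unfolding fcoef_turn[OF Suc.prems \<open>z \<in> tube\<close>] by (simp add: norm_mult mult_ac)
  qed
qed

lemma fcoef_has_derivative:
  assumes F: "smooth_on tube F" and z: "z \<in> tube"
  shows "(fcoef F j has_derivative (\<lambda>v. fourier (\<lambda>\<phi>. frechet_derivative F (at (rot \<phi> z)) (rot \<phi> v)) j)) (at z)"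
proof -
  let ?F' = "\<lambda>z. frechet_derivative F (at z)"
  define h where "h = (\<lambda>z \<phi>. cis (of_int j * \<phi>) * F (rot \<phi> z))"
  define h' where "h' = (\<lambda>z \<phi> v. cis (of_int j * \<phi>) * ?F' (rot \<phi> z) (rot \<phi> v))"
  have "((\<lambda>z. integral {0..2 * pi} (h z)) has_derivative (\<lambda>v. integral {0..2 * pi} (\<lambda>\<phi>. h' z \<phi> v))) (at z)"
  proof (rule integral_has_derivative[OF open_tube z])
    fix \<phi> z assume z: "z \<in> tube"
    show "((\<lambda>z. h z \<phi>) has_derivative h' z \<phi>) (at z)"
      unfolding h_def h'_def
      by (rule has_derivative_mult_right[OF has_derivative_compose[OF
            bounded_linear_imp_has_derivative[OF bounded_linear_rot]
            smooth_on_has_derivative[OF F rot_tube[OF z]]]])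
    show "continuous_on {0..2 * pi} (h z)"
      unfolding h_def
      by (rule continuous_on_mult[OF _ rot_flow_continuous[OF smooth_on_continuous_on[OF F] z]])
        (intro continuous_intros)
  next
    fix v
    have c: "continuous_on (tube \<times> {0..2 * pi}) (\<lambda>p. ?F' (rot (snd p) (fst p)) w)" for w
      by (rule continuous_on_compose2[OF smooth_on_continuous_on[OF smooth_on_frechet[OF F]] continuous_on_rot])
        (auto intro: rot_tube)
    \<comment> \<open>The direction \<open>rot \<phi> v\<close> varies with \<open>\<phi>\<close>;
      splitting it leaves derivatives in three fixed directions, whose continuity is known.\<close>
    have "continuous_on (tube \<times> {0..2 * pi}) (\<lambda>p. cis (of_int j * snd p) * (?F' (rot (snd p) (fst p)) (tpart v)
       + cos (snd p) *\<^sub>R ?F' (rot (snd p) (fst p)) (xpart v) + sin (snd p) *\<^sub>R ?F' (rot (snd p) (fst p)) (turn v)))"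
      by (intro continuous_on_mult continuous_on_add continuous_on_scaleR c) (auto intro!: continuous_intros)
    then show "continuous_on (tube \<times> {0..2 * pi}) (\<lambda>p. h' (fst p) (snd p) v)"
    proof (rule continuous_on_eq)
      fix p assume "p \<in> tube \<times> {0..2 * pi}"
      then have "rot (snd p) (fst p) \<in> tube" by (auto intro: rot_tube)
      note l = frechet_derivative_linear[OF F this]
      show "cis (of_int j * snd p) * (?F' (rot (snd p) (fst p)) (tpart v)
         + cos (snd p) *\<^sub>R ?F' (rot (snd p) (fst p)) (xpart v) + sin (snd p) *\<^sub>R ?F' (rot (snd p) (fst p)) (turn v))
         = h' (fst p) (snd p) v"
        unfolding h'_def rot_def[of "snd p" v] by (simp only: linear_add[OF l] linear_scale[OF l])
    qed
  qed
  from has_derivative_mult_right[OF this, of "1 / (2 * pi)"]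
  show ?thesis
    unfolding fcoef_def[abs_def] fourier_def h_def h'_def by simp
qed

text \<open>Writes a derivative of a mode through modes of derivatives of \<open>F\<close> in fixed
  directions. This closes the induction in \<open>fcoef_rapid\<close>.\<close>

lemma fcoef_derivative_formula:
  assumes F: "smooth_on tube F" and z: "z \<in> tube"
  shows "fourier (\<lambda>\<phi>. frechet_derivative F (at (rot \<phi> z)) (rot \<phi> v)) j =
    fcoef (\<lambda>z. frechet_derivative F (at z) (tpart v)) j z
    + (1 / 2) * (fcoef (\<lambda>z. frechet_derivative F (at z) (xpart v)) (j + 1) z
       + fcoef (\<lambda>z. frechet_derivative F (at z) (xpart v)) (j - 1) z)
    + (1 / (2 * \<i>)) * (fcoef (\<lambda>z. frechet_derivative F (at z) (turn v)) (j + 1) z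
       - fcoef (\<lambda>z. frechet_derivative F (at z) (turn v)) (j - 1) z)"
proof -
  have "frechet_derivative F (at (rot \<phi> z)) (rot \<phi> v) = frechet_derivative F (at (rot \<phi> z)) (tpart v)
     + cos \<phi> *\<^sub>R frechet_derivative F (at (rot \<phi> z)) (xpart v)
     + sin \<phi> *\<^sub>R frechet_derivative F (at (rot \<phi> z)) (turn v)" for \<phi>
  proof -
    note l = frechet_derivative_linear[OF F rot_tube[OF z], of \<phi>]
    show ?thesis unfolding rot_def[of \<phi> v] by (simp only: linear_add[OF l] linear_scale[OF l])
  qed
  then show ?thesis
    unfolding fcoef_def
    by (simp only:) (rule fourier_trig; rule rot_flow_continuous[OF smooth_on_continuous_on[OF smooth_on_frechet[OF F]] z])
qed

lemma fcoef_rapid0: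
  assumes F: "smooth_on tube F"
  shows "rapid0 tube (fcoef F)"
  unfolding rapid0_def
proof (intro conjI allI impI)
  show "continuous_on tube (fcoef F j)" for j
    by (intro continuous_at_imp_continuous_on ballI has_derivative_continuous[OF fcoef_has_derivative[OF F]])
  fix N K assume K: "compact K" "K \<subseteq> tube"
  obtain C where C: "\<And>j z. z \<in> K \<Longrightarrow> cmod (fcoef F j z) * \<bar>real_of_int j\<bar> ^ N \<le> C"
    using fcoef_decay[OF K F] by blast
  obtain C0 where C0: "\<And>j z. z \<in> K \<Longrightarrow> cmod (fcoef F j z) * \<bar>real_of_int j\<bar> ^ 0 \<le> C0"
    using fcoef_decay[OF K F] by blast
  show "\<exists>C. \<forall>j. \<forall>z\<in>K. cmod (fcoef F j z) * (1 + \<bar>real_of_int j\<bar>) ^ N \<le> C"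
  proof (intro exI allI ballI)
    fix j z assume z: "z \<in> K"
    have c0: "C0 \<ge> 0"
      by (rule order_trans[OF _ C0[OF z, of j]]) simp
    have c1: "C \<ge> 0"
      by (rule order_trans[OF _ C[OF z, of j]]) simp
    \<comment> \<open>For nonzero \<open>j\<close>, 1 + |j| <= 2 |j| gives the first summand;
      \<open>C0\<close> bounds the mode 0.\<close>
    show "cmod (fcoef F j z) * (1 + \<bar>real_of_int j\<bar>) ^ N \<le> 2 ^ N * C + C0"
    proof (cases "j = 0")
      case True
      moreover have "0 \<le> 2 ^ N * C" using c1 by simp
      ultimately show ?thesis using C0[OF z, of j] by simp
    next
      case False
      then have "1 + \<bar>real_of_int j\<bar> \<le> 2 * \<bar>real_of_int j\<bar>" by linarith
      then have "(1 + \<bar>real_of_int j\<bar>) ^ N \<le> (2 * \<bar>real_of_int j\<bar>) ^ N"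
        by (intro power_mono) auto
      then have "cmod (fcoef F j z) * (1 + \<bar>real_of_int j\<bar>) ^ N \<le> cmod (fcoef F j z) * (2 * \<bar>real_of_int j\<bar>) ^ N"
        by (rule mult_left_mono) simp
      also have "\<dots> = 2 ^ N * (cmod (fcoef F j z) * \<bar>real_of_int j\<bar> ^ N)"
        by (simp only: power_mult_distrib mult_ac)
      also have "\<dots> \<le> 2 ^ N * C"
        by (intro mult_left_mono C z) simp
      finally show ?thesis using c0 by simp
    qed
  qed
qed

lemma fcoef_rapid:
  assumes "smooth_on tube F"
  shows "rapid k tube (fcoef F)"
  using assms
proof (induction k arbitrary: F)
  case 0
  then show ?case using fcoef_rapid0 by simp
next
  case (Suc k)
  show ?case
  proof (rule rapid_SucI[OF open_tube fcoef_rapid0[OF Suc.prems] fcoef_has_derivative[OF Suc.prems]])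
    fix v
    let ?F = "\<lambda>w z. frechet_derivative F (at z) w"
    have r: "rapid k tube (fcoef (?F w))" for w
      by (rule Suc.IH[OF smooth_on_frechet[OF Suc.prems]])
    have p: "rapid k tube (\<lambda>j z. fcoef (?F w) (j + 1) z)" for w
      using rapid_shift[OF r, of w 1] .
    have m': "rapid k tube (\<lambda>j z. fcoef (?F w) (j - 1) z)" for w
      using rapid_shift[OF r, of w "-1"] by simp
    have "rapid k tube (\<lambda>j z. fcoef (?F (tpart v)) j z
      + (1 / 2) * (fcoef (?F (xpart v)) (j + 1) z + fcoef (?F (xpart v)) (j - 1) z)
      + (1 / (2 * \<i>)) * (fcoef (?F (turn v)) (j + 1) z + (- 1) * fcoef (?F (turn v)) (j - 1) z))"
      by (intro rapid_add[OF open_tube] rapid_cmult[OF open_tube poly_bdd_const] r p m')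
    then show "rapid k tube (\<lambda>j z. fourier (\<lambda>\<phi>. frechet_derivative F (at (rot \<phi> z)) (rot \<phi> v)) j)"
      by (rule rapid_cong[OF open_tube, rotated]) (simp add: fcoef_derivative_formula[OF Suc.prems])
  qed
qed

text \<open>\<open>rot\<close> commutes with its generator, so differentiating the mode along
  \<open>turn\<close> is taking the mode of the derivative, to which \<open>fcoef_turn\<close>
  applies.\<close>

lemma fcoef_frechet_turn:
  assumes F: "smooth_on tube F" and z: "z \<in> tube"
  shows "frechet_derivative (fcoef F j) (at z) (turn z) = - \<i> * of_int j * fcoef F j z"
proof -
  have "frechet_derivative (fcoef F j) (at z) (turn z) = fourier (\<lambda>\<phi>. frechet_derivative F (at (rot \<phi> z)) (rot \<phi> (turn z))) j"
    unfolding frechet_derivative_at[OF fcoef_has_derivative[OF F z, of j], symmetric] ..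
  also have "\<dots> = fcoef (\<lambda>z. frechet_derivative F (at z) (turn z)) j z"
    unfolding fcoef_def rot_turn ..
  finally show ?thesis unfolding fcoef_turn[OF F z] .
qed

lemma fcoef_sums:
  assumes F: "smooth_on tube F" and z: "z \<in> tube"
  shows "zterm (\<lambda>j. fcoef F j z) sums F z"
proof -
  have "zterm (fourier (\<lambda>\<phi>. F (rot \<phi> z))) sums F (rot 0 z)"
    by (rule fourier_inversion[OF rot_flow_continuous[OF smooth_on_continuous_on[OF F] z] _ rot_flow_derivative[OF F z]])
      (simp add: rot_periodic)
  then show ?thesis unfolding fcoef_def rot_0 .
qed

lemma fcoef_tperiodic:
  assumes "\<And>z. z \<in> tube \<Longrightarrow> F (z + (2 * pi, 0)) = F z" "z \<in> tube"
  shows "fcoef F j (z + (2 * pi, 0)) = fcoef F j z"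
proof -
  have "rot \<phi> (z + (2 * pi, 0)) = rot \<phi> z + (2 * pi, 0)" for \<phi>
    by (simp add: prod_eq_iff matrix2_eq_iff snd_rot_nth)
  then show ?thesis
    unfolding fcoef_def by (simp add: assms(1)[OF rot_tube[OF assms(2)]])
qed

section \<open>Exponents and small divisors\<close>

lemma periodic_antiderivative:
  fixes g :: "real \<Rightarrow> real"
  assumes g: "continuous_on UNIV g" and per: "\<And>t. g (t + 2 * pi) = g t"
  obtains G where "\<And>t. (G has_vector_derivative g t) (at t)" "G 0 = 0"
    "\<And>t. G (t + 2 * pi) = G t + integral {0..2 * pi} g"
proof -
  \<comment> \<open>The extended interval is the whole line, so the antiderivative also exists at
    negative times, which integration backward needs.\<close>
  have "\<exists>F. \<forall>x::real. - \<infinity> < ereal x \<longrightarrow> ereal x < \<infinity> \<longrightarrow> (F has_vector_derivative g x) (at x)"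
    by (rule einterval_antiderivative) (use g in \<open>auto simp: continuous_on_eq_continuous_at\<close>)
  then obtain F where F: "\<And>x. (F has_vector_derivative g x) (at x)" by auto
  define G where "G = (\<lambda>t. F t - F 0)"
  have G: "(G has_vector_derivative g t) (at t)" for t
    unfolding G_def using has_vector_derivative_diff[OF F[of t] has_vector_derivative_const[of "F 0"]] by simp
  have "((\<lambda>t. G (t + 2 * pi) - G t) has_vector_derivative 0) (at t within UNIV)" for t
  proof -
    have "((\<lambda>t. t + 2 * pi) has_vector_derivative 1 + 0) (at t)"
      by (intro has_vector_derivative_add has_vector_derivative_id has_vector_derivative_const)
    from vector_diff_chain_at[OF this G]
    have "((\<lambda>t. G (t + 2 * pi)) has_vector_derivative g t) (at t)"
      by (simp add: o_def per)
    from has_vector_derivative_diff[OF this G[of t]] show ?thesis by simp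
  qed
  then obtain c where c: "\<And>t. G (t + 2 * pi) - G t = c"
    using has_vector_derivative_zero_constant[of UNIV "\<lambda>t. G (t + 2 * pi) - G t"] by auto
  have "(g has_integral G (2 * pi) - G 0) {0..2 * pi}"
    by (rule fundamental_theorem_of_calculus[OF _ has_vector_derivative_at_within[OF G]]) simp
  then have "integral {0..2 * pi} g = c"
    using c[of 0] by (simp add: integral_unique)
  then have "G (t + 2 * pi) = G t + integral {0..2 * pi} g" for t
    using c[of t] by simp
  then show ?thesis
    using that[of G] G by (simp add: G_def)
qed

lemma periodic_bounded:
  fixes g :: "real \<Rightarrow> real"
  assumes g: "continuous_on UNIV g" and per: "\<And>t. g (t + 2 * pi) = g t"
  obtains M where "\<And>t. \<bar>g t\<bar> \<le> M"
proof -
  have "compact (g ` {0..2 * pi})"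
    by (rule compact_continuous_image[OF continuous_on_subset[OF g]]) auto
  from compact_imp_bounded[OF this] obtain M where M: "\<And>y. y \<in> g ` {0..2 * pi} \<Longrightarrow> \<bar>y\<bar> \<le> M"
    unfolding bounded_real by blast
  have "\<bar>g t\<bar> \<le> M" for t
  proof -
    define n where "n = \<lfloor>t / (2 * pi)\<rfloor>"
    have "of_int n \<le> t / (2 * pi)" "t / (2 * pi) < of_int n + 1"
      unfolding n_def by linarith+
    then have "t - 2 * pi * of_int n \<in> {0..2 * pi}"
      using pi_gt_zero by (auto simp: field_simps)
    moreover have "g (t - 2 * pi * of_int n) = g t"
      using periodic_int[of g "t - 2 * pi * of_int n" n, OF per] by simp
    ultimately show ?thesis using M by (metis imageI)
  qed
  then show ?thesis by (rule that)
qed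

section \<open>The root, its size and the spectral projections\<close>

lemma rho_square: "(rho lam \<delta> \<alpha> m)\<^sup>2 = (of_real (lam * m) - \<i> * of_real \<delta>)\<^sup>2 + of_real ((cmod \<alpha>)\<^sup>2)"
  unfolding rho_def by (rule power2_csqrt)

lemma Re_rho: "Re (rho lam \<delta> \<alpha> m) \<ge> 0"
proof -
  have "Re (csqrt z) \<ge> 0" for z
    using csqrt_principal[of z] by (auto simp del: csqrt.sel)
  then show ?thesis unfolding rho_def .
qed

lemma cmod_rho_le: "cmod (rho lam \<delta> \<alpha> m) \<le> \<bar>lam * m\<bar> + \<bar>\<delta>\<bar> + cmod \<alpha>"
proof (rule power2_le_imp_le)
  let ?w = "of_real (lam * m) - \<i> * of_real \<delta> :: complex"
  have w: "cmod ?w \<le> \<bar>lam * m\<bar> + \<bar>\<delta>\<bar>"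
    using norm_triangle_ineq4[of "of_real (lam * m) :: complex" "\<i> * of_real \<delta>"] by (simp add: norm_mult)
  have "(cmod (rho lam \<delta> \<alpha> m))\<^sup>2 = cmod (?w\<^sup>2 + of_real ((cmod \<alpha>)\<^sup>2))"
    by (simp only: norm_power[symmetric] rho_square)
  also have "\<dots> \<le> (cmod ?w)\<^sup>2 + (cmod \<alpha>)\<^sup>2"
    using norm_triangle_ineq[of "?w\<^sup>2" "of_real ((cmod \<alpha>)\<^sup>2)"] by (simp add: norm_power del: of_real_mult)
  also have "\<dots> \<le> (\<bar>lam * m\<bar> + \<bar>\<delta>\<bar>)\<^sup>2 + (cmod \<alpha>)\<^sup>2"
    using w by (intro add_mono power_mono) auto
  also have "\<dots> \<le> (\<bar>lam * m\<bar> + \<bar>\<delta>\<bar> + cmod \<alpha>)\<^sup>2"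
    by (simp add: power2_eq_square algebra_simps)
  finally show "(cmod (rho lam \<delta> \<alpha> m))\<^sup>2 \<le> (\<bar>lam * m\<bar> + \<bar>\<delta>\<bar> + cmod \<alpha>)\<^sup>2" .
qed simp

text \<open>With y = (lam m)^2, the squared modulus of rho^2 is (|\<alpha>|^2 - \<delta>^2)^2 + y^2
  + 2 y (|\<alpha>|^2 + \<delta>^2). It is smallest at y = 0, whence a bound uniform in
  \<open>m\<close>, which (I) makes positive.\<close>

lemma cmod_rho_ge: "(cmod (rho lam \<delta> \<alpha> m))\<^sup>2 \<ge> \<bar>(cmod \<alpha>)\<^sup>2 - \<delta>\<^sup>2\<bar>"
proof -
  let ?y = "(lam * m)\<^sup>2" and ?a = "(cmod \<alpha>)\<^sup>2"
  have sq: "(rho lam \<delta> \<alpha> m)\<^sup>2 = Complex (?y - \<delta>\<^sup>2 + ?a) (- 2 * (lam * m) * \<delta>)"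
    unfolding rho_square by (simp add: complex_eq_iff power2_eq_square)
  have "(?a - \<delta>\<^sup>2)\<^sup>2 \<le> (?a - \<delta>\<^sup>2)\<^sup>2 + ?y\<^sup>2 + 2 * ?y * (?a + \<delta>\<^sup>2)"
    by simp
  also have "\<dots> = (?y - \<delta>\<^sup>2 + ?a)\<^sup>2 + (- 2 * (lam * m) * \<delta>)\<^sup>2"
    by (simp add: power2_eq_square algebra_simps)
  finally have "sqrt ((?a - \<delta>\<^sup>2)\<^sup>2) \<le> cmod ((rho lam \<delta> \<alpha> m)\<^sup>2)"
    unfolding sq complex_norm by (rule real_sqrt_le_mono)
  then show ?thesis by (simp add: norm_power)
qed

text \<open>For N = ((\<mu>, \<alpha>), (\<beta>, -\<mu>)) with square \<rho>^2, the columns of 1 +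
  \<sigma> N / \<rho> are eigenvectors for \<sigma> \<rho>, since N (1 + \<sigma> N / \<rho>) = N +
  \<sigma> \<rho>. The inverse \<open>k\<close> is a variable so that the four entries become
  polynomial identities.\<close>

lemma projection_identities:
  fixes \<mu> \<alpha> \<beta> \<rho> k \<sigma> h :: complex
  assumes "\<rho> * k = 1" "\<sigma> * \<sigma> = 1" "\<rho> * \<rho> = \<mu> * \<mu> + \<alpha> * \<beta>"
  shows "\<mu> * (h * (1 + \<sigma> * \<mu> * k)) + \<alpha> * (h * (\<sigma> * \<beta> * k)) = \<sigma> * \<rho> * (h * (1 + \<sigma> * \<mu> * k))"
    and "\<mu> * (h * (\<sigma> * \<alpha> * k)) + \<alpha> * (h * (1 + (- \<sigma>) * \<mu> * k)) = \<sigma> * \<rho> * (h * (\<sigma> * \<alpha> * k))"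
    and "\<beta> * (h * (1 + \<sigma> * \<mu> * k)) - \<mu> * (h * (\<sigma> * \<beta> * k)) = \<sigma> * \<rho> * (h * (\<sigma> * \<beta> * k))"
    and "\<beta> * (h * (\<sigma> * \<alpha> * k)) - \<mu> * (h * (1 + (- \<sigma>) * \<mu> * k)) = \<sigma> * \<rho> * (h * (1 + (- \<sigma>) * \<mu> * k))"
  using assms by algebra+

section \<open>The constants of the theorem and the small divisors\<close>

locale setting =
  fixes p0 lam \<delta> :: real and \<alpha> :: complex and q s :: "real \<Rightarrow> real" and s0 q0 :: real
  assumes q: "smooth_circle q" and s: "smooth_circle s" and q_nonneg: "q t \<ge> 0"
    and s0: "s0 = integral {0..2 * pi} s" and q0: "q0 = integral {0..2 * pi} q"
    and I: "cmod \<alpha> \<noteq> \<bar>\<delta>\<bar>"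
    and III: "\<exists>M :: real. M > 0 \<and> (\<forall>l\<in>half_nats. bracket l \<ge> M \<longrightarrow> (\<forall>m\<in>weights l.
        min (cmod (exp (- rho lam \<delta> \<alpha> m * of_real q0)
                   - exp (2 * of_real pi * \<i> * of_real m * of_real p0 + of_real s0)))
            (cmod (1 - exp (- rho lam \<delta> \<alpha> m * of_real q0
                   + 2 * of_real pi * \<i> * of_real m * of_real p0 + of_real s0)))
        \<ge> bracket l powr (- M)))"
begin

definition wt :: "int \<Rightarrow> real" where "wt j = of_int j / 2"

text \<open>The conjugate, because the Fourier coefficients satisfy a system whose eigenvalues are the roots
  of \<open>(\<lambda>m + i\<delta>)\<^sup>2 + |\<alpha>|\<^sup>2\<close>.\<close>

definition rbar :: "int \<Rightarrow> complex" where "rbar j = cnj (rho lam \<delta> \<alpha> (wt j))"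

text \<open>Upper left entry of the trace-free matrix that multiplies \<open>q\<close> on mode
  \<open>j\<close>; the lower right entry is its negative.\<close>

definition drift :: "int \<Rightarrow> complex" where "drift j = of_real (lam * wt j) + \<i> * of_real \<delta>"

lemma rbar_square: "(rbar j)\<^sup>2 = (drift j)\<^sup>2 + \<alpha> * cnj \<alpha>"
proof -
  have "(rbar j)\<^sup>2 = cnj ((rho lam \<delta> \<alpha> (wt j))\<^sup>2)"
    by (simp add: rbar_def)
  then show ?thesis
    unfolding rho_square drift_def complex_norm_square by (simp add: mult.commute)
qed

lemma I_gap: "\<bar>(cmod \<alpha>)\<^sup>2 - \<delta>\<^sup>2\<bar> > 0"
proof -
  have "(cmod \<alpha>)\<^sup>2 \<noteq> \<bar>\<delta>\<bar>\<^sup>2" using I by (simp only: power2_eq_iff_nonneg norm_ge_zero abs_ge_zero) simp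
  then show ?thesis by simp
qed

lemma rbar_nonzero: "rbar j \<noteq> 0"
  using cmod_rho_ge[of \<alpha> \<delta> lam "wt j"] I_gap by (auto simp: rbar_def)

lemma poly_bdd_wt: "poly_bdd (\<lambda>j. of_real (wt j))"
  using poly_bdd_mult[OF poly_bdd_of_int poly_bdd_const[of "1 / 2"]] by (simp add: wt_def)

lemma poly_bdd_rbar: "poly_bdd rbar"
  unfolding poly_bdd_def
proof (intro exI allI)
  fix j
  have 1: "\<bar>lam * wt j\<bar> \<le> \<bar>lam\<bar> * \<bar>real_of_int j\<bar>"
    unfolding wt_def abs_mult by (intro mult_left_mono) auto
  have 2: "0 \<le> \<bar>\<delta>\<bar> * \<bar>real_of_int j\<bar>" "0 \<le> cmod \<alpha> * \<bar>real_of_int j\<bar>" "0 \<le> \<bar>lam\<bar>"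
    by simp_all
  have "cmod (rbar j) \<le> \<bar>lam * wt j\<bar> + \<bar>\<delta>\<bar> + cmod \<alpha>"
    unfolding rbar_def complex_mod_cnj by (rule cmod_rho_le)
  also have "\<dots> \<le> (\<bar>lam\<bar> + \<bar>\<delta>\<bar> + cmod \<alpha>) + (\<bar>lam\<bar> * \<bar>real_of_int j\<bar> + \<bar>\<delta>\<bar> * \<bar>real_of_int j\<bar> + cmod \<alpha> * \<bar>real_of_int j\<bar>)"
    using 1 2 by linarith
  finally show "cmod (rbar j) \<le> (\<bar>lam\<bar> + \<bar>\<delta>\<bar> + cmod \<alpha>) * (1 + \<bar>real_of_int j\<bar>) ^ 1"
    by (simp only: power_one_right distrib_left distrib_right mult_1_right)
qed

lemma poly_bdd_inverse_rbar: "poly_bdd (\<lambda>j. 1 / rbar j)"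
  unfolding poly_bdd_def
proof (intro exI allI)
  fix j
  let ?g = "\<bar>(cmod \<alpha>)\<^sup>2 - \<delta>\<^sup>2\<bar>"
  have "sqrt ?g \<le> cmod (rbar j)"
    using cmod_rho_ge[of \<alpha> \<delta> lam "wt j"] by (intro real_le_lsqrt) (simp_all add: rbar_def)
  then have "1 / cmod (rbar j) \<le> 1 / sqrt ?g"
    using I_gap by (intro divide_left_mono mult_pos_pos) (auto simp: rbar_nonzero)
  then show "cmod (1 / rbar j) \<le> (1 / sqrt ?g) * (1 + \<bar>real_of_int j\<bar>) ^ 0"
    by (simp add: norm_divide)
qed

lemma poly_bdd_drift: "poly_bdd drift"
proof -
  have "poly_bdd (\<lambda>j. of_real lam * of_real (wt j) + \<i> * of_real \<delta>)"
    by (intro poly_bdd_add poly_bdd_mult poly_bdd_const poly_bdd_wt)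
  then show ?thesis by (simp add: drift_def[abs_def])
qed

text \<open>A half-integer m is a weight of all the spins |m|, |m| + 1, ..., so (III), though
  restricted to large spins, controls the divisors of every mode. A spin within a constant of |m|
  converts the bound in \<open>bracket l\<close> into one in \<open>j\<close>.\<close>

lemma small_divisors:
  obtains C N where "\<And>j. C * (1 + \<bar>real_of_int j\<bar>) ^ N > 0"
    "\<And>j. 1 / (C * (1 + \<bar>real_of_int j\<bar>) ^ N) \<le>
       min (cmod (exp (- rho lam \<delta> \<alpha> (wt j) * of_real q0)
                   - exp (2 * of_real pi * \<i> * of_real (wt j) * of_real p0 + of_real s0)))
            (cmod (1 - exp (- rho lam \<delta> \<alpha> (wt j) * of_real q0
                   + 2 * of_real pi * \<i> * of_real (wt j) * of_real p0 + of_real s0)))"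
proof -
  obtain M where M: "M > 0" "\<And>l m. l \<in> half_nats \<Longrightarrow> bracket l \<ge> M \<Longrightarrow> m \<in> weights l \<Longrightarrow>
        bracket l powr (- M) \<le> min (cmod (exp (- rho lam \<delta> \<alpha> m * of_real q0)
                   - exp (2 * of_real pi * \<i> * of_real m * of_real p0 + of_real s0)))
            (cmod (1 - exp (- rho lam \<delta> \<alpha> m * of_real q0
                   + 2 * of_real pi * \<i> * of_real m * of_real p0 + of_real s0)))"
    using III by blast
  obtain n :: nat where n: "M \<le> real n" using real_arch_simple by blast
  show ?thesis
  proof (rule that[of "real (n + 1) ^ n" n])
    show "real (n + 1) ^ n * (1 + \<bar>real_of_int j\<bar>) ^ n > 0" for j
      by (intro mult_pos_pos zero_less_power) auto
    fix j
    \<comment> \<open>The smallest spin with weight \<open>wt j\<close> is |j|/2. Raising it by the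
      integer \<open>n\<close> brings \<open>bracket l\<close> above \<open>M\<close> and leaves it
      at most (n + 1)(1 + |j|).\<close>
    define l where "l = real (nat \<bar>j\<bar> + 2 * n) / 2"
    have l0: "l \<ge> 0" unfolding l_def by simp
    have l: "l = \<bar>real_of_int j\<bar> / 2 + real n" unfolding l_def by simp
    have "l \<in> half_nats" unfolding half_nats_def l_def by blast
    moreover have bl: "l \<le> bracket l" "bracket l \<le> 1 + l"
      unfolding bracket_def using l0
      by (auto intro!: real_le_rsqrt real_le_lsqrt simp: power2_eq_square algebra_simps)
    then have "bracket l \<ge> M" using n l by simp
    moreover have "wt j \<in> weights l"
    proof -
      have "wt j = - l + real (nat j + n)"
      proof (cases "j \<ge> 0")
        case True
        then show ?thesis unfolding wt_def l by simp
      next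
        case False
        then show ?thesis unfolding wt_def l by simp
      qed
      moreover have "real (nat j + n) \<le> 2 * l"
        unfolding l by (cases "j \<ge> 0") auto
      ultimately show ?thesis unfolding weights_def by blast
    qed
    ultimately have "bracket l powr (- M) \<le> min (cmod (exp (- rho lam \<delta> \<alpha> (wt j) * of_real q0)
                   - exp (2 * of_real pi * \<i> * of_real (wt j) * of_real p0 + of_real s0)))
            (cmod (1 - exp (- rho lam \<delta> \<alpha> (wt j) * of_real q0
                   + 2 * of_real pi * \<i> * of_real (wt j) * of_real p0 + of_real s0)))"
      by (rule M(2))
    moreover have "1 / (real (n + 1) ^ n * (1 + \<bar>real_of_int j\<bar>) ^ n) \<le> bracket l powr (- M)"
    proof -
      have b1: "bracket l \<ge> 1"
        unfolding bracket_def using l0 by (intro real_le_rsqrt) simp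
      have "0 \<le> real n * \<bar>real_of_int j\<bar>" by simp
      then have "bracket l \<le> 1 + real n + \<bar>real_of_int j\<bar> + real n * \<bar>real_of_int j\<bar>"
        using bl(2) l by linarith
      then have "bracket l \<le> real (n + 1) * (1 + \<bar>real_of_int j\<bar>)"
        by (simp add: algebra_simps)
      then have "bracket l ^ n \<le> (real (n + 1) * (1 + \<bar>real_of_int j\<bar>)) ^ n"
        using b1 by (intro power_mono) auto
      moreover have "bracket l powr M \<le> bracket l ^ n"
        using b1 n powr_mono[of M "real n" "bracket l"] by (simp add: powr_realpow)
      ultimately have "bracket l powr M \<le> real (n + 1) ^ n * (1 + \<bar>real_of_int j\<bar>) ^ n"
        by (simp only: power_mult_distrib)
      moreover have "bracket l powr M > 0" using b1 by simp
      ultimately have "1 / (real (n + 1) ^ n * (1 + \<bar>real_of_int j\<bar>) ^ n) \<le> 1 / bracket l powr M"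
        by (intro divide_left_mono mult_pos_pos) auto
      then show ?thesis by (simp add: powr_minus_divide)
    qed
    ultimately show "1 / (real (n + 1) ^ n * (1 + \<bar>real_of_int j\<bar>) ^ n) \<le>
       min (cmod (exp (- rho lam \<delta> \<alpha> (wt j) * of_real q0)
                   - exp (2 * of_real pi * \<i> * of_real (wt j) * of_real p0 + of_real s0)))
            (cmod (1 - exp (- rho lam \<delta> \<alpha> (wt j) * of_real q0
                   + 2 * of_real pi * \<i> * of_real (wt j) * of_real p0 + of_real s0)))"
      by (rule order_trans[rotated])
  qed
qed

lemma s_continuous: "continuous_on UNIV s" "s (t + 2 * pi) = s t"
  and q_continuous: "continuous_on UNIV q" "q (t + 2 * pi) = q t"
  using s q by (auto simp: smooth_circle_def smooth_on_continuous_on)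

text \<open>\<open>E\<close> is explicit: primitives of \<open>s\<close> and \<open>q\<close> plus a
  linear term. Since \<open>Q\<close> is nondecreasing and \<open>rbar j\<close> has nonnegative
  real part, moving in the direction \<open>\<sigma>\<close> can only shrink the factor from
  \<open>q\<close>, so the bound on the propagator depends on \<open>s\<close> alone.\<close>

lemma transport_exponents:
  assumes \<sigma>: "\<sigma> = 1 \<or> \<sigma> = -1"
  obtains E B where "transport col_ne \<sigma> E s q (\<lambda>j. - \<i> * of_real (wt j) * of_real p0) (\<lambda>j. of_real \<sigma> * rbar j) B"
proof -
  obtain S where S: "\<And>t. (S has_vector_derivative s t) (at t)" "S 0 = 0" "\<And>t. S (t + 2 * pi) = S t + s0"
    unfolding s0 by (rule periodic_antiderivative[OF s_continuous]) blast
  obtain Q where Q: "\<And>t. (Q has_vector_derivative q t) (at t)" "Q 0 = 0" "\<And>t. Q (t + 2 * pi) = Q t + q0"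
    unfolding q0 by (rule periodic_antiderivative[OF q_continuous]) blast
  define E where "E = (\<lambda>j t. of_real (S t) + (- \<i> * of_real (wt j) * of_real p0) * of_real t
      + (of_real \<sigma> * rbar j) * of_real (Q t))"
  have E2pi: "E j (2 * pi) = of_real s0 - 2 * of_real pi * \<i> * of_real (wt j) * of_real p0
      + of_real \<sigma> * rbar j * of_real q0" for j
    using S(3)[of 0] Q(3)[of 0] S(2) Q(2) by (simp add: E_def)
  obtain Ms where Ms: "\<And>t. \<bar>s t\<bar> \<le> Ms"
    by (rule periodic_bounded[OF s_continuous]) blast
  have Ms0: "Ms \<ge> 0" using order_trans[OF abs_ge_zero Ms] .
  have S_lip: "\<bar>S x - S y\<bar> \<le> Ms * \<bar>x - y\<bar>" for x y
  proof -
    have "norm (S x - S y) \<le> Ms * norm (x - y)"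
    proof (rule differentiable_bound[where S = UNIV and f' = "\<lambda>t h. h * s t"])
      show "(S has_derivative (\<lambda>h. h * s t)) (at t within UNIV)" for t
        using S(1)[of t] by (simp add: has_vector_derivative_def)
      show "onorm (\<lambda>h. h * s t) \<le> Ms" for t
      proof (rule onorm_bound[OF Ms0])
        show "norm (h * s t) \<le> Ms * norm h" for h
          using mult_right_mono[OF Ms[of t] abs_ge_zero[of h]] by (simp add: abs_mult mult.commute)
      qed
    qed auto
    then show ?thesis by simp
  qed
  have Q_mono: "Q x \<le> Q y" if "x \<le> y" for x y
    using Q(1) q_nonneg that
    by (intro DERIV_nonneg_imp_nondecreasing[OF that])
      (metis has_real_derivative_iff_has_vector_derivative)
  obtain C N where C: "\<And>j. C * (1 + \<bar>real_of_int j\<bar>) ^ N > 0"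
    "\<And>j. 1 / (C * (1 + \<bar>real_of_int j\<bar>) ^ N) \<le>
       min (cmod (exp (- rho lam \<delta> \<alpha> (wt j) * of_real q0)
                   - exp (2 * of_real pi * \<i> * of_real (wt j) * of_real p0 + of_real s0)))
            (cmod (1 - exp (- rho lam \<delta> \<alpha> (wt j) * of_real q0
                   + 2 * of_real pi * \<i> * of_real (wt j) * of_real p0 + of_real s0)))"
    by (rule small_divisors) blast
  \<comment> \<open>Conjugation replaces \<open>rbar\<close> by \<open>rho\<close>. For
    \<open>\<sigma> = 1\<close> the divisor is the first quantity in (III) times a factor of modulus
    \<open>exp (- s0)\<close>, for \<open>\<sigma> = -1\<close> it is the second up to sign; the
    constant \<open>exp (- \<bar>s0\<bar>)\<close> serves both.\<close>
  have gap: "exp (- \<bar>s0\<bar>) / (C * (1 + \<bar>real_of_int j\<bar>) ^ N) \<le> cmod (exp (- of_real \<sigma> * E j (2 * pi)) - 1)" for j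
  proof -
    let ?r = "rho lam \<delta> \<alpha> (wt j)" and ?X = "2 * of_real pi * \<i> * of_real (wt j) * of_real p0 + of_real s0 :: complex"
    let ?b = "1 / (C * (1 + \<bar>real_of_int j\<bar>) ^ N)"
    have b: "0 \<le> ?b" using C(1)[of j] by simp
    have "cmod (exp (- of_real \<sigma> * E j (2 * pi)) - 1) = cmod (cnj (exp (- of_real \<sigma> * E j (2 * pi)) - 1))"
      by (rule complex_mod_cnj[symmetric])
    also have "cnj (exp (- of_real \<sigma> * E j (2 * pi)) - 1) = exp (- of_real \<sigma> * cnj (E j (2 * pi))) - 1"
      by (simp add: exp_cnj)
    also have "cnj (E j (2 * pi)) = ?X + of_real \<sigma> * ?r * of_real q0"
      unfolding E2pi by (simp add: rbar_def)
    also have "- of_real \<sigma> * (?X + of_real \<sigma> * ?r * of_real q0) = - of_real \<sigma> * ?X - (of_real \<sigma> * of_real \<sigma>) * ?r * of_real q0"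
      by (simp only: distrib_left mult_minus_left diff_conv_add_uminus mult.assoc)
    also have "(of_real \<sigma> * of_real \<sigma> :: complex) = 1" using \<sigma> by auto
    finally have e: "cmod (exp (- of_real \<sigma> * E j (2 * pi)) - 1) = cmod (exp (- of_real \<sigma> * ?X - ?r * of_real q0) - 1)"
      by (simp only: mult_1)
    have "exp (- \<bar>s0\<bar>) * ?b \<le> cmod (exp (- of_real \<sigma> * ?X - ?r * of_real q0) - 1)"
      using \<sigma>
    proof
      assume \<sigma>: "\<sigma> = 1"
      have "exp (- ?r * of_real q0) - exp ?X = exp ?X * (exp (- ?X - ?r * of_real q0) - 1)"
        by (simp add: right_diff_distrib flip: exp_add)
      then have "cmod (exp (- ?r * of_real q0) - exp ?X) = exp s0 * cmod (exp (- ?X - ?r * of_real q0) - 1)"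
        by (simp add: norm_mult)
      then have "?b \<le> exp s0 * cmod (exp (- ?X - ?r * of_real q0) - 1)"
        using C(2)[of j] by (simp only: min.bounded_iff)
      then have "exp (- s0) * ?b \<le> exp (- s0) * (exp s0 * cmod (exp (- ?X - ?r * of_real q0) - 1))"
        by (rule mult_left_mono) simp
      also have "\<dots> = cmod (exp (- ?X - ?r * of_real q0) - 1)"
        by (simp only: mult.assoc[symmetric] exp_add[symmetric]) simp
      finally have 1: "exp (- s0) * ?b \<le> cmod (exp (- ?X - ?r * of_real q0) - 1)" .
      have "exp (- \<bar>s0\<bar>) * ?b \<le> exp (- s0) * ?b"
        by (intro mult_right_mono b) simp
      with 1 show ?thesis using \<sigma> by simp
    next
      assume \<sigma>: "\<sigma> = -1"
      have "?b \<le> cmod (1 - exp (- ?r * of_real q0 + 2 * of_real pi * \<i> * of_real (wt j) * of_real p0 + of_real s0))"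
        using C(2)[of j] by (simp only: min.bounded_iff)
      also have "\<dots> = cmod (exp (- of_real \<sigma> * ?X - ?r * of_real q0) - 1)"
        using \<sigma> by (simp add: norm_minus_commute algebra_simps)
      finally have 1: "?b \<le> cmod (exp (- of_real \<sigma> * ?X - ?r * of_real q0) - 1)" .
      have "exp (- \<bar>s0\<bar>) * ?b \<le> 1 * ?b"
        by (intro mult_right_mono b) simp
      with 1 show ?thesis by simp
    qed
    then show ?thesis unfolding e by simp
  qed
  have gap0: "0 < exp (- \<bar>s0\<bar>) / (C * (1 + \<bar>real_of_int j\<bar>) ^ N)" for j
    using C(1)[of j] by (intro divide_pos_pos) auto
  have "transport col_ne \<sigma> E s q (\<lambda>j. - \<i> * of_real (wt j) * of_real p0) (\<lambda>j. of_real \<sigma> * rbar j) (Ms * (2 * pi))"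
  proof
    show "open col_ne" by (rule open_col_ne)
    show "\<sigma> = 1 \<or> \<sigma> = - 1" by (rule \<sigma>)
    show "smooth_on UNIV s" "smooth_on UNIV q" using s q by (simp_all add: smooth_circle_def)
    show "poly_bdd (\<lambda>j. - \<i> * of_real (wt j) * of_real p0)"
      by (intro poly_bdd_mult poly_bdd_const poly_bdd_wt)
    show "poly_bdd (\<lambda>j. of_real \<sigma> * rbar j)"
      by (intro poly_bdd_mult poly_bdd_const poly_bdd_rbar)
    show "(E j has_vector_derivative of_real (s t) + - \<i> * of_real (wt j) * of_real p0
        + of_real \<sigma> * rbar j * of_real (q t)) (at t)" for j t
    proof -
      have o: "((\<lambda>t. of_real (g t)) has_vector_derivative (of_real g' :: complex)) (at t)"
        if "(g has_vector_derivative g') (at t)" for g g'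
        by (rule bounded_linear.has_vector_derivative[OF bounded_linear_of_real that])
      have "(E j has_vector_derivative of_real (s t) + (- \<i> * of_real (wt j) * of_real p0) * of_real 1
        + (of_real \<sigma> * rbar j) * of_real (q t)) (at t)"
        unfolding E_def
        by (intro has_vector_derivative_add has_vector_derivative_mult_right o S(1) Q(1) has_vector_derivative_id)
      then show ?thesis by simp
    qed
    show "E j (t + 2 * pi) = E j t + E j (2 * pi)" for j t
      unfolding E2pi unfolding E_def S(3) Q(3) by (simp add: algebra_simps)
    show "Re (E j t - E j (t + \<sigma> * r)) \<le> Ms * (2 * pi)" if r: "0 \<le> r" "r \<le> 2 * pi" for j t r
    proof -
      have "Re (E j t - E j (t + \<sigma> * r)) = (S t - S (t + \<sigma> * r)) + Re (rbar j) * (\<sigma> * (Q t - Q (t + \<sigma> * r)))"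
        by (simp add: E_def algebra_simps)
      moreover have "S t - S (t + \<sigma> * r) \<le> Ms * (2 * pi)"
      proof -
        have "S t - S (t + \<sigma> * r) \<le> Ms * \<bar>t - (t + \<sigma> * r)\<bar>"
          using S_lip[of t "t + \<sigma> * r"] by linarith
        also have "\<dots> \<le> Ms * (2 * pi)"
          using r \<sigma> by (intro mult_left_mono Ms0) auto
        finally show ?thesis .
      qed
      moreover have "Re (rbar j) * (\<sigma> * (Q t - Q (t + \<sigma> * r))) \<le> 0"
      proof (rule mult_nonneg_nonpos)
        show "0 \<le> Re (rbar j)" by (simp add: rbar_def Re_rho)
        show "\<sigma> * (Q t - Q (t + \<sigma> * r)) \<le> 0"
          using \<sigma> Q_mono[of t "t + r"] Q_mono[of "t - r" t] r by auto
      qed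
      ultimately show ?thesis by linarith
    qed
    show "exp (- of_real \<sigma> * E j (2 * pi)) \<noteq> 1" for j
      using gap[of j] gap0[of j] by auto
    show "poly_bdd (\<lambda>j. 1 / (exp (- of_real \<sigma> * E j (2 * pi)) - 1))"
      unfolding poly_bdd_def
    proof (intro exI allI)
      fix j
      let ?g = "exp (- \<bar>s0\<bar>) / (C * (1 + \<bar>real_of_int j\<bar>) ^ N)"
      have "1 / cmod (exp (- of_real \<sigma> * E j (2 * pi)) - 1) \<le> 1 / ?g"
        using gap[of j] gap0[of j] by (intro divide_left_mono mult_pos_pos) auto
      also have "1 / ?g = (C / exp (- \<bar>s0\<bar>)) * (1 + \<bar>real_of_int j\<bar>) ^ N"
        by simp
      finally show "cmod (1 / (exp (- of_real \<sigma> * E j (2 * pi)) - 1)) \<le> (C / exp (- \<bar>s0\<bar>)) * (1 + \<bar>real_of_int j\<bar>) ^ N"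
        by (simp only: norm_divide norm_one)
    qed
  qed
  then show ?thesis by (rule that)
qed

text \<open>The last clause is the weight condition of mode \<open>j\<close>. It lets multiplication
  by \<open>j\<close> be written again as a derivative along the flow, so that the equations of the
  modes can be summed.\<close>

definition admissible :: "(int \<Rightarrow> real \<times> (complex ^ 2 ^ 2) \<Rightarrow> complex) \<Rightarrow> bool" where
  "admissible u \<longleftrightarrow> (\<forall>k. rapid k tube u) \<and> (\<forall>j. \<forall>z\<in>tube. u j (z + (2 * pi, 0)) = u j z) \<and>
     (\<forall>j. \<forall>z\<in>tube. frechet_derivative (u j) (at z) (turn z) = - \<i> * of_int j * u j z)"

lemma admissibleD:
  assumes "admissible u"
  shows "rapid k tube u" "z \<in> tube \<Longrightarrow> u j (z + (2 * pi, 0)) = u j z"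
    "z \<in> tube \<Longrightarrow> frechet_derivative (u j) (at z) (turn z) = - \<i> * of_int j * u j z"
    "z \<in> tube \<Longrightarrow> u j differentiable (at z)"
proof -
  show r: "rapid k tube u" for k using assms by (simp add: admissible_def)
  show "z \<in> tube \<Longrightarrow> u j differentiable (at z)" using r[of 1] by simp
qed (use assms in \<open>simp_all add: admissible_def\<close>)

lemma admissible_lincomb:
  assumes "poly_bdd c" "poly_bdd d" "admissible f" "admissible g"
  shows "admissible (\<lambda>j z. c j * f j z + d j * g j z)"
  unfolding admissible_def
proof (intro conjI allI ballI)
  show "rapid k tube (\<lambda>j z. c j * f j z + d j * g j z)" for k
    by (intro rapid_lincomb open_tube assms admissibleD(1))
  fix j z assume z: "z \<in> tube"
  show "c j * f j (z + (2 * pi, 0)) + d j * g j (z + (2 * pi, 0)) = c j * f j z + d j * g j z"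
    by (simp only: admissibleD(2)[OF assms(3) z] admissibleD(2)[OF assms(4) z])
  show "frechet_derivative (\<lambda>z. c j * f j z + d j * g j z) (at z) (turn z) = - \<i> * of_int j * (c j * f j z + d j * g j z)"
    unfolding frechet_derivative_lincomb[OF admissibleD(4)[OF assms(3) z] admissibleD(4)[OF assms(4) z]]
      admissibleD(3)[OF assms(3) z] admissibleD(3)[OF assms(4) z]
    by (simp add: algebra_simps)
qed

section \<open>Solution of the equations for the single modes\<close>

lemma scalar_solution:
  assumes \<sigma>: "\<sigma> = 1 \<or> \<sigma> = -1"
    and F: "smooth_on tube F" "\<And>z. z \<in> tube \<Longrightarrow> F (z + (2 * pi, 0)) = F z"
  obtains w where "admissible w"
    "\<And>j z. z \<in> tube \<Longrightarrow> frechet_derivative (w j) (at z) (1, 0)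
       = (of_real (s (fst z)) - \<i> * of_real (wt j) * of_real p0 + of_real \<sigma> * rbar j * of_real (q (fst z))) * w j z
         + fcoef F j z"
proof -
  obtain E B where "transport col_ne \<sigma> E s q (\<lambda>j. - \<i> * of_real (wt j) * of_real p0) (\<lambda>j. of_real \<sigma> * rbar j) B"
    using transport_exponents[OF \<sigma>] by blast
  then interpret T: transport col_ne \<sigma> E s q "\<lambda>j. - \<i> * of_real (wt j) * of_real p0" "\<lambda>j. of_real \<sigma> * rbar j" B .
  have D: "T.D = tube" unfolding T.D_def tube_def ..
  have a: "rapid k T.D (fcoef F)" for k
    unfolding D by (rule fcoef_rapid[OF F(1)])
  have per: "T.tperiodic (fcoef F)"
    unfolding T.tperiodic_def D using fcoef_tperiodic[of F] F(2) by blast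
  show ?thesis
  proof (rule that[of "T.solve (fcoef F)"])
    show "admissible (T.solve (fcoef F))"
      unfolding admissible_def
    proof (intro conjI allI ballI)
      show "rapid k tube (T.solve (fcoef F))" for k
        using T.solve_rapid[OF a per] unfolding D .
      fix j z assume "z \<in> tube"
      then have z: "z \<in> T.D" unfolding D .
      show "T.solve (fcoef F) j (z + (2 * pi, 0)) = T.solve (fcoef F) j z"
        using T.solve_tperiodic[OF per] z unfolding T.tperiodic_def by blast
      \<comment> \<open>The generator has no time component and depends on the space point only, as
        \<open>solve_frechet_space\<close> requires.\<close>
      have t: "turn z = (0, snd (turn z))" by (simp add: turn_def)
      have "frechet_derivative (T.solve (fcoef F) j) (at z) (0, snd (turn z)) = - \<i> * of_int j * T.solve (fcoef F) j z"
      proof (rule T.solve_frechet_space[OF a per z])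
        fix x assume x: "x \<in> T.D" "snd x = snd z"
        have "turn x = (0, snd (turn z))" using x(2) by (simp add: turn_def)
        then show "frechet_derivative (fcoef F j) (at x) (0, snd (turn z)) = - \<i> * of_int j * fcoef F j x"
          using fcoef_frechet_turn[OF F(1), of x j] x(1) unfolding D by simp
      qed
      then show "frechet_derivative (T.solve (fcoef F) j) (at z) (turn z) = - \<i> * of_int j * T.solve (fcoef F) j z"
        by (simp only: t[symmetric])
    qed
    fix j z assume "z \<in> tube"
    then have z: "z \<in> T.D" unfolding D .
    show "frechet_derivative (T.solve (fcoef F) j) (at z) (1, 0)
       = (of_real (s (fst z)) - \<i> * of_real (wt j) * of_real p0 + of_real \<sigma> * rbar j * of_real (q (fst z))) * T.solve (fcoef F) j z
         + fcoef F j z"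
      unfolding T.solve_frechet_time[OF a per z] T.A_def by simp
  qed
qed

text \<open>The inhomogeneity is the projection of \<open>(F, G)\<close> onto the eigenspace of
  \<open>((drift, \<alpha>), (cnj \<alpha>, - drift))\<close> for the eigenvalue \<open>\<sigma> rbar\<close>.\<close>

definition half_system ::
  "real \<Rightarrow> (real \<times> (complex ^ 2 ^ 2) \<Rightarrow> complex) \<Rightarrow> (real \<times> (complex ^ 2 ^ 2) \<Rightarrow> complex) \<Rightarrow>
   (int \<Rightarrow> real \<times> (complex ^ 2 ^ 2) \<Rightarrow> complex) \<Rightarrow> (int \<Rightarrow> real \<times> (complex ^ 2 ^ 2) \<Rightarrow> complex) \<Rightarrow> bool" where
  "half_system \<sigma> F G u v \<longleftrightarrow> (\<forall>j. \<forall>z\<in>tube.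
    frechet_derivative (u j) (at z) (1, 0)
       = (of_real (s (fst z)) - \<i> * of_real (wt j) * of_real p0) * u j z
         + of_real (q (fst z)) * (drift j * u j z + \<alpha> * v j z)
         + (1 / 2) * ((1 + of_real \<sigma> * drift j / rbar j) * fcoef F j z + (of_real \<sigma> * \<alpha> / rbar j) * fcoef G j z) \<and>
    frechet_derivative (v j) (at z) (1, 0)
       = (of_real (s (fst z)) - \<i> * of_real (wt j) * of_real p0) * v j z
         + of_real (q (fst z)) * (cnj \<alpha> * u j z - drift j * v j z)
         + (1 / 2) * ((of_real \<sigma> * cnj \<alpha> / rbar j) * fcoef F j z + (1 - of_real \<sigma> * drift j / rbar j) * fcoef G j z))"

text \<open>Scalar solutions \<open>f\<close> and \<open>g\<close> for \<open>F\<close> and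
  \<open>G\<close> are taken with the eigenvalue \<open>\<sigma> rbar\<close>, and a projection
  constant in time is applied to the pair. On its range multiplication by
  \<open>\<sigma> rbar\<close> is the action of the matrix, so the system follows.\<close>

lemma half_solution:
  assumes \<sigma>: "\<sigma> = 1 \<or> \<sigma> = -1"
    and F: "smooth_on tube F" "\<And>z. z \<in> tube \<Longrightarrow> F (z + (2 * pi, 0)) = F z"
    and G: "smooth_on tube G" "\<And>z. z \<in> tube \<Longrightarrow> G (z + (2 * pi, 0)) = G z"
  obtains u v where "admissible u" "admissible v"
    "half_system \<sigma> F G u v"
proof -
  obtain f where f: "admissible f"
    "\<And>j z. z \<in> tube \<Longrightarrow> frechet_derivative (f j) (at z) (1, 0)
       = (of_real (s (fst z)) - \<i> * of_real (wt j) * of_real p0 + of_real \<sigma> * rbar j * of_real (q (fst z))) * f j z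
         + fcoef F j z"
    by (rule scalar_solution[OF \<sigma> F]) blast+
  obtain g where g: "admissible g"
    "\<And>j z. z \<in> tube \<Longrightarrow> frechet_derivative (g j) (at z) (1, 0)
       = (of_real (s (fst z)) - \<i> * of_real (wt j) * of_real p0 + of_real \<sigma> * rbar j * of_real (q (fst z))) * g j z
         + fcoef G j z"
    by (rule scalar_solution[OF \<sigma> G]) blast+
  \<comment> \<open>(cu, du) and (cv, dv) are the rows of the projection onto the
    eigenspace.\<close>
  define cu du cv dv where
    "cu = (\<lambda>j. (1 / 2) * (1 + of_real \<sigma> * drift j * (1 / rbar j)))"
    and "du = (\<lambda>j. (1 / 2) * (of_real \<sigma> * \<alpha> * (1 / rbar j)))"
    and "cv = (\<lambda>j. (1 / 2) * (of_real \<sigma> * cnj \<alpha> * (1 / rbar j)))"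
    and "dv = (\<lambda>j. (1 / 2) * (1 + (- of_real \<sigma>) * drift j * (1 / rbar j)))"
  have poly: "poly_bdd cu" "poly_bdd du" "poly_bdd cv" "poly_bdd dv"
    unfolding cu_def du_def cv_def dv_def
    by (intro poly_bdd_mult[OF poly_bdd_const] poly_bdd_add[OF poly_bdd_const]
        poly_bdd_mult[OF _ poly_bdd_inverse_rbar] poly_bdd_const poly_bdd_drift)+
  have \<sigma>2: "of_real \<sigma> * of_real \<sigma> = (1 :: complex)" using \<sigma> by auto
  define u v where "u = (\<lambda>j z. cu j * f j z + du j * g j z)" and "v = (\<lambda>j z. cv j * f j z + dv j * g j z)"
  have diff: "f j differentiable (at z)" "g j differentiable (at z)" if "z \<in> tube" for j z
    using admissibleD(4)[OF f(1) that] admissibleD(4)[OF g(1) that] by blast+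
  have sq: "rbar j * rbar j = drift j * drift j + \<alpha> * cnj \<alpha>" for j
    using rbar_square[of j] by (simp add: power2_eq_square)
  have inv: "rbar j * (1 / rbar j) = 1" for j by (simp add: rbar_nonzero)
  note eig = projection_identities[OF inv \<sigma>2 sq]
  have c1: "drift j * cu j + \<alpha> * cv j = of_real \<sigma> * rbar j * cu j"
    and c2: "drift j * du j + \<alpha> * dv j = of_real \<sigma> * rbar j * du j"
    and c3: "cnj \<alpha> * cu j - drift j * cv j = of_real \<sigma> * rbar j * cv j"
    and c4: "cnj \<alpha> * du j - drift j * dv j = of_real \<sigma> * rbar j * dv j" for j
    unfolding cu_def du_def cv_def dv_def by (rule eig)+
  \<comment> \<open>The coefficient is split into the part without \<open>q\<close> and the part
    with it, because only the latter is to be replaced by the matrix.\<close>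
  have evol: "c * (X * y + a) + d * (X * x + b) = X0 * (c * y + d * x) + q' * (p * (c * y + d * x)) + (c * a + d * b)"
    if "X = X0 + p * q'" for c d X X0 y x a b q' p :: complex
    unfolding that by (simp add: algebra_simps)
  have uv1: "drift j * u j z + \<alpha> * v j z = of_real \<sigma> * rbar j * u j z" for j z
  proof -
    have "drift j * u j z + \<alpha> * v j z = (drift j * cu j + \<alpha> * cv j) * f j z + (drift j * du j + \<alpha> * dv j) * g j z"
      unfolding u_def v_def by (simp add: algebra_simps)
    then show ?thesis unfolding c1 c2 u_def by (simp add: algebra_simps)
  qed
  have uv2: "cnj \<alpha> * u j z - drift j * v j z = of_real \<sigma> * rbar j * v j z" for j z
  proof -
    have "cnj \<alpha> * u j z - drift j * v j z = (cnj \<alpha> * cu j - drift j * cv j) * f j z + (cnj \<alpha> * du j - drift j * dv j) * g j z"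
      unfolding u_def v_def by (simp add: algebra_simps)
    then show ?thesis unfolding c3 c4 v_def by (simp add: algebra_simps)
  qed
  show ?thesis
  proof (rule that[of u v])
    show "admissible u" "admissible v"
      unfolding u_def v_def by (intro admissible_lincomb poly f(1) g(1))+
    show "half_system \<sigma> F G u v"
      unfolding half_system_def
    proof (intro allI ballI conjI)
      fix j z assume z: "z \<in> tube"
      have du: "frechet_derivative (u j) (at z) w = cu j * frechet_derivative (f j) (at z) w + du j * frechet_derivative (g j) (at z) w" for w
        unfolding u_def by (rule frechet_derivative_lincomb[OF diff[OF z]])
      have dv: "frechet_derivative (v j) (at z) w = cv j * frechet_derivative (f j) (at z) w + dv j * frechet_derivative (g j) (at z) w" for w
        unfolding v_def by (rule frechet_derivative_lincomb[OF diff[OF z]])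
      let ?X0 = "of_real (s (fst z)) - \<i> * of_real (wt j) * of_real p0"
      have "frechet_derivative (u j) (at z) (1, 0) = ?X0 * u j z + of_real (q (fst z)) * (of_real \<sigma> * rbar j * u j z)
          + (cu j * fcoef F j z + du j * fcoef G j z)"
        unfolding du f(2)[OF z] g(2)[OF z] by (simp add: u_def evol)
      also have "cu j * fcoef F j z + du j * fcoef G j z =
         (1 / 2) * ((1 + of_real \<sigma> * drift j / rbar j) * fcoef F j z + (of_real \<sigma> * \<alpha> / rbar j) * fcoef G j z)"
        unfolding cu_def du_def by (simp add: distrib_left mult.assoc)
      finally show "frechet_derivative (u j) (at z) (1, 0) = ?X0 * u j z
           + of_real (q (fst z)) * (drift j * u j z + \<alpha> * v j z)
           + (1 / 2) * ((1 + of_real \<sigma> * drift j / rbar j) * fcoef F j z + (of_real \<sigma> * \<alpha> / rbar j) * fcoef G j z)"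
        unfolding uv1 .
      have "frechet_derivative (v j) (at z) (1, 0) = ?X0 * v j z + of_real (q (fst z)) * (of_real \<sigma> * rbar j * v j z)
          + (cv j * fcoef F j z + dv j * fcoef G j z)"
        unfolding dv f(2)[OF z] g(2)[OF z] by (simp add: v_def evol)
      also have "cv j * fcoef F j z + dv j * fcoef G j z =
         (1 / 2) * ((of_real \<sigma> * cnj \<alpha> / rbar j) * fcoef F j z + (1 - of_real \<sigma> * drift j / rbar j) * fcoef G j z)"
        unfolding cv_def dv_def by (simp add: distrib_left mult.assoc)
      finally show "frechet_derivative (v j) (at z) (1, 0) = ?X0 * v j z
           + of_real (q (fst z)) * (cnj \<alpha> * u j z - drift j * v j z)
           + (1 / 2) * ((of_real \<sigma> * cnj \<alpha> / rbar j) * fcoef F j z + (1 - of_real \<sigma> * drift j / rbar j) * fcoef G j z)"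
        unfolding uv2 .
    qed
  qed
qed

text \<open>The factor \<open>wt j\<close> is absorbed into the derivative along
  \<open>turn\<close>. The coefficients no longer depend on \<open>j\<close>, which allows summation
  over the modes.\<close>

definition pair_system ::
  "(real \<times> (complex ^ 2 ^ 2) \<Rightarrow> complex) \<Rightarrow> (real \<times> (complex ^ 2 ^ 2) \<Rightarrow> complex) \<Rightarrow>
   (int \<Rightarrow> real \<times> (complex ^ 2 ^ 2) \<Rightarrow> complex) \<Rightarrow> (int \<Rightarrow> real \<times> (complex ^ 2 ^ 2) \<Rightarrow> complex) \<Rightarrow> bool" where
  "pair_system F G u v \<longleftrightarrow> (\<forall>j. \<forall>z\<in>tube.
    frechet_derivative (u j) (at z) (1, 0)
       = of_real (s (fst z)) * u j z
         + (of_real lam * of_real (q (fst z)) - \<i> * of_real p0) * (\<i> / 2) * frechet_derivative (u j) (at z) (turn z)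
         + of_real (q (fst z)) * (\<i> * of_real \<delta> * u j z + \<alpha> * v j z) + fcoef F j z \<and>
    frechet_derivative (v j) (at z) (1, 0)
       = of_real (s (fst z)) * v j z
         + (- of_real lam * of_real (q (fst z)) - \<i> * of_real p0) * (\<i> / 2) * frechet_derivative (v j) (at z) (turn z)
         + of_real (q (fst z)) * (cnj \<alpha> * u j z - \<i> * of_real \<delta> * v j z) + fcoef G j z)"

text \<open>The projections for the two signs add up to the identity, so the sum of the two
  half-solutions has the full inhomogeneity.\<close>

lemma pair_solution:
  assumes F: "smooth_on tube F" "\<And>z. z \<in> tube \<Longrightarrow> F (z + (2 * pi, 0)) = F z"
    and G: "smooth_on tube G" "\<And>z. z \<in> tube \<Longrightarrow> G (z + (2 * pi, 0)) = G z"
  obtains u v where "admissible u" "admissible v"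
    "pair_system F G u v"
proof -
  have ii: "\<i> * (\<i> * x) = - x" for x :: complex
    by (simp flip: mult.assoc)
  let ?X0 = "\<lambda>j z. of_real (s (fst z)) - \<i> * of_real (wt j) * of_real p0"
  show ?thesis
  proof (rule half_solution[OF disjI1[OF refl] F G], assumption, assumption,
      rule half_solution[OF disjI2[OF refl] F G], assumption, assumption)
    fix u1 v1 u2 v2
    assume a1: "admissible u1" "admissible v1" and h1: "half_system 1 F G u1 v1"
    assume a2: "admissible u2" "admissible v2" and h2: "half_system (-1) F G u2 v2"
    define u v where "u = (\<lambda>j z. 1 * u1 j z + 1 * u2 j z)" and "v = (\<lambda>j z. 1 * v1 j z + 1 * v2 j z)"
    have adm: "admissible u" "admissible v"
      unfolding u_def v_def by (intro admissible_lincomb poly_bdd_const a1(1,2) a2(1,2))+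
    show thesis
    proof (rule that[of u v])
      show "admissible u" "admissible v" by (rule adm)+
      show "pair_system F G u v"
        unfolding pair_system_def
      proof (intro allI ballI conjI)
        fix j z assume z: "z \<in> tube"
        note eqs = h1[unfolded half_system_def, rule_format, OF z, of j, THEN conjunct1]
          h1[unfolded half_system_def, rule_format, OF z, of j, THEN conjunct2]
          h2[unfolded half_system_def, rule_format, OF z, of j, THEN conjunct1]
          h2[unfolded half_system_def, rule_format, OF z, of j, THEN conjunct2]
        have du: "frechet_derivative (u j) (at z) w = frechet_derivative (u1 j) (at z) w + frechet_derivative (u2 j) (at z) w" for w
          unfolding u_def frechet_derivative_lincomb[OF admissibleD(4)[OF a1(1) z] admissibleD(4)[OF a2(1) z]] by (simp only: mult_1)
        have dv: "frechet_derivative (v j) (at z) w = frechet_derivative (v1 j) (at z) w + frechet_derivative (v2 j) (at z) w" for w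
          unfolding v_def frechet_derivative_lincomb[OF admissibleD(4)[OF a1(2) z] admissibleD(4)[OF a2(2) z]] by (simp only: mult_1)
        note tu = admissibleD(3)[OF adm(1) z] and tv = admissibleD(3)[OF adm(2) z]
        have "frechet_derivative (u j) (at z) (1, 0) = ?X0 j z * u j z + of_real (q (fst z)) * (drift j * u j z + \<alpha> * v j z) + fcoef F j z"
          unfolding du eqs(1,3) unfolding u_def v_def by (simp add: algebra_simps)
        \<comment> \<open>i/2 times the derivative along \<open>turn\<close> is \<open>d0\<close>;
          on mode \<open>j\<close> it is multiplication by \<open>wt j\<close>.\<close>
        moreover have "(\<i> / 2) * (- \<i> * of_int j * u j z) = of_real (wt j) * u j z"
          by (simp add: wt_def ii mult.assoc)
        ultimately show "frechet_derivative (u j) (at z) (1, 0)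
           = of_real (s (fst z)) * u j z
             + (of_real lam * of_real (q (fst z)) - \<i> * of_real p0) * (\<i> / 2) * frechet_derivative (u j) (at z) (turn z)
             + of_real (q (fst z)) * (\<i> * of_real \<delta> * u j z + \<alpha> * v j z) + fcoef F j z"
          unfolding tu by (simp only: mult.assoc[of _ "\<i> / 2"]) (simp add: drift_def algebra_simps)
        have "frechet_derivative (v j) (at z) (1, 0) = ?X0 j z * v j z + of_real (q (fst z)) * (cnj \<alpha> * u j z - drift j * v j z) + fcoef G j z"
          unfolding dv eqs(2,4) unfolding u_def v_def by (simp add: algebra_simps)
        moreover have "(\<i> / 2) * (- \<i> * of_int j * v j z) = of_real (wt j) * v j z"
          by (simp add: wt_def ii mult.assoc)
        ultimately show "frechet_derivative (v j) (at z) (1, 0)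
           = of_real (s (fst z)) * v j z
             + (- of_real lam * of_real (q (fst z)) - \<i> * of_real p0) * (\<i> / 2) * frechet_derivative (v j) (at z) (turn z)
             + of_real (q (fst z)) * (cnj \<alpha> * u j z - \<i> * of_real \<delta> * v j z) + fcoef G j z"
          unfolding tv by (simp only: mult.assoc[of _ "\<i> / 2"]) (simp add: drift_def algebra_simps)
      qed
    qed
  qed
qed

section \<open>Summation of the modes and return to the equation with conjugation\<close>

definition function_system ::
  "(real \<times> (complex ^ 2 ^ 2) \<Rightarrow> complex) \<Rightarrow> (real \<times> (complex ^ 2 ^ 2) \<Rightarrow> complex) \<Rightarrow>
   (real \<times> (complex ^ 2 ^ 2) \<Rightarrow> complex) \<Rightarrow> (real \<times> (complex ^ 2 ^ 2) \<Rightarrow> complex) \<Rightarrow> bool" where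
  "function_system F G u v \<longleftrightarrow> (\<forall>z\<in>tube.
    frechet_derivative u (at z) (1, 0)
       = of_real (s (fst z)) * u z
         + (of_real lam * of_real (q (fst z)) - \<i> * of_real p0) * (\<i> / 2) * frechet_derivative u (at z) (turn z)
         + of_real (q (fst z)) * (\<i> * of_real \<delta> * u z + \<alpha> * v z) + F z \<and>
    frechet_derivative v (at z) (1, 0)
       = of_real (s (fst z)) * v z
         + (- of_real lam * of_real (q (fst z)) - \<i> * of_real p0) * (\<i> / 2) * frechet_derivative v (at z) (turn z)
         + of_real (q (fst z)) * (cnj \<alpha> * u z - \<i> * of_real \<delta> * v z) + G z)"

lemma linear_system:
  assumes F: "smooth_on tube F" "\<And>z. z \<in> tube \<Longrightarrow> F (z + (2 * pi, 0)) = F z"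
    and G: "smooth_on tube G" "\<And>z. z \<in> tube \<Longrightarrow> G (z + (2 * pi, 0)) = G z"
  obtains u v where "smooth_on tube u" "smooth_on tube v"
    "\<And>z. z \<in> tube \<Longrightarrow> u (z + (2 * pi, 0)) = u z"
    "\<And>z. z \<in> tube \<Longrightarrow> v (z + (2 * pi, 0)) = v z"
    "function_system F G u v"
proof -
  show ?thesis
  proof (rule pair_solution[OF F G], assumption, assumption)
    fix u v
    assume uv: "admissible u" "admissible v"
    "pair_system F G u v"
    define U V where "U = (\<lambda>z. zsum (\<lambda>j. u j z))" and "V = (\<lambda>z. zsum (\<lambda>j. v j z))"
    have su: "zterm (\<lambda>j. u j z) sums U z" and sv: "zterm (\<lambda>j. v j z) sums V z" if "z \<in> tube" for z
      unfolding U_def V_def by (rule zsum_sums[OF rapid_imp_rapid0[OF admissibleD(1)[OF uv(1)]] that],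
          rule zsum_sums[OF rapid_imp_rapid0[OF admissibleD(1)[OF uv(2)]] that])
    have dU: "zterm (\<lambda>j. frechet_derivative (u j) (at z) w) sums frechet_derivative U (at z) w"
      and dV: "zterm (\<lambda>j. frechet_derivative (v j) (at z) w) sums frechet_derivative V (at z) w" if "z \<in> tube" for z w
      unfolding U_def V_def by (rule zsum_frechet[OF open_tube admissibleD(1)[OF uv(1)] that], rule zsum_frechet[OF open_tube admissibleD(1)[OF uv(2)] that])
    show thesis
    proof (rule that[of U V])
      show "smooth_on tube U" "smooth_on tube V"
        unfolding smooth_on_def U_def V_def by (intro allI zsum_Ck_on open_tube admissibleD(1) uv(1,2))+
      show "U (z + (2 * pi, 0)) = U z" "V (z + (2 * pi, 0)) = V z" if z: "z \<in> tube" for z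
        unfolding U_def V_def by (simp_all only: admissibleD(2)[OF uv(1) z] admissibleD(2)[OF uv(2) z])
      show "function_system F G U V"
        unfolding function_system_def
      proof (intro ballI conjI)
        fix z assume z: "z \<in> tube"
        have "zterm (\<lambda>j. frechet_derivative (u j) (at z) (1, 0)) sums
           (of_real (s (fst z)) * U z
             + (of_real lam * of_real (q (fst z)) - \<i> * of_real p0) * (\<i> / 2) * frechet_derivative U (at z) (turn z)
             + of_real (q (fst z)) * (\<i> * of_real \<delta> * U z + \<alpha> * V z) + F z)"
          unfolding uv(3)[unfolded pair_system_def, rule_format, OF z, THEN conjunct1] by (rule zterm_lincomb[OF su[OF z] dU[OF z] sv[OF z] fcoef_sums[OF F(1) z]])
        from sums_unique2[OF dU[OF z] this]
        show "frechet_derivative U (at z) (1, 0)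
           = of_real (s (fst z)) * U z
             + (of_real lam * of_real (q (fst z)) - \<i> * of_real p0) * (\<i> / 2) * frechet_derivative U (at z) (turn z)
             + of_real (q (fst z)) * (\<i> * of_real \<delta> * U z + \<alpha> * V z) + F z" .
        \<comment> \<open>Brings the coupling into the order of \<open>zterm_lincomb\<close>, with
          the unknown being differentiated first.\<close>
        have swap: "cnj \<alpha> * x - \<i> * of_real \<delta> * y = (- (\<i> * of_real \<delta>)) * y + cnj \<alpha> * x" for x y
          by simp
        have "zterm (\<lambda>j. frechet_derivative (v j) (at z) (1, 0)) sums
           (of_real (s (fst z)) * V z
             + (- of_real lam * of_real (q (fst z)) - \<i> * of_real p0) * (\<i> / 2) * frechet_derivative V (at z) (turn z)
             + of_real (q (fst z)) * ((- (\<i> * of_real \<delta>)) * V z + cnj \<alpha> * U z) + G z)"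
          unfolding uv(3)[unfolded pair_system_def, rule_format, OF z, THEN conjunct2] swap
          by (rule zterm_lincomb[OF sv[OF z] dV[OF z] su[OF z] fcoef_sums[OF G(1) z]])
        from sums_unique2[OF dV[OF z] this]
        show "frechet_derivative V (at z) (1, 0)
           = of_real (s (fst z)) * V z
             + (- of_real lam * of_real (q (fst z)) - \<i> * of_real p0) * (\<i> / 2) * frechet_derivative V (at z) (turn z)
             + of_real (q (fst z)) * (cnj \<alpha> * U z - \<i> * of_real \<delta> * V z) + G z"
          by (simp add: algebra_simps)
      qed
    qed
  qed
qed

text \<open>If (u, v) solves the system with inhomogeneity (f, cnj f), so does (cnj v, cnj u). In
  their mean the second component is the conjugate of the first, and the first equation is the
  original one. \<open>du\<close> and \<open>dv\<close> stand for the derivatives along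
  \<open>turn\<close>.\<close>

lemma symmetrization:
  fixes u v du dv f :: complex and S Q :: real
  shows "(1 / 2) * (of_real S * u + (of_real lam * of_real Q - \<i> * of_real p0) * (\<i> / 2) * du
        + of_real Q * (\<i> * of_real \<delta> * u + \<alpha> * v) + f
      + cnj (of_real S * v + (- of_real lam * of_real Q - \<i> * of_real p0) * (\<i> / 2) * dv
        + of_real Q * (cnj \<alpha> * u - \<i> * of_real \<delta> * v) + cnj f))
    + \<i> * (of_real p0 + \<i> * of_real lam * of_real Q) * ((\<i> / 2) * ((1 / 2) * (du + cnj dv)))
    - (of_real S + \<i> * of_real \<delta> * of_real Q) * ((1 / 2) * (u + cnj v))
    - \<alpha> * of_real Q * cnj ((1 / 2) * (u + cnj v)) = f"
proof -
  have ii: "\<i> * (\<i> * x) = - x" for x :: complex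
    by (simp flip: mult.assoc)
  have 2: "(\<i> / 2) * x = (1 / 2) * (\<i> * x)" for x :: complex by simp
  \<comment> \<open>A symbol for 1/2, used only through the next two properties, keeps the
    simplifier from rearranging fractions and leaves a polynomial identity.\<close>
  define h :: complex where "h = 1 / 2"
  have h: "cnj h = h" "h * 2 = 1" unfolding h_def by simp_all
  show ?thesis
    unfolding mult.assoc 2 h_def[symmetric]
    by (simp add: algebra_simps ii h)
qed

lemma solution:
  assumes f: "smooth_circle_SU2 f"
  shows "\<exists>u. smooth_circle_SU2 u \<and> (\<forall>t. \<forall>x\<in>SU2. P_op p0 lam \<delta> \<alpha> q s u t x = f t x)"
proof -
  define F where "F = (\<lambda>z. f (fst z) (retr (snd z)))"
  have F: "smooth_on tube F" unfolding F_def by (rule smooth_extension[OF f])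
  have Fper: "F (z + (2 * pi, 0)) = F z" if "z \<in> tube" for z
    using f retr_in_SU2[of "snd z"] that by (auto simp: F_def smooth_circle_SU2_def tube_def)
  have cF: "smooth_on tube (\<lambda>z. cnj (F z))"
    using F unfolding smooth_on_def by (intro allI Ck_on_bounded_linear[OF open_tube bounded_linear_cnj]) blast
  have cFper: "cnj (F (z + (2 * pi, 0))) = cnj (F z)" if "z \<in> tube" for z
    by (simp only: Fper[OF that])
  show ?thesis
  proof (rule linear_system[OF F Fper cF cFper], assumption, assumption)
    fix u v
    assume uv: "smooth_on tube u" "smooth_on tube v"
    "\<And>z. z \<in> tube \<Longrightarrow> u (z + (2 * pi, 0)) = u z"
    "\<And>z. z \<in> tube \<Longrightarrow> v (z + (2 * pi, 0)) = v z"
    "function_system F (\<lambda>z. cnj (F z)) u v"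
    define w where "w = (\<lambda>z. (1 / 2) * (u z + cnj (v z)))"
    have w: "smooth_on tube w"
      unfolding smooth_on_def w_def
      using uv(1,2) unfolding smooth_on_def
      by (intro allI Ck_on_mult[OF open_tube] Ck_on_const[OF open_tube] Ck_on_add[OF open_tube])
        (auto intro: Ck_on_bounded_linear[OF open_tube bounded_linear_cnj])
    have dw: "(w has_derivative (\<lambda>h. (1 / 2) * (frechet_derivative u (at z) h + cnj (frechet_derivative v (at z) h)))) (at z)"
      if "z \<in> tube" for z
      unfolding w_def
      by (rule has_derivative_mult_right[OF has_derivative_add[OF smooth_on_has_derivative[OF uv(1) that]
            bounded_linear.has_derivative[OF bounded_linear_cnj smooth_on_has_derivative[OF uv(2) that]]]])
    show ?thesis
    proof (intro exI conjI allI ballI)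
      show "smooth_circle_SU2 (\<lambda>t x. w (t, x))"
        by (rule smooth_circle_SU2I[OF w]) (simp add: w_def uv(3,4))
      fix t :: real and x :: "complex ^ 2 ^ 2" assume x: "x \<in> SU2"
      let ?z = "(t, x)"
      have z: "?z \<in> tube" using x SU2_subset_col_ne by (auto simp: tube_def)
      have fw: "frechet_derivative w (at ?z) h = (1 / 2) * (frechet_derivative u (at ?z) h + cnj (frechet_derivative v (at ?z) h))" for h
        unfolding frechet_derivative_at[OF dw[OF z], symmetric] ..
      have lin: "linear (frechet_derivative w (at ?z))"
        by (rule frechet_derivative_linear[OF w z])
      have "((\<lambda>\<tau>. (\<tau>, x)) has_derivative (\<lambda>h. (h, 0))) (at t)"
        by (intro has_derivative_Pair has_derivative_ident has_derivative_const)
      from has_derivative_compose[OF this smooth_on_has_derivative[OF w z]]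
      have "((\<lambda>\<tau>. w (\<tau>, x)) has_derivative (\<lambda>h. frechet_derivative w (at ?z) (h, 0))) (at t)" .
      moreover have "(\<lambda>h. frechet_derivative w (at ?z) (h, 0)) = (\<lambda>h. h *\<^sub>R frechet_derivative w (at ?z) (1, 0))"
      proof
        fix h
        have "(h, 0) = h *\<^sub>R (1 :: real, 0 :: complex ^ 2 ^ 2)" by simp
        then show "frechet_derivative w (at ?z) (h, 0) = h *\<^sub>R frechet_derivative w (at ?z) (1, 0)"
          by (simp only: linear_scale[OF lin])
      qed
      ultimately have "((\<lambda>\<tau>. w (\<tau>, x)) has_vector_derivative frechet_derivative w (at ?z) (1, 0)) (at t)"
        unfolding has_vector_derivative_def by (simp only:)
      then have dt: "vector_derivative (\<lambda>\<tau>. w (\<tau>, x)) (at t) = frechet_derivative w (at ?z) (1, 0)"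
        by (rule vector_derivative_at)
      \<comment> \<open>Translation by \<open>omega \<theta>\<close> is
        \<open>rot (\<theta> / 2)\<close>; this is the origin of the factor 1/2 in the expression of
        \<open>d0\<close> through \<open>turn\<close>.\<close>
      have "((\<lambda>\<theta>. (1 / 2) * \<theta>) has_vector_derivative (1 / 2 :: real)) (at 0)"
        by (auto intro!: derivative_eq_intros simp: has_vector_derivative_def)
      from vector_diff_chain_at[OF this rot_flow_derivative[OF w z, of "(1 / 2) * 0"]]
      have "((\<lambda>\<theta>. w (rot ((1 / 2) * \<theta>) ?z)) has_vector_derivative
          (1 / 2 :: real) *\<^sub>R frechet_derivative w (at ?z) (turn ?z)) (at 0)"
        by (simp only: o_def mult_zero_right rot_0)
      moreover have half: "2 * ((1 / 2) * \<theta>) = \<theta>" for \<theta> :: real by simp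
      ultimately have "((\<lambda>\<theta>. w (t, x ** omega \<theta>)) has_vector_derivative
          (1 / 2 :: real) *\<^sub>R frechet_derivative w (at ?z) (turn ?z)) (at 0)"
        by (simp only: rot_Pair half)
      from vector_derivative_at[OF this]
      have dx: "d0 (\<lambda>x. w (t, x)) x = (\<i> / 2) * frechet_derivative w (at ?z) (turn ?z)"
        unfolding d0_def by (simp add: scaleR_conv_of_real)
      have F: "F ?z = f t x" unfolding F_def by (simp add: retr_SU2 x)
      show "P_op p0 lam \<delta> \<alpha> q s (\<lambda>t x. w (t, x)) t x = f t x"
        unfolding P_op_def dt dx fw F
          uv(5)[unfolded function_system_def, rule_format, OF z, THEN conjunct1]
          uv(5)[unfolded function_system_def, rule_format, OF z, THEN conjunct2]
        unfolding w_def fst_conv F by (rule symmetrization)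
    qed
  qed
qed

end

section \<open>Global solvability\<close>

theorem theorem6p1:
  fixes p0 lam \<delta> s0 q0 :: real
    and \<alpha> A0 B0 C0 :: complex
    and q s :: "real \<Rightarrow> real"
  assumes "\<alpha> \<noteq> 0"
    and "smooth_circle q" and "smooth_circle s"
    and "\<forall>t. q t \<ge> 0" and "\<exists>t. q t \<noteq> 0"
    and s0: "s0 = integral {0..2 * pi} s"
    and q0: "q0 = integral {0..2 * pi} q"
    and A0: "A0 = of_real s0 + \<i> * of_real \<delta> * of_real q0"
    and B0: "B0 = \<alpha> * of_real q0"
    and C0: "C0 = 2 * of_real pi * of_real p0 + \<i> * of_real lam * of_real q0"
    and I: "cmod \<alpha> \<noteq> \<bar>\<delta>\<bar>"
    and II: "\<not> (\<exists>m\<in>half_ints. \<exists>k :: int.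
        Re (A0 * (2 * of_real pi * of_int k + of_real m * cnj C0)) = 0 \<and>
        (cmod (2 * of_real pi * of_int k + of_real m * C0))\<^sup>2 = (cmod A0)\<^sup>2 - (cmod B0)\<^sup>2)"
    and III: "\<exists>M :: real. M > 0 \<and> (\<forall>l\<in>half_nats. bracket l \<ge> M \<longrightarrow> (\<forall>m\<in>weights l.
        min (cmod (exp (- rho lam \<delta> \<alpha> m * of_real q0)
                   - exp (2 * of_real pi * \<i> * of_real m * of_real p0 + of_real s0)))
            (cmod (1 - exp (- rho lam \<delta> \<alpha> m * of_real q0
                   + 2 * of_real pi * \<i> * of_real m * of_real p0 + of_real s0)))
        \<ge> bracket l powr (- M)))"
  shows "\<forall>f. smooth_circle_SU2 f \<longrightarrow>
    (\<exists>u. smooth_circle_SU2 u \<and> (\<forall>t. \<forall>x\<in>SU2. P_op p0 lam \<delta> \<alpha> q s u t x = f t x))"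
proof -
  interpret setting p0 lam \<delta> \<alpha> q s s0 q0
    by unfold_locales (use assms in auto)
  show ?thesis using solution by blast
qed

end
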